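(* Let $t>0$, $m\in\{0,1\}$, $n\ge1$ an integer, $v_0=\frac n2$, $v_1=n+1$. Then $$P\{X_m(\Gamma(t))\in dx\,|\,N(t)=n\}=\frac{dx}{B(1,v_m)\,\pi}\int_0^t\frac{ds}{\sqrt{s(t-s)}}\int_0^1(1-w)^{v_m-1}\,\frac{1}{\pi}\frac{\mathbf{1}_{\{|x|<cs\sqrt{w}\}}}{\sqrt{c^2s^2w-x^2}}\,dw,\qquad x\in\mathbb{R}.$$
   Context: Fix $c>0$, $\lambda>0$. For $m\in\{0,1\}$ let $X_m(s)=c\sum_{j=1}^{N(s)+1}(s_j-s_{j-1})\cos\theta_j$, where $N$ is a homogeneous Poisson process of rate $\lambda$ with event times $s_1<s_2<\cdots$, $s_0=0$, $s_{N(s)+1}=s$, and the $\theta_j$ are i.i.d. (independent of $N$) with density $\frac{\Gamma(m+1)}{\sqrt\pi\,\Gamma(m+\frac12)}\sin^{2m}\theta$ on $(0,\pi)$. For $n\ge1$ let $p_n^m(x,s)$ be the density of $X_m(s)$ given $N(s)=n$; explicitly $p_n^m(x,s)=\frac{\Gamma(v_m)\Gamma(v_m+1)}{2\pi\Gamma(2v_m)}\left(\frac{2}{cs}\right)^{2v_m}(c^2s^2-x^2)^{v_m-\frac12}$ for $|x|<cs$ and $0$ otherwise. $\Gamma(t)=\int_0^t\mathbf{1}_{\{B(s)>0\}}ds$ (not to be confused with the Gamma function) is the sojourn time on the positive half-line of a standard Brownian motion $B$, independent of $X_m$ and $N$; its density is the arcsine law $\gamma(s)=\frac{1}{\pi\sqrt{s(t-s)}}$,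 $0<s<t$. For an independent positive random time $T$, the conditional law $P\{X_m(T)\in dx\,|\,N(t)=n\}$ means the law of $X_m$ at time $T$ when the number of Poisson events up to that time is fixed to be $n$, i.e. $dx\int_0^\infty p_n^m(x,s)\,P\{T\in ds\}$. $B(a,b)=\Gamma(a)\Gamma(b)/\Gamma(a+b)$ is the Beta function. Equalities of laws are equalities of Lebesgue densities (a.e. $x$). *)

theory Defs
  imports "HOL-Probability.Probability"
begin

text \<open>
  A homogeneous Poisson process of rate \<open>lam\<close> is given by its event times
  \<open>S 1 < S 2 < \<dots>\<close> (with \<open>S 0 = 0\<close>), whose gaps are i.i.d. exponential.
\<close>

definition poisson_event_times ::
    "'a measure \<Rightarrow> real \<Rightarrow> (nat \<Rightarrow> 'a \<Rightarrow> real) \<Rightarrow> bool" where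
  "poisson_event_times M lam S \<longleftrightarrow>
     (\<forall>\<omega>\<in>space M. S 0 \<omega> = 0) \<and>
     prob_space.indep_vars M (\<lambda>_. borel) (\<lambda>j \<omega>. S (Suc j) \<omega> - S j \<omega>) UNIV \<and>
     (\<forall>j. distributed M lborel (\<lambda>\<omega>. S (Suc j) \<omega> - S j \<omega>)
            (\<lambda>x. ennreal (exponential_density lam x)))"

text \<open>
  Almost surely only finitely many events occur before time \<open>s\<close>; on the exceptional null set,
  where the set below may be infinite, its cardinality is 0 by convention.
\<close>

definition event_count :: "(nat \<Rightarrow> 'a \<Rightarrow> real) \<Rightarrow> real \<Rightarrow> 'a \<Rightarrow> nat" where
  "event_count S s \<omega> = card {j. 1 \<le> j \<and> S j \<omega> \<le> s}"

definition direction_density :: "nat \<Rightarrow> real \<Rightarrow> real" where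
  "direction_density m \<theta> =
     (if 0 < \<theta> \<and> \<theta> < pi
      then Gamma (real m + 1) / (sqrt pi * Gamma (real m + 1 / 2)) * sin \<theta> ^ (2 * m)
      else 0)"

text \<open>The directions are indexed by the positive integers.\<close>

definition iid_directions ::
    "'a measure \<Rightarrow> nat \<Rightarrow> (nat \<Rightarrow> 'a \<Rightarrow> real) \<Rightarrow> bool" where
  "iid_directions M m \<theta> \<longleftrightarrow>
     prob_space.indep_vars M (\<lambda>_. borel) \<theta> {1..} \<and>
     (\<forall>j\<ge>1. distributed M lborel (\<theta> j) (\<lambda>x. ennreal (direction_density m x)))"

text \<open>
  \<open>switch_time S s \<omega> j\<close> is \<open>s\<^sub>j\<close> in the formula for the motion observed up to
  time \<open>s\<close>, i.e. with \<open>s\<^sub>j\<close> replaced by \<open>s\<close> for \<open>j = N(s) + 1\<close>.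
\<close>

definition switch_time :: "(nat \<Rightarrow> 'a \<Rightarrow> real) \<Rightarrow> real \<Rightarrow> 'a \<Rightarrow> nat \<Rightarrow> real" where
  "switch_time S s \<omega> j = (if j \<le> event_count S s \<omega> then S j \<omega> else s)"

definition motion ::
    "real \<Rightarrow> (nat \<Rightarrow> 'a \<Rightarrow> real) \<Rightarrow> (nat \<Rightarrow> 'a \<Rightarrow> real) \<Rightarrow> real \<Rightarrow> 'a \<Rightarrow> real" where
  "motion c S \<theta> s \<omega> =
     c * (\<Sum>j = 1..event_count S s \<omega> + 1.
            (switch_time S s \<omega> j - switch_time S s \<omega> (j - 1)) * cos (\<theta> j \<omega>))"

text \<open>
  \<open>p\<close> is a jointly measurable version of the conditional densities
  \<open>x \<mapsto> p x s\<close> of \<open>X s\<close> given \<open>N s = n\<close>, \<open>s > 0\<close>.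
\<close>

definition is_cond_density ::
    "'a measure \<Rightarrow> (real \<Rightarrow> 'a \<Rightarrow> real) \<Rightarrow> (real \<Rightarrow> 'a \<Rightarrow> nat) \<Rightarrow> nat \<Rightarrow> (real \<Rightarrow> real \<Rightarrow> real) \<Rightarrow> bool"
  where
  "is_cond_density M X N n p \<longleftrightarrow>
     (\<lambda>(x, s). p x s) \<in> borel_measurable (borel \<Otimes>\<^sub>M restrict_space borel {0<..}) \<and>
     (\<forall>s>0. (\<forall>x. 0 \<le> p x s) \<and>
        distr (uniform_measure M {\<omega> \<in> space M. N s \<omega> = n}) borel (X s)
          = density lborel (\<lambda>x. ennreal (p x s)))"

text \<open>
  The density of the position at an independent positive random time \<open>T\<close> when the number of
  events up to that time is fixed: the densities \<open>p x s\<close> mixed over the law of \<open>T\<close>.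
  This is not conditioning on the event \<open>N T = n\<close>, which would reweight the
  law of \<open>T\<close>.
\<close>

definition fixed_count_density ::
    "'a measure \<Rightarrow> (real \<Rightarrow> real \<Rightarrow> real) \<Rightarrow> ('a \<Rightarrow> real) \<Rightarrow> real \<Rightarrow> ennreal" where
  "fixed_count_density M p T x = (\<integral>\<^sup>+ s\<in>{0<..}. ennreal (p x s) \<partial>distr M borel T)"

text \<open>
  Continuity is required of every path, so that the sojourn time is
  measurable without completing \<open>M\<close>.
\<close>

definition brownian_motion :: "'a measure \<Rightarrow> (real \<Rightarrow> 'a \<Rightarrow> real) \<Rightarrow> bool" where
  "brownian_motion M B \<longleftrightarrow>
     (\<forall>s\<ge>0. B s \<in> borel_measurable M) \<and>
     (AE \<omega> in M. B 0 \<omega> = 0) \<and>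
     (\<forall>\<omega>\<in>space M. continuous_on {0..} (\<lambda>s. B s \<omega>)) \<and>
     (\<forall>r s. 0 \<le> r \<and> r < s \<longrightarrow>
        distributed M lborel (\<lambda>\<omega>. B s \<omega> - B r \<omega>)
          (\<lambda>x. ennreal (normal_density 0 (sqrt (s - r)) x))) \<and>
     (\<forall>\<tau> :: nat \<Rightarrow> real. 0 \<le> \<tau> 0 \<and> strict_mono \<tau> \<longrightarrow>
        prob_space.indep_vars M (\<lambda>_. borel) (\<lambda>i \<omega>. B (\<tau> (Suc i)) \<omega> - B (\<tau> i) \<omega>) UNIV)"

text \<open>
  Independence of random elements of possibly different types (the library's \<open>indep_var\<close>
  needs a common type).
\<close>

definition indep_elements ::
    "'a measure \<Rightarrow> 'b measure \<Rightarrow> ('a \<Rightarrow> 'b) \<Rightarrow> 'c measure \<Rightarrow> ('a \<Rightarrow> 'c) \<Rightarrow> bool" where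
  "indep_elements M K X L Y \<longleftrightarrow>
     X \<in> measurable M K \<and> Y \<in> measurable M L \<and>
     prob_space.indep_set M
       {X -` A \<inter> space M | A. A \<in> sets K} {Y -` A \<inter> space M | A. A \<in> sets L}"

definition sojourn_time :: "(real \<Rightarrow> 'a \<Rightarrow> real) \<Rightarrow> real \<Rightarrow> 'a \<Rightarrow> real" where
  "sojourn_time B t \<omega> = (LINT s:{0..t}|lborel. indicator {0<..} (B s \<omega>))"

definition shape :: "nat \<Rightarrow> nat \<Rightarrow> real" where
  "shape m n = (if m = 0 then real n / 2 else real n + 1)"

end

theory Submission
  imports Defs "HOL-Computational_Algebra.Computational_Algebra"
begin

text \<open>
  Every law involved has bounded support and is identified by its moments.

  Given \<open>N(s) = n\<close>, the shifted position \<open>X(s) + c s\<close> is \<open>c\<close> times the sum of the gaps, each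
  weighted with \<open>1 + cos \<theta>\<close>. All terms are nonnegative and the gaps are uniform on a simplex, so up to
  factorials the moments of \<open>X(s) + c s\<close> are the coefficients of the \<open>(n+1)\<close>-st power of the generating function
  \<open>E (1 - z (1 + cos \<theta>))\<^sup>-\<^sup>1\<close>. This is a binomial series for \<open>m = 0\<close> and the square of a Catalan
  generating function for \<open>m = 1\<close>; in both cases the coefficients are the moments of the claimed
  density.

  The moments of the sojourn time \<open>\<Gamma>(1)\<close> are read off at an independent exponential time: by Brownian
  scaling, \<open>E \<Gamma>(1) ^ r\<close> is the probability that a random walk, whose steps are the increments of Brownian
  motion over independent exponential times, stays positive for \<open>r\<close> steps. Decomposing the walk at its
  first maximum shows that the convolution square of this sequence is constantly \<open>1\<close>, which
  characterises the moments of the arcsine law.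
\<close>

text \<open>The shift by \<open>c * s\<close> keeps the flight computation free of integrability
  conditions: every integrand is nonnegative, so moments are \<open>nn_integral\<close>s and Tonelli
  applies. Conditioning on N(s) = n is not done by describing the spacings; moments are computed on
  the event, with exponential gaps, and divided by its probability, the moment of order 0. Divided
  powers organise this: x^i / i! convolved with x^j / j! is x^(i+j+1) / (i+j+1)!, so the factorials
  of the multinomial expansion cancel against the simplex integrals and ordinary generating
  functions multiply.

  The exponential time has a similar effect for Brownian motion: averaging over it turns the
  constraint that the gaps sum to less than t into independent exponential gaps.

  The two laws meet only in the last step, where the densities are mixed over the law of
  \<Gamma>(t). A conditional density is determined only up to an x-null set for each s, so null sets
  have to be exchanged by Fubini, and the Lebesgue density of the arcsine law makes an s-null set
  harmless.\<close>

section \<open>Laws with bounded support and Beta integrals\<close>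

text \<open>On [0, K] the Taylor polynomial of order n approximates the characteristic function at u
  up to 2 (|u| K)^n / n!, which tends to 0, so equal moments force equal characteristic functions.
  Moments appear as \<open>nn_integral\<close>s because that is how both sides are computed
  later.\<close>

lemma measure_eqI_moments:
  fixes \<mu> \<nu> :: "real measure" and K :: real
  assumes \<mu>: "prob_space \<mu>" "sets \<mu> = sets borel" "AE x in \<mu>. 0 \<le> x \<and> x \<le> K"
    and \<nu>: "prob_space \<nu>" "sets \<nu> = sets borel" "AE x in \<nu>. 0 \<le> x \<and> x \<le> K"
    and moments: "\<And>k. (\<integral>\<^sup>+ x. ennreal (x ^ k) \<partial>\<mu>) = (\<integral>\<^sup>+ x. ennreal (x ^ k) \<partial>\<nu>)"
  shows "\<mu> = \<nu>"
proof (rule Levy_uniqueness)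
  have rd: "real_distribution \<rho>" if "prob_space \<rho>" "sets \<rho> = sets borel" for \<rho> :: "real measure"
    using that sets_eq_imp_space_eq[of \<rho> borel]
    by (auto simp: real_distribution_def real_distribution_axioms_def)
  show R: "real_distribution \<mu>" "real_distribution \<nu>"
    using rd \<mu> \<nu> by auto
  have bound: "cmod (char \<rho> u - (\<Sum>k\<le>n. ((\<i> * u) ^ k / fact k) * enn2real (\<integral>\<^sup>+ x. ennreal (x ^ k) \<partial>\<rho>)))
      \<le> 2 * ((\<bar>u\<bar> * \<bar>K\<bar>) ^ n / fact n)"
    if \<rho>: "prob_space \<rho>" "sets \<rho> = sets borel" "AE x in \<rho>. 0 \<le> x \<and> x \<le> K" for \<rho> u n
  proof -
    interpret real_distribution \<rho> using rd \<rho> by auto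
    have [measurable_cong]: "sets \<rho> = sets borel" using \<rho> by simp
    have int: "integrable \<rho> (\<lambda>x. x ^ k)" for k
    proof (rule integrable_const_bound[where B = "\<bar>K\<bar> ^ k"])
      show "AE x in \<rho>. norm (x ^ k) \<le> \<bar>K\<bar> ^ k"
        using \<rho>(3) by eventually_elim (auto simp: power_abs[symmetric] intro!: power_mono)
    qed measurable
    have e: "expectation (\<lambda>x. x ^ k) = enn2real (\<integral>\<^sup>+ x. ennreal (x ^ k) \<partial>\<rho>)" for k
      using \<rho>(3) by (intro integral_eq_nn_integral) (auto elim!: eventually_mono)
    have "expectation (\<lambda>x. \<bar>x\<bar> ^ n) \<le> expectation (\<lambda>x. \<bar>K\<bar> ^ n)"
    proof (rule integral_mono_AE)
      show "integrable \<rho> (\<lambda>x. \<bar>x\<bar> ^ n)" using int[of n] by (simp add: power_abs[symmetric])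
      show "AE x in \<rho>. \<bar>x\<bar> ^ n \<le> \<bar>K\<bar> ^ n"
        using \<rho>(3) by eventually_elim (auto intro!: power_mono)
    qed simp
    then have le: "expectation (\<lambda>x. \<bar>x\<bar> ^ n) \<le> \<bar>K\<bar> ^ n" using prob_space by simp
    have "cmod (char \<rho> u - (\<Sum>k\<le>n. ((\<i> * u) ^ k / fact k) * expectation (\<lambda>x. x ^ k)))
        \<le> (2 * \<bar>u\<bar> ^ n / fact n) * expectation (\<lambda>x. \<bar>x\<bar> ^ n)"
      by (rule char_approx1) (rule int)
    also have "\<dots> \<le> (2 * \<bar>u\<bar> ^ n / fact n) * \<bar>K\<bar> ^ n"
      using le by (intro mult_left_mono) auto
    finally show ?thesis by (simp add: e power_mult_distrib)
  qed
  show "char \<mu> = char \<nu>"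
  proof
    fix u
    have "cmod (char \<mu> u - char \<nu> u) \<le> 4 * ((\<bar>u\<bar> * \<bar>K\<bar>) ^ n / fact n)" for n
    proof -
      let ?S = "\<Sum>k\<le>n. ((\<i> * u) ^ k / fact k) * enn2real (\<integral>\<^sup>+ x. ennreal (x ^ k) \<partial>\<mu>)"
      have "cmod (char \<mu> u - ?S) \<le> 2 * ((\<bar>u\<bar> * \<bar>K\<bar>) ^ n / fact n)"
        by (rule bound[OF \<mu>])
      moreover have "cmod (char \<nu> u - ?S) \<le> 2 * ((\<bar>u\<bar> * \<bar>K\<bar>) ^ n / fact n)"
        using bound[OF \<nu>, of u n] by (simp only: moments)
      ultimately show ?thesis
        using norm_triangle_ineq4[of "char \<mu> u - ?S" "char \<nu> u - ?S"] by simp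
    qed
    moreover have "(\<lambda>n. 4 * ((\<bar>u\<bar> * \<bar>K\<bar>) ^ n / fact n)) \<longlonglongrightarrow> 4 * 0"
      using summable_LIMSEQ_zero[OF summable_exp[of "\<bar>u\<bar> * \<bar>K\<bar>"]]
      by (intro tendsto_mult tendsto_const) (simp add: field_simps)
    ultimately have "cmod (char \<mu> u - char \<nu> u) \<le> 0"
      by (intro LIMSEQ_le_const) auto
    then show "char \<mu> u = char \<nu> u" by simp
  qed
qed

text \<open>Serves four times: for the arcsine moments, for integrals over simplices, for the
  moments of the conditional density and for the inner w-integral of the theorem. The substitution x
  = a + (b - a) u reduces it to the unit interval.\<close>

lemma nn_integral_Beta:
  fixes a b p q :: real
  assumes "a < b" "0 < p" "0 < q"
  shows "(\<integral>\<^sup>+ x\<in>{a<..<b}. ennreal ((x - a) powr (p - 1) * (b - x) powr (q - 1)) \<partial>lborel)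
    = ennreal ((b - a) powr (p + q - 1) * Beta p q)"
proof -
  let ?f = "\<lambda>x. ennreal ((x - a) powr (p - 1) * (b - x) powr (q - 1)) * indicator {a<..<b} x"
  have unit: "(\<integral>\<^sup>+ u\<in>{0<..<1}. ennreal (u powr (p - 1) * (1 - u) powr (q - 1)) \<partial>lborel) = ennreal (Beta p q)"
  proof -
    have "((\<lambda>t. t powr (p - 1) * (1 - t) powr (q - 1)) has_integral Beta p q) {0<..<1}"
      using has_integral_Beta_real[of p q] assms by (simp add: has_integral_Icc_iff_Ioo)
    then show ?thesis by (intro nn_integral_has_integral_lebesgue') auto
  qed
  have "(\<integral>\<^sup>+ x. ?f x \<partial>lborel) = ennreal \<bar>b - a\<bar> * (\<integral>\<^sup>+ u. ?f (a + (b - a) * u) \<partial>lborel)"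
    using assms by (intro nn_integral_real_affine) auto
  also have "(\<integral>\<^sup>+ u. ?f (a + (b - a) * u) \<partial>lborel) =
     (\<integral>\<^sup>+ u. ennreal ((b - a) powr (p + q - 2)) *
        (ennreal (u powr (p - 1) * (1 - u) powr (q - 1)) * indicator {0<..<1} u) \<partial>lborel)"
  proof (intro nn_integral_cong)
    fix u :: real
    have m: "a + (b - a) * u \<in> {a<..<b} \<longleftrightarrow> u \<in> {0<..<1}"
    proof -
      have "a + (b - a) * u < b \<longleftrightarrow> (b - a) * u < (b - a) * 1" by (simp add: algebra_simps)
      then show ?thesis using assms(1) by (auto simp: zero_less_mult_iff mult_less_cancel_left)
    qed
    show "?f (a + (b - a) * u) = ennreal ((b - a) powr (p + q - 2)) *
        (ennreal (u powr (p - 1) * (1 - u) powr (q - 1)) * indicator {0<..<1} u)"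
    proof (cases "u \<in> {0<..<1}")
      case True
      have e: "b - (a + (b - a) * u) = (b - a) * (1 - u)" by (simp add: algebra_simps)
      have "((b - a) * u) powr (p - 1) * ((b - a) * (1 - u)) powr (q - 1) =
         (b - a) powr (p + q - 2) * (u powr (p - 1) * (1 - u) powr (q - 1))"
        using True assms by (simp add: powr_mult powr_diff powr_add powr_numeral divide_simps power2_eq_square)
      then show ?thesis using True m e by (simp add: ennreal_mult)
    qed (use m in simp)
  qed
  also have "\<dots> = ennreal ((b - a) powr (p + q - 2)) * ennreal (Beta p q)"
    by (subst nn_integral_cmult) (auto simp: unit)
  also have "ennreal \<bar>b - a\<bar> * \<dots> = ennreal ((b - a) powr (p + q - 1) * Beta p q)"
  proof -
    have "(b - a) powr (p + q - 1) = (b - a) * (b - a) powr (p + q - 2)"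
      using assms powr_add[of "b - a" 1 "p + q - 2"] by (simp add: algebra_simps)
    moreover have "0 \<le> Beta p q" using assms by (simp add: Beta_def)
    ultimately show ?thesis using assms by (simp add: ennreal_mult'' ennreal_mult mult.assoc)
  qed
  finally show ?thesis .
qed

lemma Beta_add_nat:
  fixes p q :: real
  assumes "0 < p" "0 < q"
  shows "Beta (p + real k) q = Beta p q * pochhammer p k / pochhammer (p + q) k"
proof -
  have "x \<notin> \<int>\<^sub>\<le>\<^sub>0" if "0 < x" for x :: real using that by auto
  then have "pochhammer p k * Gamma p = Gamma (p + real k)"
    "pochhammer (p + q) k * Gamma (p + q) = Gamma (p + q + real k)"
    using assms pochhammer_Gamma[of p k] pochhammer_Gamma[of "p + q" k]
    by (auto simp: Gamma_eq_zero_iff)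
  moreover have "0 < Gamma p" "0 < Gamma (p + q)" "0 < Gamma (p + q + real k)"
    "0 < pochhammer (p + q) k"
    using assms by (auto intro!: Gamma_real_pos pochhammer_pos)
  ultimately show ?thesis
    by (simp add: Beta_def ac_simps flip: \<open>pochhammer (p + q) k * Gamma (p + q) = Gamma (p + q + real k)\<close>)
qed

lemma nn_integral_Icc_continuous:
  fixes f :: "real \<Rightarrow> real"
  assumes "continuous_on {a..b} f" "\<And>x. x \<in> {a..b} \<Longrightarrow> 0 \<le> f x"
  shows "(\<integral>\<^sup>+ x\<in>{a..b}. ennreal (f x) \<partial>lborel) = ennreal (integral {a..b} f)"
  using assms by (intro nn_integral_has_integral_lebesgue' integrable_integral integrable_continuous_real)

text \<open>The derivative of \<open>sin \<theta> * (1 + cos \<theta>) ^ k\<close> gives the recursion.\<close>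

lemma integral_one_plus_cos_power:
  "integral {0..pi} (\<lambda>\<theta>. (1 + cos \<theta>) ^ k) = pi * 2 ^ k * pochhammer (1 / 2) k / fact k"
proof (induction k)
  case (Suc k)
  have "((\<lambda>\<theta>. (real k + 1) * (1 + cos \<theta>) ^ Suc k - (2 * real k + 1) * (1 + cos \<theta>) ^ k) has_integral
     (sin pi * (1 + cos pi) ^ k - sin 0 * (1 + cos 0) ^ k)) {0..pi}"
  proof (rule fundamental_theorem_of_calculus)
    fix x :: real
    have s: "sin x * sin x = (1 + cos x) * (1 - cos x)"
      using sin_cos_squared_add3[of x] by (simp add: algebra_simps)
    have "((\<lambda>\<theta>. sin \<theta> * (1 + cos \<theta>) ^ k) has_real_derivative
       cos x * (1 + cos x) ^ k - real k * (sin x * sin x) * (1 + cos x) ^ (k - 1)) (at x)"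
      by (auto intro!: derivative_eq_intros simp: algebra_simps)
    also have "cos x * (1 + cos x) ^ k - real k * (sin x * sin x) * (1 + cos x) ^ (k - 1) =
       (real k + 1) * (1 + cos x) ^ Suc k - (2 * real k + 1) * (1 + cos x) ^ k"
      \<comment> \<open>For k = 0 the truncated exponent \<open>k - 1\<close> is harmless, since its
        power is multiplied by \<open>real k\<close>.\<close>
      unfolding s by (cases k) (auto simp: algebra_simps)
    finally show "((\<lambda>\<theta>. sin \<theta> * (1 + cos \<theta>) ^ k) has_vector_derivative
       (real k + 1) * (1 + cos x) ^ Suc k - (2 * real k + 1) * (1 + cos x) ^ k) (at x within {0..pi})"
      by (simp add: has_real_derivative_iff_has_vector_derivative has_vector_derivative_at_within)
  qed simp
  then have "integral {0..pi} (\<lambda>\<theta>. (real k + 1) * (1 + cos \<theta>) ^ Suc k - (2 * real k + 1) * (1 + cos \<theta>) ^ k) = 0"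
    by (intro integral_unique) simp
  moreover have "(\<lambda>\<theta>. (1 + cos \<theta>) ^ j) integrable_on {0..pi}" for j
    by (intro integrable_continuous_real continuous_intros)
  note i = this
  have "integral {0..pi} (\<lambda>\<theta>. (real k + 1) * (1 + cos \<theta>) ^ Suc k - (2 * real k + 1) * (1 + cos \<theta>) ^ k)
    = (real k + 1) * integral {0..pi} (\<lambda>\<theta>. (1 + cos \<theta>) ^ Suc k) - (2 * real k + 1) * integral {0..pi} (\<lambda>\<theta>. (1 + cos \<theta>) ^ k)"
    by (subst Henstock_Kurzweil_Integration.integral_diff) (auto intro!: integrable_on_cmult_left i simp del: power_Suc)
  ultimately have "(real k + 1) * integral {0..pi} (\<lambda>\<theta>. (1 + cos \<theta>) ^ Suc k) = (2 * real k + 1) * (pi * 2 ^ k * pochhammer (1 / 2) k / fact k)"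
    using Suc.IH by simp
  then show ?case
    by (simp add: pochhammer_Suc divide_simps del: power_Suc) (simp add: algebra_simps)
qed simp

section \<open>Moment generating functions\<close>

text \<open>The power series of (1 - X)^(-r).\<close>

definition binomial_fps :: "real \<Rightarrow> real fps" where
  "binomial_fps r = Abs_fps (\<lambda>k. pochhammer r k / fact k)"

lemma binomial_fps_nth [simp]: "binomial_fps r $ k = pochhammer r k / fact k"
  by (simp add: binomial_fps_def)

text \<open>Since pochhammer r k / k! is (-1)^k times the binomial coefficient of -r over k, this is
  Vandermonde's identity.\<close>

lemma binomial_fps_add: "binomial_fps (r + s) = binomial_fps r * binomial_fps s"
proof (rule fps_ext)
  fix n
  have g: "pochhammer x k / fact k = (-1) ^ k * (- x gchoose k)" for x :: real and k
    by (simp add: gbinomial_pochhammer power_mult_distrib[symmetric])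
  have "(binomial_fps r * binomial_fps s) $ n = (\<Sum>k=0..n. (-1) ^ n * ((- r gchoose k) * (- s gchoose (n - k))))"
    unfolding fps_mult_nth binomial_fps_nth g
    by (intro sum.cong refl) (auto simp: power_add[symmetric] algebra_simps)
  also have "\<dots> = (-1) ^ n * (- (r + s) gchoose n)"
    using gbinomial_Vandermonde[of "- r" "- s" n] by (simp add: sum_distrib_left[symmetric])
  finally show "binomial_fps (r + s) $ n = (binomial_fps r * binomial_fps s) $ n"
    by (simp add: g)
qed

lemma binomial_fps_1: "(1 - fps_X) * binomial_fps 1 = 1"
  by (rule fps_ext) (auto simp: algebra_simps pochhammer_fact[symmetric])

lemma binomial_fps_0: "binomial_fps 0 = 1"
  by (rule fps_ext) (auto simp: pochhammer_0_left)

lemma binomial_fps_power: "binomial_fps r ^ n = binomial_fps (real n * r)"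
  by (induction n) (auto simp: binomial_fps_0 binomial_fps_add[symmetric] algebra_simps)

text \<open>The square of (1 - X)^(-1/2) is the geometric series. The sequence is the candidate for
  the probabilities \<open>stay_prob\<close> of the random walk.\<close>

lemma half_convolution:
  "(\<Sum>k\<le>n. (pochhammer (1 / 2) k / fact k) * (pochhammer (1 / 2) (n - k) / fact (n - k))) = (1 :: real)"
proof -
  have "(binomial_fps (1/2) * binomial_fps (1/2)) $ n = binomial_fps 1 $ n"
    by (simp add: binomial_fps_add[symmetric])
  then show ?thesis by (simp add: fps_mult_nth pochhammer_fact[symmetric] atMost_atLeast0)
qed

text \<open>For n > 0 the value at n occurs in the n-th equation only as 2 * p 0 * p n, so the
  earlier values determine it. The value at 0 has to be given, because -p solves the same
  equations.\<close>

lemma convolution_one_unique: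
  fixes p q :: "nat \<Rightarrow> real"
  assumes p: "\<And>n. (\<Sum>k\<le>n. p k * p (n - k)) = 1" and q: "\<And>n. (\<Sum>k\<le>n. q k * q (n - k)) = 1"
    and 0: "p 0 = 1" "q 0 = 1"
  shows "p n = q n"
proof (induction n rule: less_induct)
  case (less n)
  show ?case
  proof (cases "n = 0")
    case False
    have split: "(\<Sum>k\<le>n. r k * r (n - k)) = 2 * r n + (\<Sum>k\<in>{1..<n}. r k * r (n - k))" if "r 0 = 1" for r :: "nat \<Rightarrow> real"
    proof -
      have "{..n} = insert 0 (insert n {1..<n})" using False by auto
      then show ?thesis using False that by simp
    qed
    have "(\<Sum>k\<in>{1..<n}. p k * p (n - k)) = (\<Sum>k\<in>{1..<n}. q k * q (n - k))"
      using less by (intro sum.cong) auto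
    then show ?thesis using p[of n] q[of n] split[of p] split[of q] 0 by simp
  qed (use 0 in simp)
qed

section \<open>Powers of the generating functions\<close>

lemma Abs_fps_scale_power:
  fixes f :: "real fps"
  shows "(Abs_fps (\<lambda>k. c ^ k * f $ k) ^ n) $ k = c ^ k * (f ^ n) $ k"
proof (induction n arbitrary: k)
  case (Suc n)
  show ?case
    by (simp add: fps_mult_nth Suc sum_distrib_left)
       (auto intro!: sum.cong simp: power_add[symmetric] algebra_simps)
qed (auto simp: power_0_left)

text \<open>The coefficients of the \<open>r\<close>-th power of the solution \<open>C\<close> of \<open>C = 1 + X * C\<^sup>2 / 4\<close>.\<close>

definition ballot :: "nat \<Rightarrow> nat \<Rightarrow> real" where
  "ballot r k = (if k = 0 then 1 else real r * fact (2 * k + r - 1) / (4 ^ k * fact k * fact (k + r)))"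

lemma ballot_1: "ballot r (Suc 0) = real r / 4"
  by (simp add: ballot_def del: fact_Suc)

text \<open>The coefficient form of C^(r+1) = C^r + X * C^(r+2) / 4, which is the equation for C
  multiplied by C^r.\<close>

lemma ballot_rec: "ballot (Suc r) (Suc k) = ballot r (Suc k) + ballot (Suc (Suc r)) k / 4"
proof (cases k)
  case 0
  have "ballot s 0 = 1" for s by (simp add: ballot_def)
  then show ?thesis using 0 by (simp add: ballot_1 add_divide_distrib)
next
  case (Suc j)
  show ?thesis unfolding ballot_def Suc
    apply (simp add: divide_simps)
    apply (simp add: algebra_simps)
    done
qed

text \<open>The recursion lowers k at the price of raising r, hence an outer induction on k for all
  r and an inner one on r.\<close>

lemma ballot_fps:
  assumes C: "C = 1 + fps_const (1 / 4) * fps_X * C ^ 2"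
  shows "(C ^ r) $ k = ballot r k"
proof (induction k arbitrary: r)
  case 0
  have "C $ 0 = 1" by (subst C) simp
  then show ?case by (simp add: ballot_def fps_nth_power_0)
next
  case (Suc k)
  note IH = Suc
  show ?case
  proof (induction r)
    case 0
    then show ?case by (simp add: ballot_def)
  next
    case (Suc r)
    have "C ^ Suc r = C ^ r * (1 + fps_const (1 / 4) * fps_X * C ^ 2)"
      using C by (metis power_Suc2)
    also have "\<dots> = C ^ r + fps_X * (fps_const (1 / 4) * C ^ Suc (Suc r))"
      by (simp add: algebra_simps power2_eq_square)
    finally have "(C ^ Suc r) $ Suc k = (C ^ r) $ Suc k + (C ^ Suc (Suc r)) $ k / 4"
      by (simp del: power_Suc)
    then show ?case by (simp only: Suc IH ballot_rec)
  qed
qed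

text \<open>For m = 1 the variable cos \<theta> has the semicircle law. Here A is (1 - X)^(-1/2), so
  R = (1 - X) A is a square root of 1 - X, and C = 2 (1 - R) / X is the Catalan series at X / 4. The
  series in the second claim generates the moments of (1 + cos \<theta>) / 2; the claim rests on C^2
  = 4 (C - 1) / X.\<close>

lemma semicircle_fps:
  defines "A \<equiv> binomial_fps (1 / 2)"
  defines "C \<equiv> Abs_fps (\<lambda>k. 2 * (A $ k - A $ Suc k))"
  shows "C = 1 + fps_const (1 / 4) * fps_X * C ^ 2"
    and "Abs_fps (\<lambda>k. 8 * (A $ Suc k - A $ Suc (Suc k))) = C ^ 2"
proof -
  define R where "R = (1 - fps_X) * A"
  have AA: "A * A = binomial_fps 1" by (simp add: A_def binomial_fps_add[symmetric])
  have "R * R = (1 - fps_X) * ((1 - fps_X) * (A * A))" by (simp add: R_def algebra_simps)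
  then have RR: "R * R = 1 - fps_X" by (simp add: AA binomial_fps_1)
  have XC: "fps_X * C = fps_const 2 * (1 - R)"
  proof (rule fps_ext)
    fix k show "(fps_X * C) $ k = (fps_const 2 * (1 - R)) $ k"
      by (cases k) (auto simp: C_def R_def algebra_simps A_def)
  qed
  have c: "fps_const 2 = (2 :: real fps)" "fps_const 4 = (4 :: real fps)" "fps_const 8 = (8 :: real fps)"
    by (simp_all add: numeral_fps_const)
  have q: "fps_const (1/4) * (4 :: real fps) = 1" "fps_const (1/4) * (4 * x) = (x :: real fps)" for x
    by (auto simp: numeral_fps_const fps_const_mult mult.assoc[symmetric])
  \<comment> \<open>Squaring X C = 2 (1 - R) and using R^2 = 1 - X gives the quadratic equation for
    C up to a factor X.\<close>
  have XXC: "(fps_X * C) * (fps_X * C) = 4 * (fps_X * C - fps_X)"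
  proof -
    have "(fps_X * C) * (fps_X * C) = 4 * (1 - 2 * R + R * R)" unfolding XC c by (simp add: algebra_simps)
    also have "\<dots> = 4 * (2 * (1 - R) - fps_X)" unfolding RR by (simp add: algebra_simps)
    finally show ?thesis unfolding XC c .
  qed
  have "fps_X * (fps_X * C ^ 2) = fps_X * (4 * (C - 1))"
    using XXC by (simp add: power2_eq_square algebra_simps)
  then have X: "fps_X * C ^ 2 = 4 * (C - 1)" by simp
  show "C = 1 + fps_const (1 / 4) * fps_X * C ^ 2"
    using X by (simp add: mult.assoc right_diff_distrib q)
  show "Abs_fps (\<lambda>k. 8 * (A $ Suc k - A $ Suc (Suc k))) = C ^ 2"
  proof (rule fps_ext)
    fix k
    have "(C ^ 2) $ k = (fps_X * C ^ 2) $ Suc k" by simp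
    also have "\<dots> = 4 * C $ Suc k" unfolding X by (simp add: numeral_fps_const)
    finally show "Abs_fps (\<lambda>k. 8 * (A $ Suc k - A $ Suc (Suc k))) $ k = (C ^ 2) $ k"
      by (simp add: C_def)
  qed
qed

text \<open>The series is (1 - 2 X)^(-1/2), whose (n+1)-st power is (1 - 2 X)^(-(n+1)/2). The right
  side is the k-th moment of twice a Beta variable with both parameters (n + 1) / 2.\<close>

lemma moments_planar:
  "fact n * fact k / fact (k + n) * (Abs_fps (\<lambda>k. 2 ^ k * pochhammer (1 / 2) k / fact k) ^ Suc n) $ k
    = 2 ^ k * pochhammer (real n / 2 + 1 / 2) k / (pochhammer (real n + 1) k :: real)"
proof -
  have "(Abs_fps (\<lambda>k. 2 ^ k * pochhammer (1 / 2) k / fact k) ^ Suc n) $ k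
     = 2 ^ k * (binomial_fps (1 / 2) ^ Suc n) $ k"
    using Abs_fps_scale_power[of 2 "binomial_fps (1/2)" "Suc n" k] by simp
  also have "\<dots> = 2 ^ k * pochhammer (real n / 2 + 1 / 2) k / fact k"
    unfolding binomial_fps_power by (simp add: field_simps)
  moreover have "fact (k + n) = (fact n * pochhammer (real n + 1) k :: real)"
    using pochhammer_product'[of "1::real" n k] by (simp add: pochhammer_fact add_ac)
  ultimately show ?thesis by simp
qed

text \<open>The series is C^2 taken at 2 X, so its (n+1)-st power has ballot coefficients of order 2
  n + 2. The right side is the k-th moment of twice a Beta variable with both parameters n + 3/2;
  the two sides are compared through the ratios of consecutive terms.\<close>

lemma moments_semicircle:
  "fact n * fact k / fact (k + n) * (Abs_fps (\<lambda>k. 8 * 2 ^ k *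
     (pochhammer (1 / 2) (Suc k) / fact (Suc k) - pochhammer (1 / 2) (Suc (Suc k)) / fact (Suc (Suc k)))) ^ Suc n) $ k
    = 2 ^ k * pochhammer (real n + 3 / 2) k / (pochhammer (2 * real n + 3) k :: real)"
proof -
  let ?C = "Abs_fps (\<lambda>k. 2 * (binomial_fps (1 / 2) $ k - binomial_fps (1 / 2) $ Suc k))"
  have "Abs_fps (\<lambda>k. 8 * 2 ^ k * (pochhammer (1 / 2) (Suc k) / fact (Suc k) - pochhammer (1 / 2) (Suc (Suc k)) / fact (Suc (Suc k))))
    = Abs_fps (\<lambda>k. 2 ^ k * (?C ^ 2) $ k)"
    by (simp only: semicircle_fps(2)[symmetric]) (rule fps_ext, simp add: algebra_simps)
  then have "(Abs_fps (\<lambda>k. 8 * 2 ^ k *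
     (pochhammer (1 / 2) (Suc k) / fact (Suc k) - pochhammer (1 / 2) (Suc (Suc k)) / fact (Suc (Suc k)))) ^ Suc n) $ k
     = 2 ^ k * ((?C ^ 2) ^ Suc n) $ k"
    by (simp only: Abs_fps_scale_power)
  also have "\<dots> = 2 ^ k * ballot (2 * Suc n) k"
    by (simp only: power_mult[symmetric] ballot_fps[OF semicircle_fps(1)])
  also have "fact n * fact k / fact (k + n) * (2 ^ k * ballot (2 * Suc n) k)
    = 2 ^ k * pochhammer (real n + 3 / 2) k / (pochhammer (2 * real n + 3) k :: real)"
  proof (induction k)
    case 0 then show ?case by (simp add: ballot_def)
  next
    case (Suc k)
    have pos: "0 < pochhammer (2 * real n + 3) k" by (intro pochhammer_pos) simp
    \<comment> \<open>The ratio of consecutive ballot coefficients, cleared of denominators. The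
      case k = 0 is separate because \<open>ballot\<close> is defined by cases there.\<close>
    have b: "ballot (2 * Suc n) (Suc k) * (real (k + 1) * real (k + 2 * n + 3))
      = ballot (2 * Suc n) k * (real (k + n + 1) * (real n + 3 / 2 + real k))"
    proof (cases k)
      case 0
      have "ballot s 0 = 1" for s by (simp add: ballot_def)
      then show ?thesis using 0 ballot_1[of "2 * Suc n"] by (simp add: field_simps)
    next
      case (Suc j)
      then show ?thesis unfolding ballot_def
        by (simp add: divide_simps) (simp add: algebra_simps)
    qed
    define L where "L j = fact n * fact j / fact (j + n) * (2 ^ j * ballot (2 * Suc n) j)" for j
    have fk: "fact (Suc k) = real (k + 1) * fact k"
      and fkn: "fact (Suc k + n) = real (k + n + 1) * fact (k + n)" by simp_all
    have "L (Suc k) * real (k + 2 * n + 3) = (fact n * fact k / fact (Suc k + n) * 2 ^ Suc k) *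
        (ballot (2 * Suc n) (Suc k) * (real (k + 1) * real (k + 2 * n + 3)))"
      unfolding L_def fk by (simp only: times_divide_eq_left times_divide_eq_right mult_ac)
    also have "\<dots> = L k * (2 * (real n + 3 / 2 + real k))"
      unfolding L_def b fkn by simp
    finally have "L (Suc k) * real (k + 2 * n + 3) = L k * (2 * (real n + 3 / 2 + real k))" .
    moreover have "L k = 2 ^ k * pochhammer (real n + 3 / 2) k / pochhammer (2 * real n + 3) k"
      using Suc.IH by (simp add: L_def)
    moreover have "0 < 2 * real n + 3 + real k" by simp
    ultimately have "L (Suc k) = 2 ^ Suc k * pochhammer (real n + 3 / 2) (Suc k) / pochhammer (2 * real n + 3) (Suc k)"
      using pos by (simp add: pochhammer_Suc divide_simps) (simp add: algebra_simps)
    then show ?case unfolding L_def .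
  qed
  finally show ?thesis .
qed

section \<open>Powers of the occupation time of a path\<close>

text \<open>Formally A' is the indicator of positivity and (A^(r+1))' = (r+1) A^r A'. The indicator
  is not continuous, so the fundamental theorem of calculus is applied to continuous approximations,
  and dominated convergence gives the limit.\<close>

lemma occupation_power_integral:
  fixes b :: "real \<Rightarrow> real"
  assumes b: "continuous_on UNIV b" and t: "0 \<le> t"
  defines "A \<equiv> \<lambda>t. integral {0..t} (\<lambda>s. indicator {0<..} (b s))"
  shows "(\<lambda>s. indicator {0<..} (b s) * A s ^ r) integrable_on {0..t}"
    and "A t ^ Suc r = real (Suc r) * integral {0..t} (\<lambda>s. indicator {0<..} (b s) * A s ^ r)"
proof -
  \<comment> \<open>Continuous ramps that increase with k to the indicator of b s > 0.\<close>
  define \<phi> where "\<phi> k s = min 1 (real k * max 0 (b s))" for k s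
  define F where "F k t = integral {0..t} (\<phi> k)" for k t
  have \<phi>c: "continuous_on S (\<phi> k)" for k S
    unfolding \<phi>_def by (intro continuous_intros continuous_on_subset[OF b]) auto
  have \<phi>01: "0 \<le> \<phi> k s" "\<phi> k s \<le> 1" for k s by (auto simp: \<phi>_def)
  have \<phi>lim: "(\<lambda>k. \<phi> k s) \<longlonglongrightarrow> indicator {0<..} (b s)" for s
  proof (cases "0 < b s")
    case True
    obtain N :: nat where "1 / b s < real N" using reals_Archimedean2 by blast
    then have N: "1 < real N * b s" using True by (simp add: field_simps)
    have "\<forall>\<^sub>F k in sequentially. \<phi> k s = 1"
      using eventually_ge_at_top[of N]
    proof eventually_elim
      case (elim k)
      then have "real N * b s \<le> real k * b s" using True by (intro mult_right_mono) auto
      then have "1 \<le> real k * b s" using N by linarith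
      then show ?case using True by (simp add: \<phi>_def min_absorb1)
    qed
    then show ?thesis using True by (simp add: tendsto_eventually)
  qed (simp add: \<phi>_def)
  have Flim: "(\<lambda>k. F k u) \<longlonglongrightarrow> A u" for u
    unfolding F_def A_def
    by (rule dominated_convergence[where h = "\<lambda>_. 1"])
       (use \<phi>01 \<phi>lim in \<open>auto intro!: integrable_continuous_real \<phi>c\<close>)
  have F0: "0 \<le> F k u" for k u
    unfolding F_def using \<phi>01 by (intro integral_nonneg integrable_continuous_real \<phi>c) auto
  have Fle: "F k u \<le> u" if "0 \<le> u" for k u
  proof -
    have "F k u \<le> integral {0..u} (\<lambda>_. 1)"
      unfolding F_def using \<phi>01 by (intro integral_le integrable_continuous_real \<phi>c continuous_intros) auto
    then show ?thesis using that by simp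
  qed
  have ftc: "((\<lambda>s. \<phi> k s * F k s ^ r) has_integral (F k t ^ Suc r / real (Suc r))) {0..t}" for k
  proof -
    have "((\<lambda>s. \<phi> k s * F k s ^ r) has_integral
       (F k t ^ Suc r / real (Suc r) - F k 0 ^ Suc r / real (Suc r))) {0..t}"
    proof (rule fundamental_theorem_of_calculus[OF t])
      fix s assume s: "s \<in> {0..t}"
      have "(F k has_real_derivative \<phi> k s) (at s within {0..t})"
        unfolding F_def[abs_def] by (rule integral_has_real_derivative[OF \<phi>c s])
      then have "((\<lambda>s. F k s ^ Suc r / real (Suc r)) has_real_derivative \<phi> k s * F k s ^ r) (at s within {0..t})"
        by (auto intro!: derivative_eq_intros simp del: power_Suc)
      then show "((\<lambda>s. F k s ^ Suc r / real (Suc r)) has_vector_derivative \<phi> k s * F k s ^ r) (at s within {0..t})"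
        by (simp add: has_real_derivative_iff_has_vector_derivative)
    qed
    then show ?thesis by (simp add: F_def)
  qed
  have dc: "(\<lambda>s. indicator {0<..} (b s) * A s ^ r) integrable_on {0..t} \<and>
     (\<lambda>k. integral {0..t} (\<lambda>s. \<phi> k s * F k s ^ r)) \<longlonglongrightarrow> integral {0..t} (\<lambda>s. indicator {0<..} (b s) * A s ^ r)"
  proof -
    have bd: "norm (\<phi> k s * F k s ^ r) \<le> t ^ r" if s: "s \<in> {0..t}" for k s
    proof -
      have "\<phi> k s * F k s ^ r \<le> 1 * t ^ r"
        using \<phi>01 F0 Fle[of s k] s by (intro mult_mono power_mono) (auto intro: order_trans)
      then show ?thesis using \<phi>01 F0 by simp
    qed
    have lim: "(\<lambda>k. \<phi> k s * F k s ^ r) \<longlonglongrightarrow> indicator {0<..} (b s) * A s ^ r" for s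
      by (intro tendsto_intros \<phi>lim Flim)
    have i: "(\<lambda>_. t ^ r) integrable_on {0..t}" by (rule integrable_const_ivl)
    show ?thesis
      using dominated_convergence[OF has_integral_integrable[OF ftc] i bd lim] by blast
  qed
  then show "(\<lambda>s. indicator {0<..} (b s) * A s ^ r) integrable_on {0..t}" by simp
  have "(\<lambda>k. F k t ^ Suc r / real (Suc r)) \<longlonglongrightarrow> integral {0..t} (\<lambda>s. indicator {0<..} (b s) * A s ^ r)"
    using dc unfolding integral_unique[OF ftc] by (rule conjunct2)
  moreover have "(\<lambda>k. F k t ^ Suc r / real (Suc r)) \<longlonglongrightarrow> A t ^ Suc r / real (Suc r)"
    by (intro tendsto_intros Flim) auto
  ultimately have "A t ^ Suc r / real (Suc r) = integral {0..t} (\<lambda>s. indicator {0<..} (b s) * A s ^ r)"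
    using LIMSEQ_unique by blast
  then show "A t ^ Suc r = real (Suc r) * integral {0..t} (\<lambda>s. indicator {0<..} (b s) * A s ^ r)"
    by (simp add: field_simps del: power_Suc of_nat_Suc)
qed

text \<open>Times are recorded by the gaps between them: the chamber of increasing times becomes the
  positive orthant, on which Lebesgue measure is a product. The partial sums are the times
  themselves.\<close>

definition positive_at :: "(real \<Rightarrow> real) \<Rightarrow> nat \<Rightarrow> (nat \<Rightarrow> real) \<Rightarrow> bool" where
  "positive_at b r g \<longleftrightarrow> (\<forall>i\<in>{..<r}. 0 < g i \<and> 0 < b (\<Sum>j\<le>i. g j))"

lemma positive_at_Suc:
  "positive_at b (Suc r) (g(r := x)) \<longleftrightarrow> positive_at b r g \<and> 0 < x \<and> 0 < b ((\<Sum>j<r. g j) + x)"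
proof -
  have "(\<Sum>j\<le>i. (g(r := x)) j) = (\<Sum>j\<le>i. g j)" if "i \<in> {..<r}" for i
    using that by (intro sum.cong) auto
  then have "positive_at b r (g(r := x)) \<longleftrightarrow> positive_at b r g"
    unfolding positive_at_def by (intro ball_cong) auto
  moreover have "(\<Sum>j\<le>r. (g(r := x)) j) = (\<Sum>j<r. g j) + x"
    by (simp add: lessThan_Suc_atMost[symmetric])
  ultimately show ?thesis
    unfolding positive_at_def lessThan_Suc by (simp add: conj_ac)
qed

lemma measurable_partial_sum [measurable]:
  fixes N :: "nat \<Rightarrow> real measure"
  assumes [measurable_cong]: "\<And>i. sets (N i) = sets borel" and "I \<subseteq> J"
  shows "(\<lambda>g. \<Sum>j\<in>I. g j) \<in> borel_measurable (Pi\<^sub>M J N)"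
  using assms by (intro borel_measurable_sum measurable_compose[OF measurable_component_singleton]) auto

lemma measurable_positive_at:
  fixes N :: "nat \<Rightarrow> real measure"
  assumes N: "\<And>i. sets (N i) = sets borel" and [measurable]: "b \<in> borel_measurable borel"
  shows "Measurable.pred (Pi\<^sub>M {..<r} N) (positive_at b r)"
proof -
  have [measurable]: "(\<lambda>g. g i) \<in> borel_measurable (Pi\<^sub>M {..<r} N)" if "i < r" for i
    using measurable_component_singleton[of i "{..<r}" N] N[of i] that by (simp cong: measurable_cong_sets)
  have [measurable]: "(\<lambda>g. \<Sum>j\<le>i. g j) \<in> borel_measurable (Pi\<^sub>M {..<r} N)" if "i < r" for i
    using that by (intro measurable_partial_sum N) auto
  show ?thesis unfolding positive_at_def[abs_def]
    by (intro pred_intros_finite) auto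
qed

lemma sigma_finite_PiM_lborel:
  fixes r :: nat
  shows "sigma_finite_measure (Pi\<^sub>M {..<r} (\<lambda>_. lborel :: real measure))"
proof -
  interpret product_sigma_finite "\<lambda>_ :: nat. lborel :: real measure" by standard
  show ?thesis by (rule sigma_finite) simp
qed

text \<open>The r-th power of the occupation time is r! times the volume of the increasing r-tuples
  of times in (0, t) at which b is positive. The induction adds the last time, which is the
  integration variable in \<open>occupation_power_integral\<close>.\<close>

lemma occupation_power_gaps:
  fixes b :: "real \<Rightarrow> real"
  assumes b: "continuous_on UNIV b" and t: "0 < t"
  shows "ennreal ((integral {0..t} (\<lambda>s. indicator {0<..} (b s))) ^ r / fact r) =
     (\<integral>\<^sup>+ g. (if positive_at b r g \<and> (\<Sum>j<r. g j) < t then 1 else 0) \<partial>Pi\<^sub>M {..<r} (\<lambda>_. lborel))"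
  using t
proof (induction r arbitrary: t)
  case 0
  then show ?case by (simp add: positive_at_def PiM_empty)
next
  case (Suc r)
  let ?R = "\<lambda>g s. (if 0 < s \<and> s < t \<and> 0 < b s \<and> positive_at b r g \<and> (\<Sum>j<r. g j) < s then 1 else 0)"
  let ?Z = "\<lambda>g x. (if positive_at b (Suc r) (g(r := x)) \<and> (\<Sum>j<Suc r. (g(r := x)) j) < t then 1 else 0)"
  define A where "A t = integral {0..t} (\<lambda>s. indicator {0<..} (b s) :: real)" for t
  have bm [measurable]: "b \<in> borel_measurable borel" using b by (rule borel_measurable_continuous_onI)
  interpret product_sigma_finite "\<lambda>_ :: nat. lborel :: real measure" by standard
  interpret P: sigma_finite_measure "Pi\<^sub>M {..<r} (\<lambda>_. lborel :: real measure)"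
    by (rule sigma_finite_PiM_lborel)
  interpret PP: pair_sigma_finite "Pi\<^sub>M {..<r} (\<lambda>_. lborel :: real measure)" "lborel :: real measure" ..
  have A0: "0 \<le> A t" for t unfolding A_def
    by (cases "(\<lambda>s. indicator {0<..} (b s) :: real) integrable_on {0..t}")
       (auto intro!: integral_nonneg simp: not_integrable_integral)
  let ?L = "Pi\<^sub>M {..<r} (\<lambda>_. lborel :: real measure)"
  have [measurable]: "(\<lambda>g. \<Sum>j<r. g j) \<in> borel_measurable ?L" by (intro measurable_partial_sum) auto
  have [measurable]: "Measurable.pred ?L (positive_at b r)" by (rule measurable_positive_at) auto
  have "ennreal (A t ^ Suc r / fact (Suc r)) =
      ennreal (integral {0..t} (\<lambda>s. indicator {0<..} (b s) * (A s ^ r / fact r)))"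
  proof -
    have "integral {0..t} (\<lambda>s. indicator {0<..} (b s) * (A s ^ r / fact r))
       = integral {0..t} (\<lambda>s. indicator {0<..} (b s) * A s ^ r) / fact r"
      by simp
    then show ?thesis
      using occupation_power_integral(2)[OF b, of t r] Suc.prems unfolding A_def
      by (simp del: power_Suc of_nat_Suc)
  qed
  also have "\<dots> = (\<integral>\<^sup>+ s. ennreal (indicator {0<..} (b s) * (A s ^ r / fact r)) * indicator {0..t} s \<partial>lborel)"
    using occupation_power_integral(1)[OF b, of t r] Suc.prems A0 unfolding A_def
    by (intro nn_integral_has_integral_lebesgue'[symmetric] integrable_integral) (auto intro!: mult_nonneg_nonneg divide_nonneg_nonneg dest: integrable_on_divide[of _ _ "fact r"])
  also have "\<dots> = (\<integral>\<^sup>+ s. (\<integral>\<^sup>+ g. (?R g s) \<partial>?L) \<partial>lborel)"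
  proof (intro nn_integral_cong_AE)
    \<comment> \<open>The induction hypothesis requires 0 < s and the gap version has s < t, so both
      endpoints are discarded as null.\<close>
    have "AE s in lborel. s \<noteq> 0 \<and> s \<noteq> t" by (auto intro: AE_lborel_singleton)
    then show "AE s in lborel. ennreal (indicator {0<..} (b s) * (A s ^ r / fact r)) * indicator {0..t} s =
       (\<integral>\<^sup>+ g. (?R g s) \<partial>?L)"
    proof eventually_elim
      case (elim s)
      show ?case
      proof (cases "0 < s \<and> s < t \<and> 0 < b s")
        case True
        then show ?thesis using Suc.IH[of s] by (simp add: A_def)
      qed (use elim in \<open>auto split: split_indicator\<close>)
    qed
  qed
  also have "\<dots> = (\<integral>\<^sup>+ g. (\<integral>\<^sup>+ s. (?R g s) \<partial>lborel) \<partial>?L)"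
    by (rule PP.Fubini') measurable
  also have "\<dots> = (\<integral>\<^sup>+ g. (\<integral>\<^sup>+ x. (?Z g x) \<partial>lborel) \<partial>?L)"
  proof (rule nn_integral_cong)
    fix g :: "nat \<Rightarrow> real"
    let ?s = "\<Sum>j<r. g j"
    have s0: "0 \<le> ?s" if "positive_at b r g"
      using that by (intro sum_nonneg) (auto simp: positive_at_def less_imp_le)
    \<comment> \<open>The last time s is replaced by the last gap, x = s minus the sum of the
      others; positivity of s then follows from that of the gaps.\<close>
    have "(\<integral>\<^sup>+ s. (if 0 < s \<and> s < t \<and> 0 < b s \<and> positive_at b r g \<and> ?s < s then 1 else 0) \<partial>lborel)
      = ennreal \<bar>1\<bar> * (\<integral>\<^sup>+ x. (if 0 < ?s + 1 * x \<and> ?s + 1 * x < t \<and> 0 < b (?s + 1 * x) \<and> positive_at b r g \<and> ?s < ?s + 1 * x then 1 else 0) \<partial>lborel)"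
      by (rule nn_integral_real_affine) auto
    also have "\<dots> = (\<integral>\<^sup>+ x. (?Z g x) \<partial>lborel)"
      unfolding positive_at_Suc using s0 by (auto intro!: nn_integral_cong)
    finally show "(\<integral>\<^sup>+ s. (if 0 < s \<and> s < t \<and> 0 < b s \<and> positive_at b r g \<and> ?s < s then 1 else 0) \<partial>lborel)
      = (\<integral>\<^sup>+ x. (?Z g x) \<partial>lborel)" .
  qed
  also have "\<dots> = (\<integral>\<^sup>+ g. (if positive_at b (Suc r) g \<and> (\<Sum>j<Suc r. g j) < t then 1 else 0) \<partial>Pi\<^sub>M {..<Suc r} (\<lambda>_. lborel))"
  proof -
    have "(\<lambda>g. if positive_at b (Suc r) g \<and> (\<Sum>j<Suc r. g j) < t then 1 else 0 :: ennreal) \<in>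
        borel_measurable (Pi\<^sub>M (insert r {..<r}) (\<lambda>_. lborel))"
      using measurable_positive_at[of "\<lambda>_. lborel" b "Suc r"] measurable_partial_sum[of "\<lambda>_. lborel" "{..<Suc r}" "{..<Suc r}"]
      unfolding lessThan_Suc[symmetric] by measurable
    from product_nn_integral_insert[OF _ _ this] show ?thesis
      unfolding lessThan_Suc by simp
  qed
  finally show ?case unfolding A_def .
qed

section \<open>Random walks with symmetric steps\<close>

text \<open>Symmetry and the absence of atoms are all that is asked of the steps: the probabilities
  of staying positive do not depend on the step law (Sparre Andersen).\<close>

locale symmetric_walk = prob_space N for N :: "real measure" +
  assumes sets_N [measurable_cong, simp]: "sets N = sets borel"
    and symmetric: "distr N borel uminus = N"
    and atomless: "emeasure N {x} = 0"
begin

sublocale steps: product_prob_space "\<lambda>_ :: nat. N" UNIV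
  by standard

abbreviation steps_on :: "nat set \<Rightarrow> (nat \<Rightarrow> real) measure" where
  "steps_on I \<equiv> Pi\<^sub>M I (\<lambda>_. N)"

definition stay_prob :: "nat \<Rightarrow> ennreal" where
  "stay_prob r = emeasure (steps_on {..<r}) {g \<in> space (steps_on {..<r}). \<forall>i\<in>{..<r}. 0 < (\<Sum>j\<le>i. g j)}"

lemma measurable_sum [measurable]: "J \<subseteq> I \<Longrightarrow> (\<lambda>g. \<Sum>j\<in>J. g j) \<in> borel_measurable (steps_on I)"
  by (intro borel_measurable_sum) auto

lemma prob_steps_on: "prob_space (steps_on I)"
  by (intro prob_space_PiM) unfold_locales

text \<open>Given the other steps, a vanishing partial sum pins step i to a single value, which has
  probability 0.\<close>

lemma no_ties:
  assumes "i < r"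
  shows "AE g in steps_on {..<r}. (\<Sum>j\<le>i. g j) \<noteq> 0"
proof -
  let ?I = "{..<r} - {i}"
  have ins: "insert i ?I = {..<r}" using assms by auto
  have sub: "{..i} \<subseteq> {..<r}" using assms by auto
  have [measurable]: "(\<lambda>g. \<Sum>j\<le>i. g j) \<in> borel_measurable (steps_on {..<r})"
    using sub by (rule measurable_sum)
  have "emeasure (steps_on {..<r}) {g \<in> space (steps_on {..<r}). (\<Sum>j\<le>i. g j) = 0}
     = (\<integral>\<^sup>+ g. indicator {g \<in> space (steps_on {..<r}). (\<Sum>j\<le>i. g j) = 0} g \<partial>steps_on {..<r})"
    by (rule nn_integral_indicator[symmetric]) measurable
  also have "\<dots> = (\<integral>\<^sup>+ g. indicator {0} (\<Sum>j\<le>i. g j) \<partial>steps_on {..<r})"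
    by (rule nn_integral_cong) (auto split: split_indicator)
  also have "\<dots> = (\<integral>\<^sup>+ x. (\<integral>\<^sup>+ y. indicator {0} (\<Sum>j\<le>i. (x(i := y)) j) \<partial>N) \<partial>steps_on ?I)"
    using steps.product_nn_integral_insert[of ?I i "\<lambda>g. indicator {0} (\<Sum>j\<le>i. g j)"] ins by simp
  also have "\<dots> = (\<integral>\<^sup>+ x. 0 \<partial>steps_on ?I)"
  proof (rule nn_integral_cong)
    fix x :: "nat \<Rightarrow> real"
    have "(\<Sum>j\<le>i. (x(i := y)) j) = (\<Sum>j<i. x j) + y" for y
      by (simp add: lessThan_Suc_atMost[symmetric])
    then have "(\<integral>\<^sup>+ y. indicator {0} (\<Sum>j\<le>i. (x(i := y)) j) \<partial>N) = (\<integral>\<^sup>+ y. indicator {- (\<Sum>j<i. x j)} y \<partial>N)"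
      by (intro nn_integral_cong) (auto split: split_indicator)
    also have "\<dots> = 0" by (simp add: atomless)
    finally show "(\<integral>\<^sup>+ y. indicator {0} (\<Sum>j\<le>i. (x(i := y)) j) \<partial>N) = 0" .
  qed
  finally have "emeasure (steps_on {..<r}) {g \<in> space (steps_on {..<r}). (\<Sum>j\<le>i. g j) = 0} = 0" by simp
  then show ?thesis
    by (intro AE_I[where N = "{g \<in> space (steps_on {..<r}). (\<Sum>j\<le>i. g j) = 0}"]) auto
qed

lemma reindex:
  assumes "inj_on f {..<r}" "f \<in> {..<r} \<rightarrow> K"
  shows "distr (steps_on K) (steps_on {..<r}) (\<lambda>g. \<lambda>i\<in>{..<r}. g (f i)) = steps_on {..<r}"
  by (rule distr_PiM_reindex[where M = "\<lambda>_. N" and K = K]) (use assms prob_space_axioms in auto)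

lemma negate: "distr (steps_on {..<r}) (steps_on {..<r}) (compose {..<r} uminus) = steps_on {..<r}"
proof -
  have d: "distr N N uminus = N" using symmetric by (subst distr_cong[OF refl sets_N refl]) auto
  show ?thesis
    by (subst distr_PiM_finite_prob_space') (use prob_space_axioms in \<open>auto simp: d\<close>)
qed

text \<open>Reversing the order of independent identically distributed steps preserves their law and
  exchanges suffix sums with prefix sums.\<close>

lemma reversed:
  "emeasure (steps_on {..<k}) {g \<in> space (steps_on {..<k}). \<forall>j\<in>{..<k}. 0 < (\<Sum>i\<in>{j..<k}. g i)} = stay_prob k"
proof -
  let ?T = "\<lambda>g. \<lambda>i\<in>{..<k}. g (k - Suc i) :: real"
  have T: "distr (steps_on {..<k}) (steps_on {..<k}) ?T = steps_on {..<k}"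
    by (rule reindex) (auto simp: inj_on_def)
  have Tm [measurable]: "?T \<in> measurable (steps_on {..<k}) (steps_on {..<k})"
    by (rule measurable_restrict) auto
  have [measurable]: "{g \<in> space (steps_on {..<k}). \<forall>i\<in>{..<k}. 0 < (\<Sum>j\<le>i. g j)} \<in> sets (steps_on {..<k})"
    by (intro sets.sets_Collect_finite_All borel_measurable_less borel_measurable_le measurable_sum) auto
  have "stay_prob k = emeasure (steps_on {..<k})
     (?T -` {g \<in> space (steps_on {..<k}). \<forall>i\<in>{..<k}. 0 < (\<Sum>j\<le>i. g j)} \<inter> space (steps_on {..<k}))"
    unfolding stay_prob_def by (subst T[symmetric]) (rule emeasure_distr; measurable)
  also have "?T -` {g \<in> space (steps_on {..<k}). \<forall>i\<in>{..<k}. 0 < (\<Sum>j\<le>i. g j)} \<inter> space (steps_on {..<k})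
     = {g \<in> space (steps_on {..<k}). \<forall>j\<in>{..<k}. 0 < (\<Sum>i\<in>{j..<k}. g i)}"
  proof -
    have s: "(\<Sum>j\<le>i. ?T g j) = (\<Sum>l\<in>{k - Suc i..<k}. g l)" if "i < k" for g i
    proof -
      have "(\<Sum>j\<le>i. ?T g j) = (\<Sum>j\<le>i. g (k - Suc j))" using that by (intro sum.cong) auto
      also have "\<dots> = (\<Sum>l\<in>{k - Suc i..<k}. g l)"
        by (rule sum.reindex_bij_witness[where i = "\<lambda>l. k - Suc l" and j = "\<lambda>j. k - Suc j"]) (use that in auto)
      finally show ?thesis .
    qed
    have "(\<forall>i\<in>{..<k}. 0 < (\<Sum>j\<le>i. ?T g j)) \<longleftrightarrow> (\<forall>j\<in>{..<k}. 0 < (\<Sum>i\<in>{j..<k}. g i))" for g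
    proof -
      have "(\<forall>i\<in>{..<k}. 0 < (\<Sum>j\<le>i. ?T g j)) \<longleftrightarrow> (\<forall>i\<in>{..<k}. 0 < (\<Sum>l\<in>{k - Suc i..<k}. g l))"
        using s by (intro ball_cong) auto
      also have "\<dots> \<longleftrightarrow> (\<forall>j\<in>{..<k}. 0 < (\<Sum>i\<in>{j..<k}. g i))"
      proof safe
        fix j assume a: "\<forall>i\<in>{..<k}. 0 < (\<Sum>l\<in>{k - Suc i..<k}. g l)" and j: "j < k"
        \<comment> \<open>The suffix from j is a reversed prefix of length k - j, whose last index
          is \<open>k - Suc j\<close>.\<close>
        show "0 < (\<Sum>i\<in>{j..<k}. g i)" using a[rule_format, of "k - Suc j"] j by simp
      qed auto
      finally show ?thesis .
    qed
    then show ?thesis using measurable_space[OF Tm] by auto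
  qed
  finally show ?thesis by simp
qed

text \<open>Three invariances are combined: moving the block of steps to start at 0, changing all
  signs, and passing from strict to weak inequalities, which costs nothing by
  \<open>no_ties\<close>.\<close>

lemma stay_prob_nonpos:
  assumes "k \<le> n"
  shows "emeasure (steps_on {k..<n}) {g \<in> space (steps_on {k..<n}). \<forall>j\<in>{k<..n}. (\<Sum>i\<in>{k..<j}. g i) \<le> 0}
    = stay_prob (n - k)"
proof -
  let ?S = "steps_on {..<n - k}"
  let ?T = "\<lambda>g. \<lambda>i\<in>{..<n - k}. g (k + i) :: real"
  have T: "distr (steps_on {k..<n}) ?S ?T = ?S"
    by (rule reindex) (auto simp: inj_on_def)
  have Tm [measurable]: "?T \<in> measurable (steps_on {k..<n}) ?S"
    by (rule measurable_restrict) auto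
  have Nm [measurable]: "compose {..<n - k} uminus \<in> measurable ?S ?S"
    unfolding compose_def by (rule measurable_restrict) auto
  have m [measurable]: "{g \<in> space ?S. \<forall>i\<in>{..<n-k}. 0 < (\<Sum>j\<le>i. g j)} \<in> sets ?S"
       "{g \<in> space ?S. \<forall>i\<in>{..<n-k}. (\<Sum>j\<le>i. g j) \<le> 0} \<in> sets ?S"
       "{g \<in> space ?S. \<forall>i\<in>{..<n-k}. 0 \<le> (\<Sum>j\<le>i. g j)} \<in> sets ?S"
    by (intro sets.sets_Collect_finite_All borel_measurable_less borel_measurable_le measurable_sum borel_measurable_const finite_lessThan subsetI; simp)+
  have "stay_prob (n - k) = emeasure ?S {g \<in> space ?S. \<forall>i\<in>{..<n-k}. 0 \<le> (\<Sum>j\<le>i. g j)}"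
    unfolding stay_prob_def
  proof (rule emeasure_eq_AE)
    have "AE g in ?S. \<forall>i\<in>{..<n - k}. (\<Sum>j\<le>i. g j) \<noteq> 0"
      using no_ties by (intro AE_finite_allI) auto
    then show "AE g in ?S. (g \<in> {g \<in> space ?S. \<forall>i\<in>{..<n-k}. 0 < (\<Sum>j\<le>i. g j)}) =
         (g \<in> {g \<in> space ?S. \<forall>i\<in>{..<n-k}. 0 \<le> (\<Sum>j\<le>i. g j)})"
      by eventually_elim (auto simp: less_le)
  qed measurable
  also have "\<dots> = emeasure ?S (compose {..<n - k} uminus -` {g \<in> space ?S. \<forall>i\<in>{..<n-k}. 0 \<le> (\<Sum>j\<le>i. g j)} \<inter> space ?S)"
    by (subst negate[symmetric]) (rule emeasure_distr; measurable)
  also have "compose {..<n - k} uminus -` {g \<in> space ?S. \<forall>i\<in>{..<n-k}. 0 \<le> (\<Sum>j\<le>i. g j)} \<inter> space ?S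
     = {g \<in> space ?S. \<forall>i\<in>{..<n-k}. (\<Sum>j\<le>i. g j) \<le> 0}"
  proof -
    have "(\<Sum>j\<le>i. compose {..<n - k} uminus g j) = - (\<Sum>j\<le>i. g j)" if "i \<in> {..<n - k}" for g :: "nat \<Rightarrow> real" and i
      using that unfolding sum_negf[symmetric] by (intro sum.cong) (auto simp: compose_def)
    then show ?thesis using measurable_space[OF Nm] by auto
  qed
  also have "emeasure ?S {g \<in> space ?S. \<forall>i\<in>{..<n-k}. (\<Sum>j\<le>i. g j) \<le> 0} =
     emeasure (steps_on {k..<n}) (?T -` {g \<in> space ?S. \<forall>i\<in>{..<n-k}. (\<Sum>j\<le>i. g j) \<le> 0} \<inter> space (steps_on {k..<n}))"
    by (subst T[symmetric]) (rule emeasure_distr; measurable)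
  also have "?T -` {g \<in> space ?S. \<forall>i\<in>{..<n-k}. (\<Sum>j\<le>i. g j) \<le> 0} \<inter> space (steps_on {k..<n}) =
     {g \<in> space (steps_on {k..<n}). \<forall>j\<in>{k<..n}. (\<Sum>i\<in>{k..<j}. g i) \<le> 0}"
  proof -
    have s: "(\<Sum>j\<le>i. ?T g j) = (\<Sum>l\<in>{k..<Suc (k + i)}. g l)" if "i \<in> {..<n - k}" for g i
    proof -
      have "(\<Sum>j\<le>i. ?T g j) = (\<Sum>j\<le>i. g (k + j))" using that by (intro sum.cong) auto
      also have "\<dots> = (\<Sum>l\<in>{k..<Suc (k + i)}. g l)"
        by (rule sum.reindex_bij_witness[where i = "\<lambda>l. l - k" and j = "\<lambda>j. k + j"]) (use that in auto)
      finally show ?thesis .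
    qed
    have "(\<forall>i\<in>{..<n-k}. (\<Sum>j\<le>i. ?T g j) \<le> 0) \<longleftrightarrow> (\<forall>j\<in>{k<..n}. (\<Sum>i\<in>{k..<j}. g i) \<le> 0)" for g
    proof -
      have "(\<forall>i\<in>{..<n-k}. (\<Sum>j\<le>i. ?T g j) \<le> 0) \<longleftrightarrow> (\<forall>i\<in>{..<n-k}. (\<Sum>l\<in>{k..<Suc (k + i)}. g l) \<le> 0)"
        using s by (intro ball_cong) auto
      also have "\<dots> \<longleftrightarrow> (\<forall>j\<in>{k<..n}. (\<Sum>i\<in>{k..<j}. g i) \<le> 0)"
      proof (intro iffI ballI)
        fix j assume a: "\<forall>i\<in>{..<n-k}. (\<Sum>l\<in>{k..<Suc (k + i)}. g l) \<le> 0" and j: "j \<in> {k<..n}"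
        have "Suc (k + (j - Suc k)) = j" "j - Suc k \<in> {..<n-k}" using j by auto
        then show "(\<Sum>i\<in>{k..<j}. g i) \<le> 0" using a by metis
      qed (auto simp del: sum.op_ivl_Suc)
      finally show ?thesis .
    qed
    then show ?thesis using measurable_space[OF Tm] by auto
  qed
  finally show ?thesis by simp
qed

text \<open>The \<open>k\<close>-th summand is the probability that the first maximum of \<open>S 0, \<dots>, S n\<close> is \<open>S k\<close>.\<close>

lemma stay_prob_convolution: "(\<Sum>k\<le>n. stay_prob k * stay_prob (n - k)) = 1"
proof -
  let ?P = "steps_on {..<n}"
  \<comment> \<open>Sums over blocks of steps make the first condition depend only on the steps
    before k and the second only on those from k on. Strictness before k and weakness after k single
    out the first maximum.\<close>
  define E where "E k = {g \<in> space ?P. (\<forall>j\<in>{..<k}. 0 < (\<Sum>i\<in>{j..<k}. g i)) \<and> (\<forall>j\<in>{k<..n}. (\<Sum>i\<in>{k..<j}. g i) \<le> 0)}" for k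
  have Em [measurable]: "E k \<in> sets ?P" if "k \<le> n" for k
    unfolding E_def using that
    by (intro sets.sets_Collect sets.sets_Collect_finite_All borel_measurable_less borel_measurable_le measurable_sum) auto
  have diff: "(\<Sum>i\<in>{j..<k}. g i) = (\<Sum>i<k. g i) - (\<Sum>i<j. g i)" if "j \<le> k" for j k and g :: "nat \<Rightarrow> real"
  proof -
    have "{..<k} = {..<j} \<union> {j..<k}" using that by auto
    moreover have "{..<j} \<inter> {j..<k} = {}" by auto
    ultimately show ?thesis using sum.union_disjoint[of "{..<j}" "{j..<k}" g] by simp
  qed
  have E_eq: "g \<in> E k \<longleftrightarrow> g \<in> space ?P \<and> (\<forall>j<k. (\<Sum>i<j. g i) < (\<Sum>i<k. g i)) \<and> (\<forall>j\<le>n. (\<Sum>i<j. g i) \<le> (\<Sum>i<k. g i))"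
    if "k \<le> n" for g k
  proof -
    have 1: "(\<forall>j\<in>{..<k}. 0 < (\<Sum>i\<in>{j..<k}. g i)) \<longleftrightarrow> (\<forall>j<k. (\<Sum>i<j. g i) < (\<Sum>i<k. g i))"
      using diff[of _ k g] by auto
    have 2: "(\<forall>j\<in>{k<..n}. (\<Sum>i\<in>{k..<j}. g i) \<le> 0) \<longleftrightarrow> (\<forall>j\<in>{k<..n}. (\<Sum>i<j. g i) \<le> (\<Sum>i<k. g i))"
      using diff[of k _ g] by auto
    have 3: "(\<forall>j<k. f j < f k) \<and> (\<forall>j\<in>{k<..n}. f j \<le> f k) \<longleftrightarrow>
       (\<forall>j<k. f j < f k) \<and> (\<forall>j\<le>n. f j \<le> f k)" for f :: "nat \<Rightarrow> real"
    proof (safe, goal_cases)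
      case (1 j)
      then show ?case by (cases j k rule: linorder_cases) (auto intro: less_imp_le)
    qed auto
    show ?thesis unfolding E_def mem_Collect_eq 1 2
      by (rule arg_cong[where f = "\<lambda>b. g \<in> space ?P \<and> b", OF 3[of "\<lambda>j. \<Sum>i<j. g i"]])
  qed
  have E_disj: False if "k < l" "l \<le> n" "g \<in> E k" "g \<in> E l" for k l g
  proof -
    have "(\<Sum>i<k. g i) < (\<Sum>i<l. g i)" using that E_eq[of l g] by blast
    moreover have "(\<Sum>i<l. g i) \<le> (\<Sum>i<k. g i)" using that E_eq[of k g] by auto
    ultimately show False by simp
  qed
  have "disjoint_family_on E {..n}"
  proof (unfold disjoint_family_on_def, intro ballI impI)
    fix k l assume kl: "k \<in> {..n}" "l \<in> {..n}" "k \<noteq> l"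
    show "E k \<inter> E l = {}"
    proof (rule equals0I)
      fix g assume g: "g \<in> E k \<inter> E l"
      show False using kl g E_disj[of k l g] E_disj[of l k g] by (cases k l rule: linorder_cases) auto
    qed
  qed
  then have "(\<Sum>k\<in>{..n}. emeasure ?P (E k)) = emeasure ?P (\<Union>k\<in>{..n}. E k)"
    using Em by (intro sum_emeasure) auto
  also have "(\<Union>k\<in>{..n}. E k) = space ?P"
  proof
    show "space ?P \<subseteq> (\<Union>k\<in>{..n}. E k)"
    proof
      fix g assume g: "g \<in> space ?P"
      define S where "S j = (\<Sum>i<j. g i)" for j
      define m where "m = Max (S ` {..n})"
      have mx: "S j \<le> m" if "j \<le> n" for j unfolding m_def using that by simp
      have "m \<in> S ` {..n}" unfolding m_def by (rule Max_in) auto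
      then have ex: "\<exists>k. k \<le> n \<and> S k = m" by auto
      define k where "k = (LEAST k. k \<le> n \<and> S k = m)"
      have k: "k \<le> n" "S k = m" unfolding k_def using LeastI_ex[OF ex] by auto
      have lt: "S j < S k" if "j < k" for j
      proof -
        have "S j \<noteq> m" using not_less_Least[of j "\<lambda>k. k \<le> n \<and> S k = m"] that k(1) unfolding k_def by auto
        then show ?thesis using mx[of j] that k by simp
      qed
      have "g \<in> E k" unfolding E_eq[OF k(1)] S_def[symmetric] using g lt mx k(2) by simp
      then show "g \<in> (\<Union>k\<in>{..n}. E k)" using k by auto
    qed
  qed (auto simp: E_def)
  also have "emeasure ?P (space ?P) = 1" using prob_steps_on by (rule prob_space.emeasure_space_1)
  also have "(\<Sum>k\<in>{..n}. emeasure ?P (E k)) = (\<Sum>k\<in>{..n}. stay_prob k * stay_prob (n - k))"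
  proof (rule sum.cong[OF refl])
    fix k assume "k \<in> {..n}"
    then have k: "k \<le> n" by simp
    have un: "{..<k} \<union> {k..<n} = {..<n}" using k by auto
    let ?F = "{g \<in> space (steps_on {..<k}). \<forall>j\<in>{..<k}. 0 < (\<Sum>i\<in>{j..<k}. g i)}"
    let ?G = "{g \<in> space (steps_on {k..<n}). \<forall>j\<in>{k<..n}. (\<Sum>i\<in>{k..<j}. g i) \<le> 0}"
    have Fm [measurable]: "?F \<in> sets (steps_on {..<k})"
      by (intro sets.sets_Collect_finite_All borel_measurable_less borel_measurable_le measurable_sum) auto
    have Gm [measurable]: "?G \<in> sets (steps_on {k..<n})"
      by (intro sets.sets_Collect_finite_All borel_measurable_less borel_measurable_le measurable_sum) auto
    have "emeasure ?P (E k) = (\<integral>\<^sup>+ g. indicator (E k) g \<partial>?P)" using Em[OF k] by simp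
    \<comment> \<open>Splitting the product measure at k factorises the integral;
      \<open>reversed\<close> and \<open>stay_prob_nonpos\<close> then evaluate the two
      factors.\<close>
    also have "\<dots> = (\<integral>\<^sup>+ x. (\<integral>\<^sup>+ y. indicator (E k) (merge {..<k} {k..<n} (x, y)) \<partial>steps_on {k..<n}) \<partial>steps_on {..<k})"
    proof -
      have m: "indicator (E k) \<in> borel_measurable ?P"
        using Em[OF k] by (rule borel_measurable_indicator)
      have d: "{..<k} \<inter> {k..<n} = {}" by auto
      show ?thesis
        by (rule steps.product_nn_integral_fold[of "{..<k}" "{k..<n}" "indicator (E k)", unfolded un,
              OF d finite_lessThan finite_atLeastLessThan m])
    qed
    also have "\<dots> = (\<integral>\<^sup>+ x. (\<integral>\<^sup>+ y. indicator ?F x * indicator ?G y \<partial>steps_on {k..<n}) \<partial>steps_on {..<k})"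
    proof (rule nn_integral_cong, rule nn_integral_cong)
      fix x y assume xy: "x \<in> space (steps_on {..<k})" "y \<in> space (steps_on {k..<n})"
      let ?m = "merge {..<k} {k..<n} (x, y)"
      have ms: "?m \<in> space ?P"
        using xy un by (auto simp: space_PiM PiE_iff merge_def extensional_def)
      have 1: "(\<Sum>i\<in>{j..<k}. ?m i) = (\<Sum>i\<in>{j..<k}. x i)" for j
        by (intro sum.cong) (auto simp: merge_def)
      have 2: "(\<Sum>i\<in>{k..<j}. ?m i) = (\<Sum>i\<in>{k..<j}. y i)" if "j \<in> {k<..n}" for j
        using that by (intro sum.cong) (auto simp: merge_def)
      have "?m \<in> E k \<longleftrightarrow> x \<in> ?F \<and> y \<in> ?G" unfolding E_def using 1 2 ms xy by auto
      then show "indicator (E k) ?m = (indicator ?F x * indicator ?G y :: ennreal)"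
        by (auto split: split_indicator)
    qed
    also have "\<dots> = emeasure (steps_on {..<k}) ?F * emeasure (steps_on {k..<n}) ?G"
      by (simp add: nn_integral_cmult nn_integral_multc)
    also have "\<dots> = stay_prob k * stay_prob (n - k)"
      unfolding reversed stay_prob_nonpos[OF k] ..
    finally show "emeasure ?P (E k) = stay_prob k * stay_prob (n - k)" .
  qed
  finally show ?thesis .
qed

end

section \<open>Brownian motion and the arcsine law\<close>

text \<open>Rounding s down to the grid of mesh 1 / (n + 1) leaves countably many values, so the
  rounded process is jointly measurable. By continuity it converges to the process itself.\<close>

lemma measurable_continuous_process:
  fixes X :: "real \<Rightarrow> 'a \<Rightarrow> real"
  assumes [measurable]: "\<And>s. X s \<in> borel_measurable M"
    and cont: "\<And>\<omega>. \<omega> \<in> space M \<Longrightarrow> continuous_on UNIV (\<lambda>s. X s \<omega>)"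
  shows "(\<lambda>(s, \<omega>). X s \<omega>) \<in> borel_measurable (borel \<Otimes>\<^sub>M M)"
proof (rule borel_measurable_LIMSEQ_real)
  fix n :: nat
  let ?h = "\<lambda>s :: real. real_of_int \<lfloor>real (Suc n) * s\<rfloor> / real (Suc n)"
  have "(\<lambda>x. (\<lambda>(i :: int) x. X (real_of_int i / real (Suc n)) (snd x)) \<lfloor>real (Suc n) * fst x\<rfloor> x) \<in> borel_measurable ((borel :: real measure) \<Otimes>\<^sub>M M)"
    by (rule measurable_compose_countable) measurable
  then show "(\<lambda>(s, \<omega>). X (?h s) \<omega>) \<in> borel_measurable (borel \<Otimes>\<^sub>M M)"
    by (simp add: case_prod_beta')
next
  fix x :: "real \<times> 'a" assume "x \<in> space (borel \<Otimes>\<^sub>M M)"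
  then obtain s \<omega> where x: "x = (s, \<omega>)" "\<omega> \<in> space M" by (auto simp: space_pair_measure)
  have "(\<lambda>n. real_of_int \<lfloor>real (Suc n) * s\<rfloor> / real (Suc n)) \<longlonglongrightarrow> s"
  proof (rule tendsto_sandwich[of "\<lambda>n. s - 1 / real (Suc n)" _ _ "\<lambda>n. s"])
    have "(\<lambda>n. s - 1 / real (Suc n)) \<longlonglongrightarrow> s - 0"
      by (intro tendsto_intros LIMSEQ_Suc[OF lim_1_over_n])
    then show "(\<lambda>n. s - 1 / real (Suc n)) \<longlonglongrightarrow> s" by simp
    have "s - 1 / real (Suc n) \<le> real_of_int \<lfloor>real (Suc n) * s\<rfloor> / real (Suc n)" for n
    proof -
      have "s - 1 / real (Suc n) = (real (Suc n) * s - 1) / real (Suc n)" by (simp add: divide_simps)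
      also have "\<dots> \<le> real_of_int \<lfloor>real (Suc n) * s\<rfloor> / real (Suc n)"
        by (rule divide_right_mono) linarith+
      finally show ?thesis .
    qed
    then show "\<forall>\<^sub>F n in sequentially. s - 1 / real (Suc n) \<le> real_of_int \<lfloor>real (Suc n) * s\<rfloor> / real (Suc n)"
      by (intro always_eventually allI)
    have "real_of_int \<lfloor>real (Suc n) * s\<rfloor> / real (Suc n) \<le> s" for n
    proof -
      have "real_of_int \<lfloor>real (Suc n) * s\<rfloor> / real (Suc n) \<le> (real (Suc n) * s) / real (Suc n)"
        by (rule divide_right_mono) linarith+
      then show ?thesis by simp
    qed
    then show "\<forall>\<^sub>F n in sequentially. real_of_int \<lfloor>real (Suc n) * s\<rfloor> / real (Suc n) \<le> s"
      by (intro always_eventually allI)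
  qed simp
  moreover have "isCont (\<lambda>s. X s \<omega>) s" using cont[OF x(2)] by (simp add: continuous_on_eq_continuous_at)
  ultimately have "(\<lambda>n. X (real_of_int \<lfloor>real (Suc n) * s\<rfloor> / real (Suc n)) \<omega>) \<longlonglongrightarrow> X s \<omega>"
    by (rule isCont_tendsto_compose[rotated])
  then show "(\<lambda>n. (case x of (s, \<omega>) \<Rightarrow> X (real_of_int \<lfloor>real (Suc n) * s\<rfloor> / real (Suc n)) \<omega>)) \<longlonglongrightarrow> (case x of (s, \<omega>) \<Rightarrow> X s \<omega>)"
    by (simp add: x)
qed

lemma PiM_density_lborel:
  fixes f :: "'i \<Rightarrow> real \<Rightarrow> ennreal"
  assumes I: "finite I" and f [measurable]: "\<And>i. i \<in> I \<Longrightarrow> f i \<in> borel_measurable borel"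
    and prob: "\<And>i. i \<in> I \<Longrightarrow> prob_space (density lborel (f i))"
  shows "Pi\<^sub>M I (\<lambda>i. density lborel (f i)) = density (Pi\<^sub>M I (\<lambda>_. lborel)) (\<lambda>x. \<Prod>i\<in>I. f i (x i))"
proof -
  let ?L = "(Pi\<^sub>M I (\<lambda>_. lborel))"
  \<comment> \<open>The padding outside \<open>I\<close> makes every factor a probability measure,
    as the product locale requires; any probability density would do.\<close>
  define f' where "f' i = (if i \<in> I then f i else (\<lambda>x. ennreal (std_normal_density x)))" for i
  have f' [measurable]: "f' i \<in> borel_measurable borel" for i unfolding f'_def by auto
  have prob': "prob_space (density lborel (f' i))" for i
    unfolding f'_def using prob prob_space_normal_density[of 1 0] by auto
  interpret product_prob_space "\<lambda>i. density lborel (f' i)" I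
    by (intro product_prob_spaceI prob')
  interpret L: product_sigma_finite "\<lambda>_ :: 'i. lborel :: real measure" by standard
  have [measurable]: "(\<lambda>x. \<Prod>i\<in>I. f' i (x i)) \<in> borel_measurable ?L"
    using measurable_component_singleton[of _ I "\<lambda>_. lborel :: real measure"] f'
    by (intro borel_measurable_prod_ennreal) (auto intro: measurable_compose[where N = borel])
  have "density ?L (\<lambda>x. \<Prod>i\<in>I. f' i (x i)) = Pi\<^sub>M I (\<lambda>i. density lborel (f' i))"
  proof (rule PiM_eqI[OF I])
    show "sets (density ?L (\<lambda>x. \<Prod>i\<in>I. f' i (x i))) = sets (Pi\<^sub>M I (\<lambda>i. density lborel (f' i)))"
      by (simp cong: sets_PiM_cong)
    fix A assume A: "\<And>i. i \<in> I \<Longrightarrow> A i \<in> sets (density lborel (f' i))"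
    have A' [measurable]: "i \<in> I \<Longrightarrow> A i \<in> sets borel" for i using A by simp
    have "emeasure (density ?L (\<lambda>x. \<Prod>i\<in>I. f' i (x i))) (Pi\<^sub>E I A)
      = (\<integral>\<^sup>+ x. (\<Prod>i\<in>I. f' i (x i)) * indicator (Pi\<^sub>E I A) x \<partial>Pi\<^sub>M I (\<lambda>_. lborel))"
      by (rule emeasure_density) (auto intro!: sets_PiM_I_finite I)
    also have "\<dots> = (\<integral>\<^sup>+ x. (\<Prod>i\<in>I. f' i (x i) * indicator (A i) (x i)) \<partial>Pi\<^sub>M I (\<lambda>_. lborel))"
    proof (rule nn_integral_cong)
      fix x assume "x \<in> space (Pi\<^sub>M I (\<lambda>_. lborel :: real measure))"
      then have "x \<in> extensional I" by (auto simp: space_PiM PiE_def)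
      then have "indicator (Pi\<^sub>E I A) x = (\<Prod>i\<in>I. indicator (A i) (x i) :: ennreal)"
        using I by (auto simp: indicator_def PiE_iff prod_zero_iff)
      then show "(\<Prod>i\<in>I. f' i (x i)) * indicator (Pi\<^sub>E I A) x = (\<Prod>i\<in>I. f' i (x i) * indicator (A i) (x i))"
        by (simp add: prod.distrib)
    qed
    also have "\<dots> = (\<Prod>i\<in>I. \<integral>\<^sup>+ x. f' i x * indicator (A i) x \<partial>lborel)"
      using I by (intro L.product_nn_integral_prod) auto
    also have "\<dots> = (\<Prod>i\<in>I. emeasure (density lborel (f' i)) (A i))"
      by (intro prod.cong refl) (simp add: emeasure_density)
    finally show "emeasure (density ?L (\<lambda>x. \<Prod>i\<in>I. f' i (x i))) (Pi\<^sub>E I A)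
      = (\<Prod>i\<in>I. emeasure (density lborel (f' i)) (A i))" .
  qed
  moreover have "Pi\<^sub>M I (\<lambda>i. density lborel (f' i)) = Pi\<^sub>M I (\<lambda>i. density lborel (f i))"
    by (intro PiM_cong) (auto simp: f'_def)
  moreover have "density ?L (\<lambda>x. \<Prod>i\<in>I. f' i (x i)) = density ?L (\<lambda>x. \<Prod>i\<in>I. f i (x i))"
    by (simp add: f'_def cong: prod.cong)
  ultimately show ?thesis by simp
qed

section \<open>Gaussian walks with prescribed variances\<close>

definition sums_positive :: "nat \<Rightarrow> (nat \<Rightarrow> real) \<Rightarrow> bool" where
  "sums_positive r y \<longleftrightarrow> (\<forall>i\<in>{..<r}. 0 < (\<Sum>j\<le>i. y j))"

lemma measurable_sums_positive:
  assumes "\<And>i. sets (N i) = sets (borel :: real measure)"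
  shows "Measurable.pred (Pi\<^sub>M {..<r} N) (sums_positive r)"
  unfolding sums_positive_def[abs_def]
proof (intro pred_intros_finite)
  fix i assume "i \<in> {..<r}"
  then have [measurable]: "(\<lambda>g. \<Sum>j\<le>i. g j) \<in> borel_measurable (Pi\<^sub>M {..<r} N)"
    by (intro measurable_partial_sum assms) auto
  show "Measurable.pred (Pi\<^sub>M {..<r} N) (\<lambda>y. 0 < (\<Sum>j\<le>i. y j))" by measurable
qed simp

text \<open>The probability that a walk with independent centred Gaussian steps of variances
  \<open>g i\<close> stays positive, in integral form so that its dependence on \<open>g\<close> is
  measurable and open to Tonelli.\<close>

definition gauss_positive :: "nat \<Rightarrow> (nat \<Rightarrow> real) \<Rightarrow> ennreal" where
  "gauss_positive r g = (\<integral>\<^sup>+ y. (\<Prod>i<r. ennreal (normal_density 0 (sqrt (g i)) (y i))) *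
      (if sums_positive r y then 1 else 0) \<partial>Pi\<^sub>M {..<r} (\<lambda>_. lborel))"

lemma nn_integral_PiM_normal:
  assumes g: "\<And>i. i < r \<Longrightarrow> 0 < g i"
  shows "emeasure (Pi\<^sub>M {..<r} (\<lambda>i. density lborel (normal_density 0 (sqrt (g i)))))
     {y \<in> space (Pi\<^sub>M {..<r} (\<lambda>_. borel)). sums_positive r y} = gauss_positive r g"
proof -
  have m [measurable]: "Measurable.pred (Pi\<^sub>M {..<r} (\<lambda>_. lborel)) (sums_positive r)"
    by (rule measurable_sums_positive) auto
  have sp: "space (Pi\<^sub>M {..<r} (\<lambda>_. borel :: real measure)) = space (Pi\<^sub>M {..<r} (\<lambda>_. lborel))"
    by (simp add: space_PiM)
  have [measurable]: "(\<lambda>y. y i) \<in> borel_measurable (Pi\<^sub>M {..<r} (\<lambda>_. lborel :: real measure))" if "i < r" for i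
    using measurable_component_singleton[of i "{..<r}" "\<lambda>_. lborel :: real measure"] that by simp
  have [measurable]: "(\<lambda>y. \<Prod>i<r. ennreal (normal_density 0 (sqrt (g i)) (y i))) \<in> borel_measurable (Pi\<^sub>M {..<r} (\<lambda>_. lborel))"
    by (intro borel_measurable_prod_ennreal measurable_compose[OF _ measurable_ennreal] measurable_compose[OF _ borel_measurable_normal_density]) auto
  have e: "Pi\<^sub>M {..<r} (\<lambda>i. density lborel (normal_density 0 (sqrt (g i))))
     = density (Pi\<^sub>M {..<r} (\<lambda>_. lborel)) (\<lambda>x. \<Prod>i<r. ennreal (normal_density 0 (sqrt (g i)) (x i)))"
    using g by (intro PiM_density_lborel prob_space_normal_density) auto
  then show ?thesis unfolding gauss_positive_def sp
    by (subst e, subst emeasure_density) (auto intro!: nn_integral_cong)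
qed

section \<open>Brownian paths and their sojourn times\<close>

locale brownian = prob_space M for M :: "'a measure" +
  fixes B :: "real \<Rightarrow> 'a \<Rightarrow> real"
  assumes BM: "brownian_motion M B"
begin

text \<open>Brownian motion is constrained only for s \<ge> 0. Freezing it at its initial value for
  negative s gives paths that are continuous on the whole line.\<close>

definition trajectory :: "'a \<Rightarrow> real \<Rightarrow> real" where
  "trajectory \<omega> s = B (max 0 s) \<omega>"

lemma continuous_trajectory: "\<omega> \<in> space M \<Longrightarrow> continuous_on UNIV (trajectory \<omega>)"
proof -
  assume "\<omega> \<in> space M"
  then have "continuous_on {0..} (\<lambda>s. B s \<omega>)" using BM by (auto simp: brownian_motion_def)
  then show ?thesis unfolding trajectory_def[abs_def]
    by (rule continuous_on_compose2) (auto intro!: continuous_intros)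
qed

lemma increment_distributed:
  "0 \<le> r \<Longrightarrow> r < s \<Longrightarrow>
    distributed M lborel (\<lambda>\<omega>. B s \<omega> - B r \<omega>) (\<lambda>x. ennreal (normal_density 0 (sqrt (s - r)) x))"
  using BM unfolding brownian_motion_def by blast

lemma increments_indep:
  "0 \<le> \<tau> 0 \<Longrightarrow> strict_mono \<tau> \<Longrightarrow>
    indep_vars (\<lambda>_. borel) (\<lambda>i \<omega>. B (\<tau> (Suc i)) \<omega> - B (\<tau> i) \<omega>) UNIV"
  for \<tau> :: "nat \<Rightarrow> real"
  using BM unfolding brownian_motion_def by blast

lemma measurable_B: "0 \<le> s \<Longrightarrow> B s \<in> borel_measurable M"
  using BM by (auto simp: brownian_motion_def)

lemma measurable_trajectory [measurable]: "(\<lambda>(s, \<omega>). trajectory \<omega> s) \<in> borel_measurable (borel \<Otimes>\<^sub>M M)"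
proof (rule measurable_continuous_process)
  show "(\<lambda>\<omega>. trajectory \<omega> s) \<in> borel_measurable M" for s
    unfolding trajectory_def by (rule measurable_B) simp
  show "continuous_on UNIV (trajectory \<omega>)" if "\<omega> \<in> space M" for \<omega>
    using that by (rule continuous_trajectory)
qed

lemma measurable_trajectory' [measurable (raw)]:
  "f \<in> borel_measurable N \<Longrightarrow> g \<in> measurable N M \<Longrightarrow> (\<lambda>x. trajectory (g x) (f x)) \<in> borel_measurable N"
  using measurable_compose[OF measurable_Pair measurable_trajectory, of f N g] by simp

text \<open>The gauge integral is the form to which the path lemmas apply; the Lebesgue integral is
  the one that yields measurability in \<omega> and the bounds.\<close>

lemma sojourn_time_eq_integral:
  assumes "\<omega> \<in> space M"
  shows "sojourn_time B t \<omega> = integral {0..t} (\<lambda>s. indicator {0<..} (trajectory \<omega> s))"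
    and "sojourn_time B t \<omega> = (LINT s|lborel. indicator {0..t} s * indicator {0<..} (trajectory \<omega> s))"
proof -
  have [measurable]: "trajectory \<omega> \<in> borel_measurable borel"
    using continuous_trajectory[OF assms] by (rule borel_measurable_continuous_onI)
  have "set_integrable lborel {0..t} (\<lambda>s. indicator {0<..} (trajectory \<omega> s) :: real)"
    unfolding set_integrable_def
    by (rule Bochner_Integration.integrable_bound[OF integrable_real_indicator[of "{0..t}"]]) (auto split: split_indicator simp: emeasure_lborel_Icc_eq)
  from set_borel_integral_eq_integral(2)[OF this]
  have 1: "(LINT s:{0..t}|lborel. indicator {0<..} (trajectory \<omega> s)) = integral {0..t} (\<lambda>s. indicator {0<..} (trajectory \<omega> s) :: real)" .
  have 2: "sojourn_time B t \<omega> = (LINT s:{0..t}|lborel. indicator {0<..} (trajectory \<omega> s))"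
    unfolding sojourn_time_def set_lebesgue_integral_def trajectory_def
    by (rule Bochner_Integration.integral_cong) (auto split: split_indicator)
  show "sojourn_time B t \<omega> = integral {0..t} (\<lambda>s. indicator {0<..} (trajectory \<omega> s))"
    using 1 2 by simp
  show "sojourn_time B t \<omega> = (LINT s|lborel. indicator {0..t} s * indicator {0<..} (trajectory \<omega> s))"
    using 2 by (simp add: set_lebesgue_integral_def)
qed

lemma measurable_sojourn_time [measurable]: "sojourn_time B t \<in> borel_measurable M"
proof -
  have "(\<lambda>\<omega>. LINT s|lborel. indicator {0..t} s * indicator {0<..} (trajectory \<omega> s) :: real) \<in> borel_measurable M"
    by measurable
  then show ?thesis
    by (rule measurable_cong[THEN iffD1, rotated]) (simp add: sojourn_time_eq_integral(2))
qed

lemma sojourn_time_bounds: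
  assumes "\<omega> \<in> space M" "0 \<le> t"
  shows "0 \<le> sojourn_time B t \<omega>" "sojourn_time B t \<omega> \<le> t"
proof -
  show "0 \<le> sojourn_time B t \<omega>"
    unfolding sojourn_time_eq_integral(2)[OF assms(1)] by (rule integral_nonneg_AE) auto
  have "(LINT s|lborel. indicator {0..t} s * indicator {0<..} (trajectory \<omega> s)) \<le> (LINT s|lborel. indicator {0..t} s :: real)"
    using continuous_trajectory[OF assms(1), THEN borel_measurable_continuous_onI] assms
    by (intro integral_mono' integrable_real_indicator) (auto split: split_indicator)
  then show "sojourn_time B t \<omega> \<le> t"
    unfolding sojourn_time_eq_integral(2)[OF assms(1)] using assms by simp
qed

lemma prob_positive_at:
  assumes g: "\<And>i. i < r \<Longrightarrow> 0 < g i"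
  shows "emeasure M {\<omega> \<in> space M. positive_at (trajectory \<omega>) r g} = gauss_positive r g"
\<comment> \<open>The characterisation of independence through product laws is applied to a nonempty
  index set.\<close>
proof (cases "r = 0")
  case True
  then show ?thesis
    by (simp add: positive_at_def gauss_positive_def sums_positive_def PiM_empty emeasure_space_1)
next
  case False
  \<comment> \<open>\<open>brownian_motion\<close> speaks of infinite strictly increasing sequences
    of times, so the partial sums of the r gaps are continued by unit steps.\<close>
  define \<tau> where "\<tau> i = (\<Sum>j<min i r. g j) + real (i - r)" for i
  have \<tau>_le: "\<tau> i = (\<Sum>j<i. g j)" if "i \<le> r" for i using that by (simp add: \<tau>_def)
  have \<tau>_Suc: "\<tau> (Suc i) = \<tau> i + (if i < r then g i else 1)" for i
    by (auto simp: \<tau>_def min_def not_le not_less Suc_diff_le)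
  have mono: "strict_mono \<tau>"
    unfolding strict_mono_Suc_iff using g by (auto simp: \<tau>_Suc)
  have \<tau>0: "\<tau> 0 = 0" by (simp add: \<tau>_def)
  have \<tau>_pos: "0 \<le> \<tau> i" for i using mono \<tau>0 by (metis le0 strict_mono_less_eq)
  define D where "D i \<omega> = B (\<tau> (Suc i)) \<omega> - B (\<tau> i) \<omega>" for i \<omega>
  have Dm [measurable]: "D i \<in> borel_measurable M" for i
    unfolding D_def using \<tau>_pos by (intro borel_measurable_diff measurable_B) auto
  have indep: "indep_vars (\<lambda>_. borel) D {..<r}"
    unfolding D_def
    by (rule indep_vars_subset[OF increments_indep]) (use mono \<tau>0 in auto)
  have distrD: "distr M borel (D i) = density lborel (normal_density 0 (sqrt (g i)))" if "i < r" for i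
  proof -
    have "distributed M lborel (\<lambda>\<omega>. B (\<tau> (Suc i)) \<omega> - B (\<tau> i) \<omega>) (\<lambda>x. ennreal (normal_density 0 (sqrt (\<tau> (Suc i) - \<tau> i)) x))"
      using mono \<tau>_pos by (intro increment_distributed) (auto simp: strict_mono_less)
    then have "distributed M lborel (D i) (\<lambda>x. ennreal (normal_density 0 (sqrt (g i)) x))"
      using that by (simp add: \<tau>_Suc D_def[abs_def])
    then have "distr M lborel (D i) = density lborel (normal_density 0 (sqrt (g i)))"
      by (simp add: distributed_def)
    then show ?thesis by (simp cong: distr_cong)
  qed
  let ?D = "\<lambda>\<omega>. \<lambda>i\<in>{..<r}. D i \<omega>"
  have [measurable]: "?D \<in> measurable M (Pi\<^sub>M {..<r} (\<lambda>_. borel))"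
    by (rule measurable_restrict) simp
  have law: "distr M (Pi\<^sub>M {..<r} (\<lambda>_. borel)) ?D = Pi\<^sub>M {..<r} (\<lambda>i. density lborel (normal_density 0 (sqrt (g i))))"
  proof -
    have "distr M (Pi\<^sub>M {..<r} (\<lambda>_. borel)) ?D = Pi\<^sub>M {..<r} (\<lambda>i. distr M borel (D i))"
      using indep_vars_iff_distr_eq_PiM[where I = "{..<r}" and X = D and M' = "\<lambda>_. borel"] indep False
      by (simp add: lessThan_empty_iff)
    also have "\<dots> = Pi\<^sub>M {..<r} (\<lambda>i. density lborel (normal_density 0 (sqrt (g i))))"
      by (rule PiM_cong) (use distrD in auto)
    finally show ?thesis .
  qed
  have [measurable]: "Measurable.pred (Pi\<^sub>M {..<r} (\<lambda>_. borel)) (sums_positive r)"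
    by (rule measurable_sums_positive) simp
  have "emeasure M {\<omega> \<in> space M. positive_at (trajectory \<omega>) r g} = emeasure M {\<omega> \<in> space M. sums_positive r (?D \<omega>)}"
  proof (rule emeasure_eq_AE)
    \<comment> \<open>B vanishes at time 0 only almost surely, so the telescoping sum of increments
      gives B itself only off a null set.\<close>
    have "AE \<omega> in M. B 0 \<omega> = 0" using BM by (auto simp: brownian_motion_def)
    then show "AE \<omega> in M. (\<omega> \<in> {\<omega> \<in> space M. positive_at (trajectory \<omega>) r g}) = (\<omega> \<in> {\<omega> \<in> space M. sums_positive r (?D \<omega>)})"
    proof eventually_elim
      case (elim \<omega>)
      have "trajectory \<omega> (\<Sum>j\<le>i. g j) = (\<Sum>j\<le>i. ?D \<omega> j)" if i: "i \<in> {..<r}" for i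
      proof -
        have "(\<Sum>j\<le>i. ?D \<omega> j) = (\<Sum>j<Suc i. B (\<tau> (Suc j)) \<omega> - B (\<tau> j) \<omega>)"
          using i unfolding lessThan_Suc_atMost by (intro sum.cong) (auto simp: D_def)
        also have "\<dots> = B (\<tau> (Suc i)) \<omega>" by (subst sum_lessThan_telescope) (simp add: \<tau>0 elim)
        also have e: "\<tau> (Suc i) = (\<Sum>j\<le>i. g j)" using i by (subst \<tau>_le) (auto simp: lessThan_Suc_atMost)
        finally show ?thesis using \<tau>_pos[of "Suc i"] e by (simp add: trajectory_def)
      qed
      then have "positive_at (trajectory \<omega>) r g \<longleftrightarrow> sums_positive r (?D \<omega>)"
        unfolding positive_at_def sums_positive_def using g by (intro ball_cong) auto
      then show ?case by simp
    qed
    show "{\<omega> \<in> space M. positive_at (trajectory \<omega>) r g} \<in> sets M"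
      unfolding positive_at_def by measurable
  qed measurable
  also have "\<dots> = emeasure (distr M (Pi\<^sub>M {..<r} (\<lambda>_. borel)) ?D) {y \<in> space (Pi\<^sub>M {..<r} (\<lambda>_. borel)). sums_positive r y}"
    by (subst emeasure_distr) (auto intro!: arg_cong[where f = "emeasure M"] simp: space_PiM)
  also have "\<dots> = gauss_positive r g"
    unfolding law by (rule nn_integral_PiM_normal[OF g])
  finally show ?thesis .
qed

end

text \<open>The expectation of \<Gamma>(t)^r / r!, written without reference to a probability space,
  so that it has the same value for every Brownian motion, in particular for a rescaled one.\<close>

definition sojourn_moment :: "nat \<Rightarrow> real \<Rightarrow> ennreal" where
  "sojourn_moment r t = (\<integral>\<^sup>+ g. (if (\<forall>i\<in>{..<r}. 0 < g i) \<and> (\<Sum>i<r. g i) < t then gauss_positive r g else 0)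
     \<partial>Pi\<^sub>M {..<r} (\<lambda>_. lborel))"

lemma (in brownian) nn_integral_sojourn_time_power:
  assumes t: "0 < t"
  shows "(\<integral>\<^sup>+ \<omega>. ennreal (sojourn_time B t \<omega> ^ r / fact r) \<partial>M) = sojourn_moment r t"
proof -
  let ?L = "Pi\<^sub>M {..<r} (\<lambda>_. lborel :: real measure)"
  let ?I = "\<lambda>\<omega> g. (if positive_at (trajectory \<omega>) r g \<and> (\<Sum>j<r. g j) < t then 1 else 0)"
  interpret P: sigma_finite_measure ?L by (rule sigma_finite_PiM_lborel)
  interpret PP: pair_sigma_finite M ?L ..
  have comp [measurable]: "(\<lambda>g. g i) \<in> borel_measurable ?L" if "i \<in> {..<r}" for i
    using measurable_component_singleton[of i "{..<r}" "\<lambda>_. lborel :: real measure"] that by simp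
  have sum [measurable]: "(\<lambda>g. \<Sum>j\<le>i. g j) \<in> borel_measurable ?L" if "i \<in> {..<r}" for i
    using that by (intro measurable_partial_sum) auto
  have [measurable]: "(\<lambda>g. \<Sum>j<r. g j) \<in> borel_measurable ?L"
    by (intro measurable_partial_sum) auto
  have pm [measurable]: "Measurable.pred (M \<Otimes>\<^sub>M ?L) (\<lambda>x. positive_at (trajectory (fst x)) r (snd x))"
    unfolding positive_at_def
  proof (intro pred_intros_finite)
    fix i assume i: "i \<in> {..<r}"
    note [measurable] = comp[OF i] sum[OF i]
    show "Measurable.pred (M \<Otimes>\<^sub>M ?L) (\<lambda>x. 0 < snd x i \<and> 0 < trajectory (fst x) (\<Sum>j\<le>i. snd x j))"
      by measurable
  qed simp
  have "(\<integral>\<^sup>+ \<omega>. ennreal (sojourn_time B t \<omega> ^ r / fact r) \<partial>M)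
    = (\<integral>\<^sup>+ \<omega>. (\<integral>\<^sup>+ g. (?I \<omega> g) \<partial>?L) \<partial>M)"
    using occupation_power_gaps[OF continuous_trajectory t] sojourn_time_eq_integral(1)
    by (intro nn_integral_cong) simp
  also have "\<dots> = (\<integral>\<^sup>+ g. (\<integral>\<^sup>+ \<omega>. (?I \<omega> g) \<partial>M) \<partial>?L)"
    by (rule PP.Fubini'[symmetric]) measurable
  also have "\<dots> = sojourn_moment r t"
    unfolding sojourn_moment_def
  proof (rule nn_integral_cong)
    fix g assume g: "g \<in> space ?L"
    have [measurable]: "Measurable.pred M (\<lambda>\<omega>. positive_at (trajectory \<omega>) r g)"
      unfolding positive_at_def by measurable
    show "(\<integral>\<^sup>+ \<omega>. (?I \<omega> g) \<partial>M) =
      (if (\<forall>i\<in>{..<r}. 0 < g i) \<and> (\<Sum>i<r. g i) < t then gauss_positive r g else 0)"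
    proof (cases "(\<forall>i\<in>{..<r}. 0 < g i) \<and> (\<Sum>i<r. g i) < t")
      case True
      then have "(\<integral>\<^sup>+ \<omega>. (?I \<omega> g) \<partial>M)
         = (\<integral>\<^sup>+ \<omega>. indicator {\<omega> \<in> space M. positive_at (trajectory \<omega>) r g} \<omega> \<partial>M)"
        by (intro nn_integral_cong) (auto split: split_indicator)
      also have "\<dots> = gauss_positive r g"
        using True by (subst nn_integral_indicator) (auto intro!: prob_positive_at)
      finally show ?thesis using True by simp
    next
      case False
      then have "\<not> (positive_at (trajectory \<omega>) r g \<and> (\<Sum>j<r. g j) < t)" for \<omega> by (auto simp: positive_at_def)
      then have "(\<integral>\<^sup>+ \<omega>. (?I \<omega> g) \<partial>M) = (\<integral>\<^sup>+ \<omega>. 0 \<partial>M)"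
        by (intro nn_integral_cong if_not_P)
      then show ?thesis unfolding if_not_P[OF False] by simp
    qed
  qed
  finally show ?thesis .
qed

lemma (in brownian) brownian_scale:
  assumes k: "0 < k"
  shows "brownian_motion M (\<lambda>s \<omega>. B (k * s) \<omega> / sqrt k)"
  unfolding brownian_motion_def
proof (intro conjI allI impI ballI)
  fix s :: real assume "0 \<le> s"
  then show "(\<lambda>\<omega>. B (k * s) \<omega> / sqrt k) \<in> borel_measurable M"
    using k by (intro borel_measurable_divide measurable_B) auto
next
  have "AE \<omega> in M. B 0 \<omega> = 0" using BM unfolding brownian_motion_def by blast
  then show "AE \<omega> in M. B (k * 0) \<omega> / sqrt k = 0" by simp
next
  fix \<omega> assume "\<omega> \<in> space M"
  then have "continuous_on {0..} (\<lambda>s. B s \<omega>)" using BM unfolding brownian_motion_def by blast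
  then show "continuous_on {0..} (\<lambda>s. B (k * s) \<omega> / sqrt k)"
    using k
    by (intro continuous_on_divide continuous_on_const
        continuous_on_compose2[of "{0..}" "\<lambda>s. B s \<omega>" "{0..}" "\<lambda>s. k * s"] continuous_on_mult continuous_on_id) auto
next
  fix r s :: real assume rs: "0 \<le> r \<and> r < s"
  have "distributed M lborel (\<lambda>\<omega>. B (k * s) \<omega> - B (k * r) \<omega>) (\<lambda>x. ennreal (normal_density 0 (sqrt (k * s - k * r)) x))"
    using rs k by (intro increment_distributed) auto
  moreover have "0 < sqrt (k * s - k * r)" using rs k by simp
  ultimately have "distributed M lborel (\<lambda>\<omega>. 0 + 1 / sqrt k * (B (k * s) \<omega> - B (k * r) \<omega>))
      (\<lambda>x. ennreal (normal_density (0 + 1 / sqrt k * 0) (\<bar>1 / sqrt k\<bar> * sqrt (k * s - k * r)) x))"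
    using k by (intro normal_density_affine) auto
  moreover have "\<bar>1 / sqrt k\<bar> * sqrt (k * s - k * r) = sqrt (s - r)"
    using k rs by (simp add: right_diff_distrib[symmetric] real_sqrt_mult)
  ultimately show "distributed M lborel (\<lambda>\<omega>. B (k * s) \<omega> / sqrt k - B (k * r) \<omega> / sqrt k)
      (\<lambda>x. ennreal (normal_density 0 (sqrt (s - r)) x))"
    by (simp add: diff_divide_distrib)
next
  fix \<tau> :: "nat \<Rightarrow> real" assume \<tau>: "0 \<le> \<tau> 0 \<and> strict_mono \<tau>"
  have "indep_vars (\<lambda>_. borel) (\<lambda>i \<omega>. B (k * \<tau> (Suc i)) \<omega> - B (k * \<tau> i) \<omega>) UNIV"
    using \<tau> k by (intro increments_indep[of "\<lambda>i. k * \<tau> i"]) (auto simp: strict_mono_def)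
  then have "indep_vars (\<lambda>_. borel) (\<lambda>i \<omega>. (\<lambda>x. x / sqrt k) (B (k * \<tau> (Suc i)) \<omega> - B (k * \<tau> i) \<omega>)) UNIV"
    by (rule indep_vars_compose2) simp
  then show "indep_vars (\<lambda>_. borel) (\<lambda>i \<omega>. B (k * \<tau> (Suc i)) \<omega> / sqrt k - B (k * \<tau> i) \<omega> / sqrt k) UNIV"
    by (simp add: diff_divide_distrib)
qed

text \<open>A pathwise identity, by the substitution s = t u; division by sqrt t does not change
  signs.\<close>

lemma (in brownian) sojourn_time_scale:
  assumes t: "0 < t" and \<omega>: "\<omega> \<in> space M"
  shows "sojourn_time B t \<omega> = t * sojourn_time (\<lambda>s \<omega>. B (t * s) \<omega> / sqrt t) 1 \<omega>"
proof -
  have "sojourn_time B t \<omega> = \<bar>t\<bar> *\<^sub>R (LINT u|lborel. indicator {0..t} (0 + t * u) *\<^sub>R indicator {0<..} (B (0 + t * u) \<omega>))"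
    unfolding sojourn_time_def set_lebesgue_integral_def using t
    by (intro lborel_integral_real_affine) simp
  also have "(LINT u|lborel. indicator {0..t} (0 + t * u) *\<^sub>R indicator {0<..} (B (0 + t * u) \<omega>))
    = sojourn_time (\<lambda>s \<omega>. B (t * s) \<omega> / sqrt t) 1 \<omega>"
    unfolding sojourn_time_def set_lebesgue_integral_def using t
    by (intro Bochner_Integration.integral_cong refl)
       (auto simp: indicator_def zero_le_mult_iff zero_less_divide_iff mult_le_cancel_left)
  finally show ?thesis using t by simp
qed

text \<open>The density of the increment of Brownian motion over an independent exponential time.\<close>

definition step_density :: "real \<Rightarrow> ennreal" where
  "step_density y = (\<integral>\<^sup>+ g. ennreal (exp (- g) * normal_density 0 (sqrt g) y) * indicator {0<..} g \<partial>lborel)"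

lemma measurable_step_density [measurable]: "step_density \<in> borel_measurable borel"
  unfolding step_density_def[abs_def] normal_density_def by measurable

lemma nn_integral_exp_minus: "(\<integral>\<^sup>+ g. ennreal (exp (- g)) * indicator {0<..} g \<partial>lborel) = 1"
proof -
  have "(\<integral>\<^sup>+ g. ennreal (exp (- g)) * indicator {0<..} g \<partial>lborel)
      = (\<integral>\<^sup>+ g. ennreal (g ^ 0 * exp (- g)) * indicator {0..} g \<partial>lborel)"
    using AE_lborel_singleton[of "0::real"]
    by (intro nn_integral_cong_AE) (auto elim!: eventually_mono split: split_indicator)
  then show ?thesis unfolding nn_intergal_power_times_exp_Ici by simp
qed

lemma nn_integral_normal_density: "0 < \<sigma> \<Longrightarrow> (\<integral>\<^sup>+ y. ennreal (normal_density \<mu> \<sigma> y) \<partial>lborel) = 1"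
  using prob_space.emeasure_space_1[OF prob_space_normal_density[of \<sigma> \<mu>]]
  by (simp add: emeasure_density)

lemma prob_space_step_density: "prob_space (density lborel step_density)"
proof
  have "emeasure (density lborel step_density) (space (density lborel step_density)) = (\<integral>\<^sup>+ y. step_density y \<partial>lborel)"
    by (simp add: emeasure_density)
  also have "\<dots> = (\<integral>\<^sup>+ g. (\<integral>\<^sup>+ y. ennreal (exp (- g) * normal_density 0 (sqrt g) y) * indicator {0<..} g \<partial>lborel) \<partial>lborel)"
    unfolding step_density_def
    by (rule lborel_pair.Fubini') (simp add: normal_density_def)
  also have "\<dots> = (\<integral>\<^sup>+ g. ennreal (exp (- g)) * indicator {0<..} g \<partial>lborel)"
  proof (rule nn_integral_cong)
    fix g :: real
    show "(\<integral>\<^sup>+ y. ennreal (exp (- g) * normal_density 0 (sqrt g) y) * indicator {0<..} g \<partial>lborel)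
      = ennreal (exp (- g)) * indicator {0<..} g"
    proof (cases "0 < g")
      case True
      then have "(\<integral>\<^sup>+ y. ennreal (exp (- g) * normal_density 0 (sqrt g) y) * indicator {0<..} g \<partial>lborel)
        = (\<integral>\<^sup>+ y. ennreal (exp (- g)) * ennreal (normal_density 0 (sqrt g) y) \<partial>lborel)"
        by (intro nn_integral_cong) (simp add: ennreal_mult)
      then show ?thesis using True by (simp add: nn_integral_cmult nn_integral_normal_density)
    qed simp
  qed
  finally show "emeasure (density lborel step_density) (space (density lborel step_density)) = 1"
    by (simp add: nn_integral_exp_minus)
qed

lemma distr_uminus_density_even:
  fixes f :: "real \<Rightarrow> ennreal"
  assumes [measurable]: "f \<in> borel_measurable borel" and even: "\<And>x. f (- x) = f x"
  shows "distr (density lborel f) borel uminus = density lborel f"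
proof (rule measure_eqI)
  fix A assume "A \<in> sets (distr (density lborel f) borel uminus)"
  then have [measurable]: "A \<in> sets borel" by simp
  have [measurable]: "uminus -` A \<in> sets (borel :: real measure)"
    using measurable_sets[of uminus borel borel A] by simp
  have "emeasure (distr (density lborel f) borel uminus) A = (\<integral>\<^sup>+ x. f x * indicator (uminus -` A) x \<partial>lborel)"
    by (subst emeasure_distr) (simp_all add: emeasure_density)
  also have "\<dots> = ennreal \<bar>-1\<bar> * (\<integral>\<^sup>+ x. f (0 + (-1) * x) * indicator (uminus -` A) (0 + (-1) * x) \<partial>lborel)"
    by (rule nn_integral_real_affine) auto
  also have "\<dots> = (\<integral>\<^sup>+ x. f x * indicator A x \<partial>lborel)"
    by (simp add: even indicator_def)
  finally show "emeasure (distr (density lborel f) borel uminus) A = emeasure (density lborel f) A"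
    by (simp add: emeasure_density)
qed simp

interpretation exp_walk: symmetric_walk "density lborel step_density"
proof -
  interpret prob_space "density lborel step_density" by (rule prob_space_step_density)
  show "symmetric_walk (density lborel step_density)"
  proof
    show "distr (density lborel step_density) borel uminus = density lborel step_density"
      by (rule distr_uminus_density_even) (auto simp: step_density_def normal_density_def)
    show "emeasure (density lborel step_density) {x} = 0" for x
    proof -
      have "emeasure (density lborel step_density) {x} = (\<integral>\<^sup>+ y. step_density y * indicator {x} y \<partial>lborel)"
        by (rule emeasure_density) auto
      also have "\<dots> = (\<integral>\<^sup>+ y. 0 \<partial>(lborel :: real measure))"
        using AE_lborel_singleton[of x] by (intro nn_integral_cong_AE) (auto elim!: eventually_mono)
      finally show ?thesis by simp
    qed
  qed simp
qed

lemma stay_prob_eq_nn_integral: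
  "exp_walk.stay_prob r = (\<integral>\<^sup>+ y. (\<Prod>i<r. step_density (y i)) * (if sums_positive r y then 1 else 0) \<partial>Pi\<^sub>M {..<r} (\<lambda>_. lborel))"
proof -
  have m [measurable]: "Measurable.pred (Pi\<^sub>M {..<r} (\<lambda>_. lborel)) (sums_positive r)"
    by (rule measurable_sums_positive) auto
  have [measurable]: "(\<lambda>y. y i) \<in> borel_measurable (Pi\<^sub>M {..<r} (\<lambda>_. lborel :: real measure))" if "i < r" for i
    using measurable_component_singleton[of i "{..<r}" "\<lambda>_. lborel :: real measure"] that by simp
  have [measurable]: "(\<lambda>y. \<Prod>i<r. step_density (y i)) \<in> borel_measurable (Pi\<^sub>M {..<r} (\<lambda>_. lborel))"
    by (intro borel_measurable_prod_ennreal) auto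
  have e: "Pi\<^sub>M {..<r} (\<lambda>i. density lborel step_density) = density (Pi\<^sub>M {..<r} (\<lambda>_. lborel)) (\<lambda>y. \<Prod>i<r. step_density (y i))"
    by (rule PiM_density_lborel) (auto intro: prob_space_step_density)
  have sp: "space (Pi\<^sub>M {..<r} (\<lambda>i. density lborel step_density)) = space (Pi\<^sub>M {..<r} (\<lambda>_. lborel))"
    by (simp add: space_PiM)
  show ?thesis
    unfolding exp_walk.stay_prob_def sp sums_positive_def[symmetric] e
    by (subst emeasure_density) (auto intro!: nn_integral_cong)
qed

text \<open>Integrating exp(-t) over all t beyond the sum of the gaps yields the product of the
  exp(-g i), so the gaps become independent exponential variables. Averaging each Gaussian step over
  its own gap then gives \<open>step_density\<close>.\<close>

lemma nn_integral_sojourn_moment: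
  "(\<integral>\<^sup>+ t. ennreal (exp (- t)) * indicator {0<..} t * sojourn_moment r t \<partial>lborel) = exp_walk.stay_prob r"
proof -
  let ?L = "Pi\<^sub>M {..<r} (\<lambda>_. lborel :: real measure)"
  let ?E = "\<lambda>g. (\<Prod>i<r. ennreal (exp (- g i)) * indicator {0<..} (g i))"
  let ?N = "\<lambda>g y. (\<Prod>i<r. ennreal (normal_density 0 (sqrt (g i)) (y i)))"
  let ?P = "\<lambda>y. (if sums_positive r y then 1 else 0)"
  let ?Q = "\<lambda>g t. (if (\<forall>i\<in>{..<r}. 0 < g i) \<and> (\<Sum>i<r. g i) < t then gauss_positive r g else 0)"
  have em: "(\<lambda>t. ennreal (exp (- t)) * indicator {s<..} t) \<in> borel_measurable lborel" for s :: real
    by measurable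
  interpret product_sigma_finite "\<lambda>_ :: nat. lborel :: real measure" by standard
  interpret P: sigma_finite_measure ?L by (rule sigma_finite_PiM_lborel)
  interpret PP: pair_sigma_finite "lborel :: real measure" ?L ..
  interpret LL: pair_sigma_finite ?L ?L ..
  have comp [measurable]: "(\<lambda>g. g i) \<in> borel_measurable ?L" if "i < r" for i
    using measurable_component_singleton[of i "{..<r}" "\<lambda>_. lborel :: real measure"] that by simp
  have [measurable]: "(\<lambda>g. \<Sum>j<r. g j) \<in> borel_measurable ?L"
    by (intro measurable_partial_sum) auto
  have sm [measurable]: "Measurable.pred ?L (sums_positive r)"
    by (rule measurable_sums_positive) auto
  have [measurable]: "Measurable.pred ?L (\<lambda>g. \<forall>i\<in>{..<r}. 0 < g i)"
    by (intro pred_intros_finite) auto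
  have pm [measurable]: "(\<lambda>x. \<Prod>i<r. ennreal (normal_density 0 (sqrt (fst x i)) (snd x i))) \<in> borel_measurable (?L \<Otimes>\<^sub>M ?L)"
    unfolding normal_density_def
    by (intro borel_measurable_prod_ennreal) simp
  have gm [measurable]: "gauss_positive r \<in> borel_measurable ?L"
    unfolding gauss_positive_def[abs_def]
    using pm by (intro P.borel_measurable_nn_integral) (simp add: case_prod_beta')
  have "(\<integral>\<^sup>+ t. ennreal (exp (- t)) * indicator {0<..} t * sojourn_moment r t \<partial>lborel)
    = (\<integral>\<^sup>+ t. (\<integral>\<^sup>+ g. ennreal (exp (- t)) * indicator {0<..} t * (?Q g t) \<partial>?L) \<partial>lborel)"
    unfolding sojourn_moment_def by (intro nn_integral_cong nn_integral_cmult[symmetric]) measurable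
  also have "\<dots> = (\<integral>\<^sup>+ g. (\<integral>\<^sup>+ t. ennreal (exp (- t)) * indicator {0<..} t * (?Q g t) \<partial>lborel) \<partial>?L)"
    by (rule PP.Fubini'[symmetric]) measurable
  also have "\<dots> = (\<integral>\<^sup>+ g. (?E g) * gauss_positive r g \<partial>?L)"
  proof (rule nn_integral_cong)
    fix g :: "nat \<Rightarrow> real"
    show "(\<integral>\<^sup>+ t. ennreal (exp (- t)) * indicator {0<..} t * (?Q g t) \<partial>lborel)
      = (?E g) * gauss_positive r g"
    proof (cases "\<forall>i\<in>{..<r}. 0 < g i")
      case True
      let ?s = "\<Sum>i<r. g i"
      have s0: "0 \<le> ?s" using True by (intro sum_nonneg) (auto intro: less_imp_le)
      have "(\<integral>\<^sup>+ t. ennreal (exp (- t)) * indicator {0<..} t * (if (\<forall>i\<in>{..<r}. 0 < g i) \<and> ?s < t then gauss_positive r g else 0) \<partial>lborel)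
        = (\<integral>\<^sup>+ t. ennreal (exp (- t)) * indicator {?s<..} t * gauss_positive r g \<partial>lborel)"
        using True s0 by (intro nn_integral_cong) (auto split: split_indicator)
      also have "\<dots> = (\<integral>\<^sup>+ t. ennreal (exp (- t)) * indicator {?s<..} t \<partial>lborel) * gauss_positive r g"
        by (rule nn_integral_multc) (rule em)
      \<comment> \<open>With u the part of t beyond the sum of the gaps, exp(-t) factorises, and the
        integral over u is 1.\<close>
      also have "(\<integral>\<^sup>+ t. ennreal (exp (- t)) * indicator {?s<..} t \<partial>lborel)
        = ennreal \<bar>1\<bar> * (\<integral>\<^sup>+ u. ennreal (exp (- (?s + 1 * u))) * indicator {?s<..} (?s + 1 * u) \<partial>lborel)"
        by (rule nn_integral_real_affine) auto
      also have "\<dots> = (\<integral>\<^sup>+ u. ennreal (exp (- ?s)) * (ennreal (exp (- u)) * indicator {0<..} u) \<partial>lborel)"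
        by (simp, intro nn_integral_cong) (auto split: split_indicator simp: exp_add exp_diff ennreal_mult[symmetric] exp_minus divide_simps)
      also have "\<dots> = ennreal (exp (- ?s))"
        by (subst nn_integral_cmult[OF em]) (simp add: nn_integral_exp_minus)
      also have "\<dots> = (?E g)"
      proof -
        have "(?E g) = (\<Prod>i<r. ennreal (exp (- g i)))"
          using True by (intro prod.cong) auto
        then show ?thesis by (simp add: prod_ennreal exp_sum sum_negf[symmetric])
      qed
      finally show ?thesis .
    next
      case False
      then have "(?E g) = 0"
        by (intro prod_zero) (auto simp: indicator_def)
      moreover have "\<not> ((\<forall>i\<in>{..<r}. 0 < g i) \<and> (\<Sum>i<r. g i) < t)" for t using False by blast
      ultimately show ?thesis by (simp only: if_False mult_zero_right mult_zero_left nn_integral_const)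
    qed
  qed
  also have "\<dots> = (\<integral>\<^sup>+ g. (\<integral>\<^sup>+ y. (?E g) *
       ((?N g y) * (?P y)) \<partial>?L) \<partial>?L)"
    unfolding gauss_positive_def
  proof (rule nn_integral_cong, rule nn_integral_cmult[symmetric])
    fix g assume g: "g \<in> space ?L"
    show "(\<lambda>y. (?N g y) * (?P y)) \<in> borel_measurable ?L"
      using measurable_compose[OF measurable_Pair1'[OF g] pm] by simp
  qed
  also have "\<dots> = (\<integral>\<^sup>+ y. (\<integral>\<^sup>+ g. (?E g) *
       ((?N g y) * (?P y)) \<partial>?L) \<partial>?L)"
  proof (rule LL.Fubini'[symmetric])
    have [measurable]: "(\<lambda>x. \<Prod>i<r. ennreal (exp (- fst x i)) * indicator {0<..} (fst x i)) \<in> borel_measurable (?L \<Otimes>\<^sub>M ?L)"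
      by (intro borel_measurable_prod_ennreal) simp
    show "(\<lambda>(g, y). (?E g) *
       ((?N g y) * (?P y))) \<in> borel_measurable (?L \<Otimes>\<^sub>M ?L)"
      unfolding case_prod_beta' by measurable
  qed
  also have "\<dots> = (\<integral>\<^sup>+ y. (\<Prod>i<r. step_density (y i)) * (?P y) \<partial>?L)"
  proof (rule nn_integral_cong)
    fix y :: "nat \<Rightarrow> real"
    have "(\<integral>\<^sup>+ g. (?E g) *
       ((?N g y) * (?P y)) \<partial>?L)
      = (\<integral>\<^sup>+ g. (\<Prod>i<r. ennreal (exp (- g i) * normal_density 0 (sqrt (g i)) (y i)) * indicator {0<..} (g i)) * (?P y) \<partial>?L)"
      by (intro nn_integral_cong) (auto simp: prod.distrib[symmetric] ennreal_mult mult_ac)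
    also have "\<dots> = (\<integral>\<^sup>+ g. (\<Prod>i<r. ennreal (exp (- g i) * normal_density 0 (sqrt (g i)) (y i)) * indicator {0<..} (g i)) \<partial>?L) * (?P y)"
      unfolding normal_density_def
      by (intro nn_integral_multc borel_measurable_prod_ennreal) simp
    also have "(\<integral>\<^sup>+ g. (\<Prod>i<r. ennreal (exp (- g i) * normal_density 0 (sqrt (g i)) (y i)) * indicator {0<..} (g i)) \<partial>?L)
      = (\<Prod>i<r. step_density (y i))"
      unfolding step_density_def
      by (rule product_nn_integral_prod) (auto simp: normal_density_def)
    finally show "(\<integral>\<^sup>+ g. (?E g) *
       ((?N g y) * (?P y)) \<partial>?L)
      = (\<Prod>i<r. step_density (y i)) * (?P y)" .
  qed
  finally show ?thesis unfolding stay_prob_eq_nn_integral .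
qed

text \<open>The probabilities are finite, so the convolution identity can be read in the reals,
  where \<open>convolution_one_unique\<close> and \<open>half_convolution\<close> settle it.\<close>

lemma stay_prob_closed_form: "exp_walk.stay_prob r = ennreal (pochhammer (1 / 2) r / fact r)"
proof -
  have le1: "exp_walk.stay_prob r \<le> 1" for r
    unfolding exp_walk.stay_prob_def
    using prob_space.emeasure_le_1[OF exp_walk.prob_steps_on] .
  define p where "p r = enn2real (exp_walk.stay_prob r)" for r
  have p: "exp_walk.stay_prob r = ennreal (p r)" for r
    unfolding p_def using le_less_trans[OF le1[of r] ennreal_one_less_top]
    by simp
  have p0: "0 \<le> p r" for r by (simp add: p_def)
  have "p r = pochhammer (1 / 2) r / fact r"
  proof (rule convolution_one_unique)
    fix n
    have "ennreal (\<Sum>k\<le>n. p k * p (n - k)) = ennreal 1"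
      using exp_walk.stay_prob_convolution[of n] p0 by (simp add: p ennreal_mult[symmetric])
    then show "(\<Sum>k\<le>n. p k * p (n - k)) = 1"
      using p0 by (subst (asm) ennreal_inj) (auto intro!: sum_nonneg)
    show "p 0 = 1"
      using prob_space.emeasure_space_1[OF exp_walk.prob_steps_on, of "{}"] by (simp add: p_def exp_walk.stay_prob_def)
    show "(\<Sum>k\<le>n. (pochhammer (1 / 2) k / fact k) * (pochhammer (1 / 2) (n - k) / fact (n - k))) = (1 :: real)"
      by (rule half_convolution)
  qed simp
  then show ?thesis by (simp add: p)
qed

text \<open>By scaling the r-th moment is a multiple of t^r, and the average of t^r over an
  exponential time is r!. This is the factorial in \<open>sojourn_moment\<close>, so E \<Gamma>(1)^r
  is exactly \<open>exp_walk.stay_prob r\<close>.\<close>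

lemma (in brownian) sojourn_time_moments:
  assumes t: "0 < t"
  shows "(\<integral>\<^sup>+ \<omega>. ennreal (sojourn_time B t \<omega> ^ r) \<partial>M) = ennreal (t ^ r * (pochhammer (1 / 2) r / fact r))"
proof -
  have nn: "(\<integral>\<^sup>+ \<omega>. ennreal (sojourn_time B t \<omega> ^ r) \<partial>M) = ennreal (fact r) * sojourn_moment r t" if "0 < t" for t
  proof -
    have "(\<integral>\<^sup>+ \<omega>. ennreal (sojourn_time B t \<omega> ^ r) \<partial>M) = (\<integral>\<^sup>+ \<omega>. ennreal (fact r) * ennreal (sojourn_time B t \<omega> ^ r / fact r) \<partial>M)"
      using sojourn_time_bounds[of _ t] that by (intro nn_integral_cong) (simp add: ennreal_mult[symmetric])
    also have "\<dots> = ennreal (fact r) * sojourn_moment r t"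
      by (subst nn_integral_cmult) (auto simp: nn_integral_sojourn_time_power that)
    finally show ?thesis .
  qed
  have scale: "sojourn_moment r t = ennreal (t ^ r) * sojourn_moment r 1" if t: "0 < t" for t
  proof -
    \<comment> \<open>The rescaled process is again a Brownian motion on the same space and hence
      shares \<open>sojourn_moment\<close>.\<close>
    interpret B': brownian M "\<lambda>s \<omega>. B (t * s) \<omega> / sqrt t"
      by unfold_locales (rule brownian_scale[OF t])
    have "sojourn_moment r t = (\<integral>\<^sup>+ \<omega>. ennreal (sojourn_time B t \<omega> ^ r / fact r) \<partial>M)"
      by (rule nn_integral_sojourn_time_power[OF t, symmetric])
    also have "\<dots> = (\<integral>\<^sup>+ \<omega>. ennreal (t ^ r) * ennreal (sojourn_time (\<lambda>s \<omega>. B (t * s) \<omega> / sqrt t) 1 \<omega> ^ r / fact r) \<partial>M)"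
      using t B'.sojourn_time_bounds[of _ 1]
      by (intro nn_integral_cong) (simp add: sojourn_time_scale[OF t] power_mult_distrib ennreal_mult[symmetric])
    also have "\<dots> = ennreal (t ^ r) * sojourn_moment r 1"
      using B'.measurable_sojourn_time[of 1]
      by (subst nn_integral_cmult) (auto simp: B'.nn_integral_sojourn_time_power)
    finally show ?thesis .
  qed
  have "exp_walk.stay_prob r = (\<integral>\<^sup>+ t. ennreal (exp (- t)) * indicator {0<..} t * sojourn_moment r t \<partial>lborel)"
    by (rule nn_integral_sojourn_moment[symmetric])
  also have "\<dots> = (\<integral>\<^sup>+ t. (ennreal (t ^ r * exp (- t)) * indicator {0..} t) * sojourn_moment r 1 \<partial>lborel)"
  proof (intro nn_integral_cong_AE)
    show "AE t in lborel. ennreal (exp (- t)) * indicator {0<..} t * sojourn_moment r t =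
       (ennreal (t ^ r * exp (- t)) * indicator {0..} t) * sojourn_moment r 1"
      using AE_lborel_singleton[of "0::real"]
    proof eventually_elim
      case (elim t)
      show ?case
      proof (cases "0 < t")
        case True
        show ?thesis unfolding scale[OF True] using True by (simp add: ennreal_mult mult_ac)
      qed (use elim in simp)
    qed
  qed
  also have "\<dots> = ennreal (fact r) * sojourn_moment r 1"
    by (subst nn_integral_multc) (auto simp: nn_intergal_power_times_exp_Ici)
  finally have "ennreal (fact r) * sojourn_moment r 1 = ennreal (pochhammer (1 / 2) r / fact r)"
    by (simp add: stay_prob_closed_form)
  then have "(\<integral>\<^sup>+ \<omega>. ennreal (sojourn_time B t \<omega> ^ r) \<partial>M) = ennreal (t ^ r) * ennreal (pochhammer (1 / 2) r / fact r)"
    unfolding nn[OF t] scale[OF t] by (metis mult.left_commute)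
  then show ?thesis using t by (simp add: ennreal_mult[symmetric] pochhammer_nonneg)
qed

section \<open>The arcsine density and its moments\<close>

definition arcsine_density :: "real \<Rightarrow> real \<Rightarrow> real" where
  "arcsine_density t s = indicator {0<..<t} s / (pi * sqrt (s * (t - s)))"

lemma measurable_arcsine_density [measurable]: "arcsine_density t \<in> borel_measurable borel"
  unfolding arcsine_density_def[abs_def] by measurable

lemma arcsine_moments:
  assumes t: "0 < t"
  shows "(\<integral>\<^sup>+ s. ennreal (arcsine_density t s) * ennreal (s ^ k) \<partial>lborel) = ennreal (t ^ k * (pochhammer (1 / 2) k / fact k))"
proof -
  have "(\<integral>\<^sup>+ s. ennreal (arcsine_density t s) * ennreal (s ^ k) \<partial>lborel) =
    (\<integral>\<^sup>+ s. ennreal (1 / pi) * (ennreal ((s - 0) powr (1 / 2 + real k - 1) * (t - s) powr (1 / 2 - 1)) * indicator {0<..<t} s) \<partial>lborel)"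
  proof (rule nn_integral_cong)
    fix s :: real
    show "ennreal (arcsine_density t s) * ennreal (s ^ k) = ennreal (1 / pi) * (ennreal ((s - 0) powr (1 / 2 + real k - 1) * (t - s) powr (1 / 2 - 1)) * indicator {0<..<t} s)"
    proof (cases "s \<in> {0<..<t}")
      case True
      have "s powr (1 / 2 + real k - 1) = s ^ k / sqrt s"
        using True powr_add[of s "real k" "- (1 / 2)"]
        by (simp add: powr_realpow powr_minus powr_half_sqrt divide_simps)
      moreover have "(t - s) powr (1 / 2 - 1) = 1 / sqrt (t - s)"
        using True by (simp add: powr_minus powr_half_sqrt divide_simps)
      ultimately show ?thesis using True
        by (simp add: arcsine_density_def real_sqrt_mult ennreal_mult[symmetric] mult_ac)
    qed (simp add: arcsine_density_def)
  qed
  also have "\<dots> = ennreal (1 / pi) * ennreal ((t - 0) powr (1 / 2 + real k + 1 / 2 - 1) * Beta (1 / 2 + real k) (1 / 2))"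
    by (subst nn_integral_cmult, measurable, subst nn_integral_Beta) (use t in auto)
  also have "\<dots> = ennreal (t ^ k * (pochhammer (1 / 2) k / fact k))"
  proof -
    have "Beta (1 / 2 + real k) (1 / 2) = pi * (pochhammer (1 / 2) k / fact k)"
      by (subst Beta_add_nat) (auto simp: Beta_def Gamma_one_half_real pochhammer_fact)
    then show ?thesis using t
      by (simp add: ennreal_mult[symmetric] powr_realpow pochhammer_nonneg)
  qed
  finally show ?thesis .
qed

lemma (in brownian) arcsine_law:
  assumes t: "0 < t"
  shows "distr M borel (sojourn_time B t) = density lborel (\<lambda>s. ennreal (arcsine_density t s))"
proof (rule measure_eqI_moments[where K = t])
  show "prob_space (distr M borel (sojourn_time B t))" by (rule prob_space_distr) simp
  show "AE x in distr M borel (sojourn_time B t). 0 \<le> x \<and> x \<le> t"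
    using sojourn_time_bounds[of _ t] t by (subst AE_distr_iff) auto
  show "prob_space (density lborel (\<lambda>s. ennreal (arcsine_density t s)))"
    using arcsine_moments[OF t, of 0] by (intro prob_spaceI) (simp add: emeasure_density)
  show "AE x in density lborel (\<lambda>s. ennreal (arcsine_density t s)). 0 \<le> x \<and> x \<le> t"
    by (subst AE_density) (auto simp: arcsine_density_def indicator_def)
  show "(\<integral>\<^sup>+ x. ennreal (x ^ k) \<partial>distr M borel (sojourn_time B t)) =
     (\<integral>\<^sup>+ x. ennreal (x ^ k) \<partial>density lborel (\<lambda>s. ennreal (arcsine_density t s)))" for k
    by (subst nn_integral_distr, simp, simp, subst nn_integral_density)
       (auto simp: sojourn_time_moments[OF t] arcsine_moments[OF t])
qed auto

section \<open>Moments of a random flight\<close>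

text \<open>The k-th moment of 1 + cos \<theta>. For m = 1 the weight is sin^2 \<theta> = 2 (1 + cos
  \<theta>) - (1 + cos \<theta>)^2, so two consecutive integrals from
  \<open>integral_one_plus_cos_power\<close> are subtracted; with the prefactor 2 / \<pi> their
  powers of 2 combine to 8 * 2^k.\<close>

definition direction_moment :: "nat \<Rightarrow> nat \<Rightarrow> real" where
  "direction_moment m k = (if m = 0 then 2 ^ k * pochhammer (1 / 2) k / fact k
     else 8 * 2 ^ k * (pochhammer (1 / 2) (Suc k) / fact (Suc k) - pochhammer (1 / 2) (Suc (Suc k)) / fact (Suc (Suc k))))"

definition direction_law :: "nat \<Rightarrow> real measure" where
  "direction_law m = density lborel (\<lambda>x. ennreal (direction_density m x))"

lemma measurable_direction_density [measurable]: "direction_density m \<in> borel_measurable borel"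
  unfolding direction_density_def[abs_def] by measurable

lemma space_direction_law [simp]: "space (direction_law m) = UNIV"
  and sets_direction_law [simp, measurable_cong]: "sets (direction_law m) = sets borel"
  by (simp_all add: direction_law_def)

lemma nn_integral_direction_moment:
  assumes m: "m \<in> {0, 1}"
  shows "(\<integral>\<^sup>+ x. ennreal ((1 + cos x) ^ k) \<partial>direction_law m) = ennreal (direction_moment m k)"
proof -
  have c0: "0 \<le> 1 + cos x" for x :: real using cos_ge_minus_one[of x] by linarith
  have i: "(\<lambda>x. (1 + cos x) ^ j) integrable_on {0..pi}" for j
    by (intro integrable_continuous_real continuous_intros)
  let ?h = "\<lambda>x. direction_density m x * (1 + cos x) ^ k"
  let ?C = "Gamma (real m + 1) / (sqrt pi * Gamma (real m + 1 / 2))"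
  have C: "?C = (if m = 0 then 1 / pi else 2 / pi)"
  proof (cases "m = 0")
    case False
    have "(1 / 2 :: real) \<notin> \<int>\<^sub>\<le>\<^sub>0" using nonpos_Ints_nonpos[of "1 / 2 :: real"] by auto
    then have "Gamma (3 / 2 :: real) = sqrt pi / 2"
      using Gamma_plus1[of "1 / 2 :: real"] by (simp add: Gamma_one_half_real)
    then have "sqrt pi * Gamma (3 / 2 :: real) = sqrt pi * (sqrt pi / 2)" by (simp only:)
    then have "sqrt pi * Gamma (3 / 2 :: real) = pi / 2" by simp
    moreover have "Gamma 2 = (1 :: real)" using Gamma_fact[of 1, where 'a = real] by simp
    moreover have "real m + 1 = 2" "real m + 1 / 2 = 3 / 2" using m False by auto
    ultimately have "?C = 1 / (pi / 2)" by (simp only:)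
    then show ?thesis using False by simp
  qed (simp add: Gamma_one_half_real)
  have eq: "?C * (sin x ^ (2 * m) * (1 + cos x) ^ k) =
     (if m = 0 then 1 / pi * (1 + cos x) ^ k else 2 / pi * (2 * (1 + cos x) ^ Suc k - (1 + cos x) ^ Suc (Suc k)))" for x
  proof -
    have "(sin x)\<^sup>2 = (1 + cos x) * (1 - cos x)"
      by (simp add: sin_squared_eq algebra_simps power2_eq_square)
    then have "(sin x)\<^sup>2 * (1 + cos x) ^ k = (1 + cos x) * (1 - cos x) * (1 + cos x) ^ k" by (simp only:)
    also have "\<dots> = 2 * (1 + cos x) ^ Suc k - (1 + cos x) ^ Suc (Suc k)" by (simp add: algebra_simps)
    finally show ?thesis unfolding C using m by (auto simp del: power_Suc)
  qed
  have "(\<integral>\<^sup>+ x. ennreal ((1 + cos x) ^ k) \<partial>direction_law m) = (\<integral>\<^sup>+ x. ennreal (direction_density m x) * ennreal ((1 + cos x) ^ k) \<partial>lborel)"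
    unfolding direction_law_def by (subst nn_integral_density) auto
  also have "\<dots> = (\<integral>\<^sup>+ x\<in>{0..pi}. ennreal (?C * (sin x ^ (2 * m) * (1 + cos x) ^ k)) \<partial>lborel)"
  proof (rule nn_integral_cong_AE)
    have "AE x in lborel. x \<noteq> 0 \<and> x \<noteq> pi" by (auto intro: AE_lborel_singleton)
    then show "AE x in lborel. ennreal (direction_density m x) * ennreal ((1 + cos x) ^ k)
        = ennreal (?C * (sin x ^ (2 * m) * (1 + cos x) ^ k)) * indicator {0..pi} x"
    proof eventually_elim
      case (elim x)
      then show ?case using C m c0[of x]
        by (auto simp: direction_density_def ennreal_mult[symmetric] mult_ac split: split_indicator)
    qed
  qed
  also have "\<dots> = ennreal (integral {0..pi} (\<lambda>x. ?C * (sin x ^ (2 * m) * (1 + cos x) ^ k)))"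
    using c0 C m by (intro nn_integral_Icc_continuous continuous_intros) (auto intro!: mult_nonneg_nonneg)
  also have "integral {0..pi} (\<lambda>x. ?C * (sin x ^ (2 * m) * (1 + cos x) ^ k)) = direction_moment m k"
  proof (cases "m = 0")
    case True
    then show ?thesis unfolding eq
      by (simp add: integral_one_plus_cos_power direction_moment_def)
  next
    case False
    then have "integral {0..pi} (\<lambda>x. ?C * (sin x ^ (2 * m) * (1 + cos x) ^ k)) =
      integral {0..pi} (\<lambda>x. 2 / pi * (2 * (1 + cos x) ^ Suc k - (1 + cos x) ^ Suc (Suc k)))"
      unfolding eq by simp
    also have "\<dots> = 2 / pi * (2 * integral {0..pi} (\<lambda>x. (1 + cos x) ^ Suc k) - integral {0..pi} (\<lambda>x. (1 + cos x) ^ Suc (Suc k)))"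
      using i by (simp add: Henstock_Kurzweil_Integration.integral_diff integrable_on_cmult_left del: power_Suc)
    also have "\<dots> = direction_moment m k"
      unfolding integral_one_plus_cos_power direction_moment_def using False
      by (simp add: divide_simps) (simp add: algebra_simps)
    finally show ?thesis .
  qed
  finally show ?thesis .
qed

lemma direction_moment_nonneg:
  assumes "m \<in> {0, 1}" shows "0 \<le> direction_moment m k"
proof (cases "m = 0")
  case False
  have "pochhammer (1 / 2) (Suc (Suc k)) / fact (Suc (Suc k)) = pochhammer (1 / 2) (Suc k) / fact (Suc k) * ((1 / 2 + real (Suc k)) / (real k + 2))"
    by (simp add: pochhammer_Suc[of _ "Suc k"] divide_simps)
  also have "\<dots> \<le> pochhammer (1 / 2) (Suc k) / fact (Suc k) * 1"
    by (intro mult_left_mono) (auto intro!: divide_nonneg_nonneg pochhammer_nonneg)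
  finally show ?thesis using False by (simp add: direction_moment_def)
qed (simp add: direction_moment_def pochhammer_nonneg)

lemma prob_space_direction_law:
  assumes "m \<in> {0, 1}" shows "prob_space (direction_law m)"
proof
  have "direction_moment m 0 = 1" by (simp add: direction_moment_def pochhammer_Suc numeral_2_eq_2)
  then show "emeasure (direction_law m) (space (direction_law m)) = 1"
    using nn_integral_direction_moment[OF assms, of 0] by simp
qed

text \<open>\<open>E ((\<Sum>j<n. g j * (1 + cos \<theta>\<^sub>j)) ^ k / k!)\<close> for i.i.d. directions \<open>\<theta>\<^sub>j\<close>.\<close>

fun flight_moment :: "nat \<Rightarrow> nat \<Rightarrow> nat \<Rightarrow> (nat \<Rightarrow> real) \<Rightarrow> real" where
  "flight_moment m 0 k g = (if k = 0 then 1 else 0)"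
| "flight_moment m (Suc n) k g = (\<Sum>i\<le>k. g n ^ i / fact i * direction_moment m i * flight_moment m n (k - i) g)"

lemma flight_moment_cong: "(\<And>j. j < n \<Longrightarrow> g j = h j) \<Longrightarrow> flight_moment m n k g = flight_moment m n k h"
  by (induction n arbitrary: k) auto

lemma flight_moment_nonneg:
  "m \<in> {0, 1} \<Longrightarrow> (\<And>j. j < n \<Longrightarrow> 0 \<le> g j) \<Longrightarrow> 0 \<le> flight_moment m n k g"
proof (induction n arbitrary: k)
  case (Suc n)
  have "0 \<le> flight_moment m n j g" for j using Suc by simp
  then show ?case
    using Suc.prems direction_moment_nonneg[OF Suc.prems(1)] unfolding flight_moment.simps
    by (intro sum_nonneg mult_nonneg_nonneg divide_nonneg_nonneg zero_le_power) auto
qed simp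

text \<open>With divided powers the binomial theorem has no coefficients, so moments of sums of
  independent terms combine as a Cauchy product.\<close>

lemma binomial_divided_fact:
  fixes a b :: real
  shows "(a + b) ^ k / fact k = (\<Sum>i\<le>k. b ^ i / fact i * (a ^ (k - i) / fact (k - i)))"
proof -
  have "(a + b) ^ k / fact k = (\<Sum>i\<le>k. real (k choose i) * b ^ i * a ^ (k - i) / fact k)"
    using binomial_ring[of b a k] by (simp add: add.commute sum_divide_distrib)
  also have "\<dots> = (\<Sum>i\<le>k. b ^ i / fact i * (a ^ (k - i) / fact (k - i)))"
    by (intro sum.cong refl) (simp add: binomial_fact)
  finally show ?thesis .
qed

text \<open>The last direction is integrated out and the divided power expanded. Nonnegative gaps
  and 1 + cos \<theta> \<ge> 0 allow the sum to be split inside \<open>ennreal\<close>.\<close>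

lemma nn_integral_directions:
  assumes m: "m \<in> {0, 1}" and g: "\<And>j. j < n \<Longrightarrow> 0 \<le> g j"
  shows "(\<integral>\<^sup>+ \<theta>. ennreal ((\<Sum>j<n. g j * (1 + cos (\<theta> j))) ^ k / fact k) \<partial>Pi\<^sub>M {..<n} (\<lambda>_. direction_law m))
    = ennreal (flight_moment m n k g)"
  using g
proof (induction n arbitrary: k)
  case 0
  then show ?case by (simp add: PiM_empty)
next
  case (Suc n)
  have c0: "0 \<le> 1 + cos x" for x :: real using cos_ge_minus_one[of x] by linarith
  interpret prob_space "direction_law m" by (rule prob_space_direction_law[OF m])
  interpret product_sigma_finite "\<lambda>_ :: nat. direction_law m" by unfold_locales
  let ?P = "Pi\<^sub>M {..<n} (\<lambda>_ :: nat. direction_law m)"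
  let ?Y = "\<lambda>n \<theta>. \<Sum>j<n. g j * (1 + cos (\<theta> j))"
  have Y0: "0 \<le> ?Y n \<theta>" for \<theta> using Suc.prems c0 by (intro sum_nonneg mult_nonneg_nonneg) auto
  have Yf: "0 \<le> ?Y n \<theta> ^ j / fact j" for \<theta> j using Y0 by (intro divide_nonneg_nonneg zero_le_power) auto
  have gn: "0 \<le> g n ^ j / fact j" for j using Suc.prems[of n] by simp
  have Ym: "?Y l \<in> borel_measurable (Pi\<^sub>M {..<l} (\<lambda>_. direction_law m))" for l
    by (intro borel_measurable_sum) measurable
  note [measurable] = Ym
  have "(\<integral>\<^sup>+ \<theta>. ennreal (?Y (Suc n) \<theta> ^ k / fact k) \<partial>Pi\<^sub>M (insert n {..<n}) (\<lambda>_. direction_law m))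
     = (\<integral>\<^sup>+ \<theta>. (\<integral>\<^sup>+ x. ennreal (?Y (Suc n) (\<theta>(n := x)) ^ k / fact k) \<partial>direction_law m) \<partial>?P)"
    using Ym[of "Suc n"] by (intro product_nn_integral_insert) (auto simp: lessThan_Suc[symmetric] simp del: sum.lessThan_Suc)
  also have "\<dots> = (\<integral>\<^sup>+ \<theta>. (\<Sum>i\<le>k. ennreal (g n ^ i / fact i * direction_moment m i) * ennreal (?Y n \<theta> ^ (k - i) / fact (k - i))) \<partial>?P)"
  proof (rule nn_integral_cong)
    fix \<theta> :: "nat \<Rightarrow> real"
    have Ys: "?Y (Suc n) (\<theta>(n := x)) = ?Y n \<theta> + g n * (1 + cos x)" for x by simp
    have "(\<integral>\<^sup>+ x. ennreal (?Y (Suc n) (\<theta>(n := x)) ^ k / fact k) \<partial>direction_law m)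
      = (\<integral>\<^sup>+ x. (\<Sum>i\<le>k. ennreal (g n ^ i / fact i * (?Y n \<theta> ^ (k - i) / fact (k - i))) * ennreal ((1 + cos x) ^ i)) \<partial>direction_law m)"
    proof (rule nn_integral_cong)
      fix x
      have "?Y (Suc n) (\<theta>(n := x)) ^ k / fact k = (\<Sum>i\<le>k. g n ^ i / fact i * (?Y n \<theta> ^ (k - i) / fact (k - i)) * (1 + cos x) ^ i)"
        unfolding Ys binomial_divided_fact by (intro sum.cong refl) (simp add: power_mult_distrib)
      then have "ennreal (?Y (Suc n) (\<theta>(n := x)) ^ k / fact k) = (\<Sum>i\<le>k. ennreal (g n ^ i / fact i * (?Y n \<theta> ^ (k - i) / fact (k - i)) * (1 + cos x) ^ i))"
        by (simp only:) (intro sum_ennreal[symmetric] mult_nonneg_nonneg gn Yf zero_le_power c0)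
      also have "\<dots> = (\<Sum>i\<le>k. ennreal (g n ^ i / fact i * (?Y n \<theta> ^ (k - i) / fact (k - i))) * ennreal ((1 + cos x) ^ i))"
        by (intro sum.cong refl ennreal_mult mult_nonneg_nonneg gn Yf zero_le_power c0)
      finally show "ennreal (?Y (Suc n) (\<theta>(n := x)) ^ k / fact k) = (\<Sum>i\<le>k. ennreal (g n ^ i / fact i * (?Y n \<theta> ^ (k - i) / fact (k - i))) * ennreal ((1 + cos x) ^ i))" .
    qed
    also have "\<dots> = (\<Sum>i\<le>k. ennreal (g n ^ i / fact i * (?Y n \<theta> ^ (k - i) / fact (k - i))) * ennreal (direction_moment m i))"
      by (subst nn_integral_sum, simp, intro sum.cong refl)
         (subst nn_integral_cmult, simp, simp only: nn_integral_direction_moment[OF m])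
    also have "\<dots> = (\<Sum>i\<le>k. ennreal (g n ^ i / fact i * direction_moment m i) * ennreal (?Y n \<theta> ^ (k - i) / fact (k - i)))"
      using gn Yf[of \<theta>] direction_moment_nonneg[OF m]
      by (intro sum.cong refl) (simp only: ennreal_mult mult.assoc mult.commute mult.left_commute)
    finally show "(\<integral>\<^sup>+ x. ennreal (?Y (Suc n) (\<theta>(n := x)) ^ k / fact k) \<partial>direction_law m) =
       (\<Sum>i\<le>k. ennreal (g n ^ i / fact i * direction_moment m i) * ennreal (?Y n \<theta> ^ (k - i) / fact (k - i)))" .
  qed
  also have "\<dots> = (\<Sum>i\<le>k. ennreal (g n ^ i / fact i * direction_moment m i) * ennreal (flight_moment m n (k - i) g))"
    using Suc by (subst nn_integral_sum, simp, intro sum.cong refl) (subst nn_integral_cmult, simp, simp)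
  also have "\<dots> = ennreal (flight_moment m (Suc n) k g)"
    using Suc.prems direction_moment_nonneg[OF m] flight_moment_nonneg[OF m, of n g]
    by (simp add: ennreal_mult[symmetric] sum_ennreal)
  finally show ?case unfolding lessThan_Suc .
qed

text \<open>Divided powers are closed under convolution, with one extra power of v. Iterated, this
  is the Dirichlet integral over a simplex.\<close>

lemma nn_integral_beta_power:
  fixes v :: real
  assumes v: "0 < v"
  shows "(\<integral>\<^sup>+ x\<in>{0<..<v}. ennreal (x ^ i / fact i * ((v - x) ^ j / fact j)) \<partial>lborel) = ennreal (v ^ Suc (i + j) / fact (Suc (i + j)))"
proof -
  have "(\<integral>\<^sup>+ x\<in>{0<..<v}. ennreal (x ^ i / fact i * ((v - x) ^ j / fact j)) \<partial>lborel)
    = (\<integral>\<^sup>+ x. ennreal (1 / (fact i * fact j)) * (ennreal ((x - 0) powr (real (Suc i) - 1) * (v - x) powr (real (Suc j) - 1)) * indicator {0<..<v} x) \<partial>lborel)"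
    by (intro nn_integral_cong) (auto simp: ennreal_mult[symmetric] powr_realpow divide_simps split: split_indicator)
  also have "\<dots> = ennreal (1 / (fact i * fact j)) * ennreal ((v - 0) powr (real (Suc i) + real (Suc j) - 1) * Beta (real (Suc i)) (real (Suc j)))"
    by (subst nn_integral_cmult, measurable, subst nn_integral_Beta) (use v in auto)
  also have "\<dots> = ennreal (v ^ Suc (i + j) / fact (Suc (i + j)))"
  proof -
    have "Beta (real (Suc i)) (real (Suc j)) = fact i * fact j / fact (Suc (i + j))"
      using Gamma_fact[of i, where 'a = real] Gamma_fact[of j, where 'a = real] Gamma_fact[of "Suc (i + j)", where 'a = real]
      by (simp add: Beta_def add_ac)
    moreover have "(v - 0) powr (real (Suc i) + real (Suc j) - 1) = v ^ Suc (i + j)"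
      using powr_realpow[OF v, of "Suc (i + j)"] by (simp add: add_ac)
    ultimately show ?thesis using v by (simp add: ennreal_mult[symmetric] del: power_Suc fact_Suc)
  qed
  finally show ?thesis .
qed

text \<open>For k = n - 1 this is the density of a sum of n independent exponential gaps. The
  exponent of u is kept apart from that of \<open>lam\<close>, because powers of the gaps coming
  from the moments raise only the former.\<close>

definition gamma_weight :: "real \<Rightarrow> nat \<Rightarrow> nat \<Rightarrow> real \<Rightarrow> ennreal" where
  "gamma_weight lam n k u = ennreal (lam ^ n * exp (- lam * u) * (u ^ k / fact k)) * indicator {0<..} u"

lemma measurable_gamma_weight [measurable]: "gamma_weight lam n k \<in> borel_measurable borel"
  unfolding gamma_weight_def[abs_def] by measurable

text \<open>Tested against f, the convolution of two weights is a weight: exponentials and powers of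
  \<open>lam\<close> multiply, and the divided powers combine by
  \<open>nn_integral_beta_power\<close>.\<close>

lemma gamma_weight_convolution:
  fixes f :: "real \<Rightarrow> ennreal"
  assumes [measurable]: "f \<in> borel_measurable borel" and lam: "0 < lam"
  shows "(\<integral>\<^sup>+ x. gamma_weight lam a i x * (\<integral>\<^sup>+ u. f (u + x) * gamma_weight lam b j u \<partial>lborel) \<partial>lborel)
    = (\<integral>\<^sup>+ v. f v * gamma_weight lam (a + b) (Suc (i + j)) v \<partial>lborel)"
proof -
  let ?U = "\<lambda>x. (\<integral>\<^sup>+ u. f (u + x) * gamma_weight lam b j u \<partial>lborel)"
  let ?F = "\<lambda>v x. (f v * gamma_weight lam b j (v - x))"
  let ?P = "\<lambda>v x. ennreal (x ^ i / fact i * ((v - x) ^ j / fact j))"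
  have "(\<integral>\<^sup>+ x. gamma_weight lam a i x * (?U x) \<partial>lborel)
    = (\<integral>\<^sup>+ x. (\<integral>\<^sup>+ v. gamma_weight lam a i x * (?F v x) \<partial>lborel) \<partial>lborel)"
  proof (rule nn_integral_cong)
    fix x :: real
    have "(\<integral>\<^sup>+ v. f v * gamma_weight lam b j (v - x) \<partial>lborel)
      = ennreal \<bar>1\<bar> * (\<integral>\<^sup>+ u. f (x + 1 * u) * gamma_weight lam b j (x + 1 * u - x) \<partial>lborel)"
      by (rule nn_integral_real_affine) auto
    then have "(?U x) = (\<integral>\<^sup>+ v. f v * gamma_weight lam b j (v - x) \<partial>lborel)"
      by (simp add: add.commute)
    then show "gamma_weight lam a i x * (?U x)
      = (\<integral>\<^sup>+ v. gamma_weight lam a i x * (?F v x) \<partial>lborel)"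
      by (simp add: nn_integral_cmult)
  qed
  also have "\<dots> = (\<integral>\<^sup>+ v. (\<integral>\<^sup>+ x. gamma_weight lam a i x * (?F v x) \<partial>lborel) \<partial>lborel)"
    by (rule lborel_pair.Fubini') simp
  also have "\<dots> = (\<integral>\<^sup>+ v. f v * gamma_weight lam (a + b) (Suc (i + j)) v \<partial>lborel)"
  proof (rule nn_integral_cong)
    fix v :: real
    have pt: "gamma_weight lam a i x * (?F v x) =
      (f v * ennreal (lam ^ (a + b) * exp (- lam * v))) * ((?P v x) * indicator {0<..<v} x)" for x
    proof (cases "x \<in> {0<..<v}")
      case True
      have "exp (- lam * x) * exp (- lam * (v - x)) = exp (- lam * v)"
        by (simp add: exp_add[symmetric] algebra_simps)
      then have "(lam ^ a * exp (- lam * x) * (x ^ i / fact i)) * (lam ^ b * exp (- lam * (v - x)) * ((v - x) ^ j / fact j))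
         = (lam ^ (a + b) * exp (- lam * v)) * (x ^ i / fact i * ((v - x) ^ j / fact j))"
        by (simp add: power_add mult_ac)
      then have "ennreal (lam ^ a * exp (- lam * x) * (x ^ i / fact i)) * ennreal (lam ^ b * exp (- lam * (v - x)) * ((v - x) ^ j / fact j))
         = ennreal (lam ^ (a + b) * exp (- lam * v)) * (?P v x)"
        using True lam by (simp add: ennreal_mult[symmetric])
      moreover have "gamma_weight lam a i x = ennreal (lam ^ a * exp (- lam * x) * (x ^ i / fact i))"
        "gamma_weight lam b j (v - x) = ennreal (lam ^ b * exp (- lam * (v - x)) * ((v - x) ^ j / fact j))"
        using True by (simp_all add: gamma_weight_def)
      ultimately have "f v * (gamma_weight lam a i x * gamma_weight lam b j (v - x)) =
        f v * (ennreal (lam ^ (a + b) * exp (- lam * v)) * (?P v x))"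
        by (simp only:)
      then show ?thesis using True by (simp only: indicator_simps mult_1_right mult.assoc mult.left_commute)
    qed (auto simp: gamma_weight_def split: split_indicator)
    have "(\<integral>\<^sup>+ x. gamma_weight lam a i x * (?F v x) \<partial>lborel)
      = (f v * ennreal (lam ^ (a + b) * exp (- lam * v))) * (\<integral>\<^sup>+ x\<in>{0<..<v}. (?P v x) \<partial>lborel)"
      unfolding pt by (rule nn_integral_cmult) measurable
    also have "\<dots> = f v * gamma_weight lam (a + b) (Suc (i + j)) v"
    proof (cases "0 < v")
      case True
      then show ?thesis using lam
        by (simp only: nn_integral_beta_power[OF True])
           (simp add: gamma_weight_def mult.assoc ennreal_mult[symmetric] del: power_Suc fact_Suc)
    next
      case False
      then have "{0<..<v} = {}" by auto
      then show ?thesis using False by (simp add: gamma_weight_def)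
    qed
    finally show "(\<integral>\<^sup>+ x. gamma_weight lam a i x * (?F v x) \<partial>lborel)
      = f v * gamma_weight lam (a + b) (Suc (i + j)) v" .
  qed
  finally show ?thesis .
qed

section \<open>Exponential gaps weighted by flight moments\<close>

definition gap_law :: "real \<Rightarrow> real measure" where
  "gap_law lam = density lborel (\<lambda>x. ennreal (exponential_density lam x))"

lemma space_gap_law [simp]: "space (gap_law lam) = UNIV"
  and sets_gap_law [simp, measurable_cong]: "sets (gap_law lam) = sets borel"
  by (simp_all add: gap_law_def)

lemma prob_space_gap_law: "0 < lam \<Longrightarrow> prob_space (gap_law lam)"
  unfolding gap_law_def by (rule prob_space_exponential_density)

lemma AE_gap_law: "AE x in gap_law lam. 0 < x"
  unfolding gap_law_def using AE_lborel_singleton[of "0 :: real"]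
  by (subst AE_density) (auto elim!: eventually_mono simp: erlang_density_def)

lemma nn_integral_gap_law:
  assumes [measurable]: "f \<in> borel_measurable borel"
  shows "(\<integral>\<^sup>+ x. f x \<partial>gap_law lam) = (\<integral>\<^sup>+ x. gamma_weight lam 1 0 x * f x \<partial>lborel)"
  unfolding gap_law_def
proof (subst nn_integral_density)
  show "(\<integral>\<^sup>+ x. ennreal (exponential_density lam x) * f x \<partial>lborel) = (\<integral>\<^sup>+ x. gamma_weight lam 1 0 x * f x \<partial>lborel)"
    using AE_lborel_singleton[of "0 :: real"]
    by (intro nn_integral_cong_AE)
       (auto elim!: eventually_mono simp: exponential_density_def gamma_weight_def mult_ac split: split_indicator)
qed auto

lemma gamma_weight_power:
  "gamma_weight lam n 0 x * ennreal (x ^ i / fact i) = gamma_weight lam n i x" if "0 < lam"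
  using that by (auto simp: gamma_weight_def ennreal_mult[symmetric] split: split_indicator)

lemma gamma_weight_nonpos: "x \<le> 0 \<Longrightarrow> gamma_weight lam n k x = 0"
  by (simp add: gamma_weight_def)

text \<open>An ordinary generating function is the right one: the i! that divides a power of a gap
  in \<open>flight_moment\<close> is absorbed by the integral over that gap.\<close>

definition flight_coeff :: "nat \<Rightarrow> nat \<Rightarrow> nat \<Rightarrow> real" where
  "flight_coeff m n k = (Abs_fps (direction_moment m) ^ n) $ k"

lemma flight_coeff_1: "flight_coeff m (Suc 0) k = direction_moment m k"
  by (simp add: flight_coeff_def)

lemma flight_coeff_Suc:
  "flight_coeff m (Suc n) k = (\<Sum>i\<le>k. direction_moment m i * flight_coeff m n (k - i))"
  by (simp add: flight_coeff_def fps_mult_nth atMost_atLeast0)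

lemma flight_coeff_nonneg: "m \<in> {0, 1} \<Longrightarrow> 0 \<le> flight_coeff m n k"
proof (induction n arbitrary: k)
  case (Suc n)
  then show ?case unfolding flight_coeff_Suc
    by (intro sum_nonneg mult_nonneg_nonneg direction_moment_nonneg) auto
qed (auto simp: flight_coeff_def)

lemma measurable_flight_moment:
  assumes "\<And>i. sets (N i) = sets (borel :: real measure)"
  shows "n \<le> r \<Longrightarrow> flight_moment m n k \<in> borel_measurable (Pi\<^sub>M {..<r} N)"
proof (induction n arbitrary: k)
  case (Suc n)
  have [measurable]: "(\<lambda>g. g n) \<in> borel_measurable (Pi\<^sub>M {..<r} N)"
    using measurable_component_singleton[of n "{..<r}" N] assms[of n] Suc.prems by (simp cong: measurable_cong_sets)
  have [measurable]: "flight_moment m n j \<in> borel_measurable (Pi\<^sub>M {..<r} N)" for j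
    using Suc by simp
  show ?case unfolding flight_moment.simps by measurable
next
  case 0
  have "flight_moment m 0 k = (\<lambda>_. if k = 0 then 1 else 0)" by (rule ext) simp
  then show ?case by simp
qed

lemma AE_PiM_gap_law:
  assumes "0 < lam"
  shows "AE g in Pi\<^sub>M {..<n} (\<lambda>_ :: nat. gap_law lam). \<forall>j\<in>{..<n}. 0 < g j"
  using assms
  by (intro AE_finite_allI AE_PiM_component) (auto intro: prob_space_gap_law AE_gap_law)

lemma flight_moment_Suc_ennreal:
  assumes m: "m \<in> {0, 1}" and g: "\<And>j. j < n \<Longrightarrow> 0 \<le> g j" and x: "0 \<le> x"
  shows "ennreal (flight_moment m (Suc n) k (g(n := x))) =
    (\<Sum>i\<le>k. ennreal (x ^ i / fact i) * (ennreal (direction_moment m i) * ennreal (flight_moment m n (k - i) g)))"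
proof -
  have fm: "flight_moment m n j (g(n := x)) = flight_moment m n j g" for j
    by (rule flight_moment_cong) simp
  have "ennreal (flight_moment m (Suc n) k (g(n := x))) =
     (\<Sum>i\<le>k. ennreal (x ^ i / fact i * (direction_moment m i * flight_moment m n (k - i) g)))"
    unfolding flight_moment.simps fm mult.assoc fun_upd_same
    using x g m by (intro sum_ennreal[symmetric] mult_nonneg_nonneg direction_moment_nonneg flight_moment_nonneg) auto
  also have "\<dots> = (\<Sum>i\<le>k. ennreal (x ^ i / fact i) * (ennreal (direction_moment m i) * ennreal (flight_moment m n (k - i) g)))"
  proof (intro sum.cong refl)
    fix i
    have "0 \<le> x ^ i / fact i" "0 \<le> direction_moment m i" "0 \<le> flight_moment m n (k - i) g"
      using x g m by (auto intro: direction_moment_nonneg flight_moment_nonneg)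
    then show "ennreal (x ^ i / fact i * (direction_moment m i * flight_moment m n (k - i) g)) =
      ennreal (x ^ i / fact i) * (ennreal (direction_moment m i) * ennreal (flight_moment m n (k - i) g))"
      by (simp only: ennreal_mult mult_nonneg_nonneg)
  qed
  finally show ?thesis .
qed

text \<open>Weighted by \<open>flight_moment\<close>, the total duration of n + 1 exponential gaps
  has an explicit density: the gaps account for the power n and the moment adds k. The test function
  f is arbitrary because the induction applies the claim to a translate of f.\<close>

lemma nn_integral_gaps:
  fixes f :: "real \<Rightarrow> ennreal"
  assumes m: "m \<in> {0, 1}" and lam: "0 < lam" and f: "f \<in> borel_measurable borel"
  shows "(\<integral>\<^sup>+ g. f (\<Sum>j<Suc n. g j) * ennreal (flight_moment m (Suc n) k g) \<partial>Pi\<^sub>M {..<Suc n} (\<lambda>_. gap_law lam))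
    = ennreal (flight_coeff m (Suc n) k) * (\<integral>\<^sup>+ u. f u * gamma_weight lam (Suc n) (k + n) u \<partial>lborel)"
  using f
proof (induction n arbitrary: k f)
  interpret prob_space "gap_law lam" by (rule prob_space_gap_law[OF lam])
  interpret product_sigma_finite "\<lambda>_ :: nat. gap_law lam" by unfold_locales
  {
    case 0
    note [measurable] = 0
    have fm: "flight_moment m (Suc 0) k g = g 0 ^ k / fact k * direction_moment m k" for g
    proof -
      have "flight_moment m (Suc 0) k g = (\<Sum>i\<le>k. if i = k then g 0 ^ i / fact i * direction_moment m i else 0)"
        unfolding flight_moment.simps by (intro sum.cong) auto
      then show ?thesis by simp
    qed
    have "(\<integral>\<^sup>+ g. f (\<Sum>j<Suc 0. g j) * ennreal (flight_moment m (Suc 0) k g) \<partial>Pi\<^sub>M {..<Suc 0} (\<lambda>_. gap_law lam))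
      = (\<integral>\<^sup>+ g. (\<lambda>x. f x * ennreal (x ^ k / fact k * direction_moment m k)) (g 0) \<partial>Pi\<^sub>M {0 :: nat} (\<lambda>_. gap_law lam))"
      unfolding fm by (simp add: lessThan_Suc)
    also have "\<dots> = (\<integral>\<^sup>+ x. f x * ennreal (x ^ k / fact k * direction_moment m k) \<partial>gap_law lam)"
      by (rule product_nn_integral_singleton) measurable
    also have "\<dots> = (\<integral>\<^sup>+ x. gamma_weight lam 1 0 x * (f x * ennreal (x ^ k / fact k * direction_moment m k)) \<partial>lborel)"
      by (rule nn_integral_gap_law) measurable
    also have "\<dots> = (\<integral>\<^sup>+ x. ennreal (direction_moment m k) * (f x * gamma_weight lam 1 k x) \<partial>lborel)"
    proof (rule nn_integral_cong)
      fix x :: real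
      show "gamma_weight lam 1 0 x * (f x * ennreal (x ^ k / fact k * direction_moment m k)) = ennreal (direction_moment m k) * (f x * gamma_weight lam 1 k x)"
      proof (cases "0 < x")
        case True
        have e: "ennreal (x ^ k / fact k * direction_moment m k) = ennreal (x ^ k / fact k) * ennreal (direction_moment m k)"
          using True direction_moment_nonneg[OF m] by (intro ennreal_mult) auto
        show ?thesis unfolding gamma_weight_power[OF lam, of 1 x k, symmetric] e by (simp only: mult_ac)
      qed (simp add: gamma_weight_nonpos)
    qed
    also have "\<dots> = ennreal (flight_coeff m (Suc 0) k) * (\<integral>\<^sup>+ u. f u * gamma_weight lam (Suc 0) (k + 0) u \<partial>lborel)"
      by (subst nn_integral_cmult) (auto simp: flight_coeff_1)
    finally show ?case .
  next
    case (Suc n)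
    note [measurable] = Suc.prems
  let ?U = "\<lambda>i x. (\<integral>\<^sup>+ u. f (u + x) * gamma_weight lam (Suc n) (k - i + n) u \<partial>lborel)"
  let ?V = "(\<integral>\<^sup>+ u. f u * gamma_weight lam (Suc (Suc n)) (k + Suc n) u \<partial>lborel)"
  let ?D = "\<lambda>i. ennreal (direction_moment m i)"
  let ?C = "\<lambda>i. ennreal (flight_coeff m (Suc n) (k - i))"
  let ?K = "\<lambda>g x. f (\<Sum>j<Suc (Suc n). (g(Suc n := x)) j) * ennreal (flight_moment m (Suc (Suc n)) k (g(Suc n := x)))"
  let ?J = "\<lambda>g i. ennreal (flight_moment m (Suc n) (k - i) g)"
    let ?P = "Pi\<^sub>M {..<Suc n} (\<lambda>_ :: nat. gap_law lam)"
    have fmm [measurable]: "flight_moment m (Suc n) j \<in> borel_measurable ?P" for j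
      by (rule measurable_flight_moment) auto
    have smm [measurable]: "(\<lambda>g. \<Sum>j<Suc n. g j) \<in> borel_measurable ?P"
      by (rule measurable_partial_sum) auto
    have fmm' [measurable]: "flight_moment m (Suc (Suc n)) k \<in> borel_measurable (Pi\<^sub>M {..<Suc (Suc n)} (\<lambda>_. gap_law lam))"
      by (rule measurable_flight_moment) auto
    have smm' [measurable]: "(\<lambda>g. \<Sum>j<Suc (Suc n). g j) \<in> borel_measurable (Pi\<^sub>M {..<Suc (Suc n)} (\<lambda>_. gap_law lam))"
      by (rule measurable_partial_sum) auto
    have "(\<lambda>g. f (\<Sum>j<Suc (Suc n). g j) * ennreal (flight_moment m (Suc (Suc n)) k g)) \<in> borel_measurable (Pi\<^sub>M (insert (Suc n) {..<Suc n}) (\<lambda>_. gap_law lam))"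
      unfolding lessThan_Suc[symmetric, of "Suc n"]
      by (intro borel_measurable_times_ennreal measurable_compose[OF smm' Suc.prems] measurable_compose[OF fmm' measurable_ennreal])
    \<comment> \<open>The new gap x is made the outer variable, so that the inner integral is an
      instance of the induction hypothesis for f shifted by x.\<close>
    from product_nn_integral_insert_rev[OF _ _ this]
    have "(\<integral>\<^sup>+ g. f (\<Sum>j<Suc (Suc n). g j) * ennreal (flight_moment m (Suc (Suc n)) k g) \<partial>Pi\<^sub>M {..<Suc (Suc n)} (\<lambda>_. gap_law lam))
      = (\<integral>\<^sup>+ x. (\<integral>\<^sup>+ g. (?K g x) \<partial>?P) \<partial>gap_law lam)"
      unfolding lessThan_Suc[symmetric, of "Suc n"] by simp
    also have "\<dots> = (\<integral>\<^sup>+ x. (\<Sum>i\<le>k. ennreal (x ^ i / fact i) * ((?D i) *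
        ((?C i) * (?U i x)))) \<partial>gap_law lam)"
    proof (rule nn_integral_cong_AE)
      show "AE x in gap_law lam. (\<integral>\<^sup>+ g. (?K g x) \<partial>?P)
        = (\<Sum>i\<le>k. ennreal (x ^ i / fact i) * ((?D i) *
        ((?C i) * (?U i x))))"
        using AE_gap_law
      proof eventually_elim
        case (elim x)
        have "(\<integral>\<^sup>+ g. (?K g x) \<partial>?P)
          = (\<integral>\<^sup>+ g. (\<Sum>i\<le>k. (ennreal (x ^ i / fact i) * (?D i)) * (f ((\<Sum>j<Suc n. g j) + x) * (?J g i))) \<partial>?P)"
        proof (rule nn_integral_cong_AE)
          show "AE g in ?P. (?K g x) =
            (\<Sum>i\<le>k. (ennreal (x ^ i / fact i) * (?D i)) * (f ((\<Sum>j<Suc n. g j) + x) * (?J g i)))"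
            using AE_PiM_gap_law[OF lam, of "Suc n"]
          proof eventually_elim
            case (elim g)
            have s: "(\<Sum>j<Suc (Suc n). (g(Suc n := x)) j) = (\<Sum>j<Suc n. g j) + x" by simp
            have "ennreal (flight_moment m (Suc (Suc n)) k (g(Suc n := x))) =
              (\<Sum>i\<le>k. ennreal (x ^ i / fact i) * ((?D i) * (?J g i)))"
              using elim \<open>0 < x\<close> by (intro flight_moment_Suc_ennreal m) (auto intro: less_imp_le)
            then show ?case unfolding s by (simp only: sum_distrib_left mult_ac)
          qed
        qed
        also have "\<dots> = (\<Sum>i\<le>k. (ennreal (x ^ i / fact i) * (?D i)) * (\<integral>\<^sup>+ g. f ((\<Sum>j<Suc n. g j) + x) * (?J g i) \<partial>?P))"
          by (subst nn_integral_sum, measurable, intro sum.cong refl nn_integral_cmult) measurable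
        also have "\<dots> = (\<Sum>i\<le>k. (ennreal (x ^ i / fact i) * (?D i)) *
            ((?C i) * (?U i x)))"
          by (subst Suc.IH[of "\<lambda>s. f (s + x)"]) auto
        finally show ?case by (simp only: mult.assoc)
      qed
    qed
    also have "\<dots> = (\<integral>\<^sup>+ x. (\<Sum>i\<le>k. ((?D i) * (?C i)) *
        (gamma_weight lam 1 i x * (?U i x))) \<partial>lborel)"
    proof (subst nn_integral_gap_law, measurable, rule nn_integral_cong, unfold sum_distrib_left, intro sum.cong refl)
      fix x :: real and i
      show "gamma_weight lam 1 0 x * (ennreal (x ^ i / fact i) * ((?D i) *
          ((?C i) * (?U i x)))) =
        ((?D i) * (?C i)) *
          (gamma_weight lam 1 i x * (?U i x))"
        unfolding gamma_weight_power[OF lam, of 1 x i, symmetric] by (simp only: mult_ac)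
    qed
    also have "\<dots> = (\<Sum>i\<le>k. ((?D i) * (?C i)) *
        (\<integral>\<^sup>+ x. gamma_weight lam 1 i x * (?U i x) \<partial>lborel))"
      by (subst nn_integral_sum, measurable, intro sum.cong refl nn_integral_cmult) measurable
    also have "\<dots> = (\<Sum>i\<le>k. ennreal (direction_moment m i * flight_coeff m (Suc n) (k - i)) *
        ?V)"
    proof (intro sum.cong refl)
      fix i assume "i \<in> {..k}"
      then have "Suc (i + (k - i + n)) = k + Suc n" by simp
      then show "((?D i) * (?C i)) *
        (\<integral>\<^sup>+ x. gamma_weight lam 1 i x * (?U i x) \<partial>lborel) =
        ennreal (direction_moment m i * flight_coeff m (Suc n) (k - i)) * ?V"
        using gamma_weight_convolution[OF Suc.prems lam, of 1 i "Suc n" "k - i + n"] direction_moment_nonneg[OF m] flight_coeff_nonneg[OF m]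
        by (simp add: ennreal_mult)
    qed
    also have "\<dots> = ennreal (flight_coeff m (Suc (Suc n)) k) * ?V"
      unfolding flight_coeff_Suc[of m "Suc n" k] using direction_moment_nonneg[OF m] flight_coeff_nonneg[OF m]
      by (simp add: sum_distrib_right[symmetric] sum_ennreal)
    finally show ?case .
  }
qed

section \<open>The conditional law of the position\<close>

lemma (in prob_space) indep_elements_distr:
  assumes "indep_elements M K X L Y" and \<phi>: "\<phi> \<in> measurable K K'" and \<psi>: "\<psi> \<in> measurable L L'"
  shows "distr M (K' \<Otimes>\<^sub>M L') (\<lambda>\<omega>. (\<phi> (X \<omega>), \<psi> (Y \<omega>))) = distr M K' (\<lambda>\<omega>. \<phi> (X \<omega>)) \<Otimes>\<^sub>M distr M L' (\<lambda>\<omega>. \<psi> (Y \<omega>))"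
proof (rule pair_measure_eqI[symmetric])
  have XY: "X \<in> measurable M K" "Y \<in> measurable M L"
    and ind: "indep_set {X -` A \<inter> space M | A. A \<in> sets K} {Y -` A \<inter> space M | A. A \<in> sets L}"
    using assms(1) by (auto simp: indep_elements_def)
  have [measurable]: "(\<lambda>\<omega>. \<phi> (X \<omega>)) \<in> measurable M K'" "(\<lambda>\<omega>. \<psi> (Y \<omega>)) \<in> measurable M L'"
    using measurable_compose[OF XY(1) \<phi>] measurable_compose[OF XY(2) \<psi>] by auto
  show "sigma_finite_measure (distr M K' (\<lambda>\<omega>. \<phi> (X \<omega>)))" "sigma_finite_measure (distr M L' (\<lambda>\<omega>. \<psi> (Y \<omega>)))"
    by (auto intro!: prob_space_imp_sigma_finite prob_space_distr)
  fix A B assume "A \<in> sets (distr M K' (\<lambda>\<omega>. \<phi> (X \<omega>)))" "B \<in> sets (distr M L' (\<lambda>\<omega>. \<psi> (Y \<omega>)))"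
  then have [measurable]: "A \<in> sets K'" "B \<in> sets L'" by auto
  let ?a = "X -` (\<phi> -` A \<inter> space K) \<inter> space M" and ?b = "Y -` (\<psi> -` B \<inter> space L) \<inter> space M"
  have a: "(\<lambda>\<omega>. \<phi> (X \<omega>)) -` A \<inter> space M = ?a" using measurable_space[OF XY(1)] by auto
  have b: "(\<lambda>\<omega>. \<psi> (Y \<omega>)) -` B \<inter> space M = ?b" using measurable_space[OF XY(2)] by auto
  have "?a \<in> {X -` A \<inter> space M | A. A \<in> sets K}" using measurable_sets[OF \<phi>, of A] by (intro CollectI exI[of _ "\<phi> -` A \<inter> space K"]) auto
  moreover have "?b \<in> {Y -` A \<inter> space M | A. A \<in> sets L}" using measurable_sets[OF \<psi>, of B] by (intro CollectI exI[of _ "\<psi> -` B \<inter> space L"]) auto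
  ultimately have "prob (?a \<inter> ?b) = prob ?a * prob ?b" by (rule indep_setD[OF ind])
  then have "emeasure M (?a \<inter> ?b) = emeasure M ?a * emeasure M ?b"
    by (simp add: emeasure_eq_measure ennreal_mult)
  moreover have "(\<lambda>\<omega>. (\<phi> (X \<omega>), \<psi> (Y \<omega>))) -` (A \<times> B) \<inter> space M = ?a \<inter> ?b"
    using a b by auto
  ultimately show "emeasure (distr M K' (\<lambda>\<omega>. \<phi> (X \<omega>))) A * emeasure (distr M L' (\<lambda>\<omega>. \<psi> (Y \<omega>))) B =
      emeasure (distr M (K' \<Otimes>\<^sub>M L') (\<lambda>\<omega>. (\<phi> (X \<omega>), \<psi> (Y \<omega>)))) (A \<times> B)"
    by (simp add: emeasure_distr a b)
qed auto

text \<open>An infinite set has cardinality 0, so with n \<ge> 1 the count n certifies that the set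
  is finite.\<close>

lemma card_event_times_eq_iff:
  fixes S :: "nat \<Rightarrow> real"
  assumes S: "strict_mono S" and n: "1 \<le> n"
  shows "card {j. 1 \<le> j \<and> S j \<le> s} = n \<longleftrightarrow> S n \<le> s \<and> s < S (Suc n)"
proof
  assume a: "S n \<le> s \<and> s < S (Suc n)"
  have "{j. 1 \<le> j \<and> S j \<le> s} = {1..n}"
  proof (intro set_eqI iffI)
    fix j assume "j \<in> {j. 1 \<le> j \<and> S j \<le> s}"
    then have "1 \<le> j" "S j < S (Suc n)" using a by auto
    then show "j \<in> {1..n}" using strict_mono_less[OF S] by auto
  next
    fix j assume "j \<in> {1..n}"
    then have "1 \<le> j" "S j \<le> S n" using strict_mono_less_eq[OF S] by auto
    then show "j \<in> {j. 1 \<le> j \<and> S j \<le> s}" using a by auto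
  qed
  then show "card {j. 1 \<le> j \<and> S j \<le> s} = n" by simp
next
  let ?A = "{j. 1 \<le> j \<and> S j \<le> s}"
  assume c: "card ?A = n"
  then have fin: "finite ?A" using n by (intro card_ge_0_finite) simp
  have "S n \<le> s"
  proof (rule ccontr)
    assume "\<not> S n \<le> s"
    then have "?A \<subseteq> {1..<n}" using strict_mono_less[OF S] by (auto simp: not_le) (meson le_less_trans less_le_trans strict_mono_less[OF S])
    then have "card ?A \<le> card {1..<n}" by (intro card_mono) auto
    then show False using c n by simp
  qed
  moreover have "s < S (Suc n)"
  proof (rule ccontr)
    assume "\<not> s < S (Suc n)"
    then have "{1..Suc n} \<subseteq> ?A" using strict_mono_less_eq[OF S] by (auto simp: not_less) (meson order_trans strict_mono_less_eq[OF S])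
    then have "card {1..Suc n} \<le> card ?A" using fin by (intro card_mono)
    then show False using c by simp
  qed
  ultimately show "S n \<le> s \<and> s < S (Suc n)" by simp
qed

text \<open>In \<open>h\<close> the gap in progress at time s is cut down to the remaining time s -
  S n. These n + 1 durations sum to s, so adding c * s replaces each cosine by 1 + cos. Durations
  are numbered from 0 and directions from 1, hence \<open>Suc j\<close>.\<close>

lemma motion_plus_eq:
  assumes cnt: "event_count S s \<omega> = n" and S0: "S 0 \<omega> = 0"
  defines "h \<equiv> (\<lambda>j. S (Suc j) \<omega> - S j \<omega>)(n := s - S n \<omega>)"
  shows "motion c S \<theta> s \<omega> + c * s = c * (\<Sum>j<Suc n. h j * (1 + cos (\<theta> (Suc j) \<omega>)))"
    and "(\<Sum>j<Suc n. h j) = s"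
proof -
  have sw: "switch_time S s \<omega> (Suc j) - switch_time S s \<omega> j = h j" if "j \<in> {..<Suc n}" for j
    using that unfolding switch_time_def cnt h_def by auto
  have "(\<Sum>j = 1..n + 1. (switch_time S s \<omega> j - switch_time S s \<omega> (j - 1)) * cos (\<theta> j \<omega>))
     = (\<Sum>j<Suc n. (switch_time S s \<omega> (Suc j) - switch_time S s \<omega> j) * cos (\<theta> (Suc j) \<omega>))"
    by (rule sum.reindex_bij_witness[where i = Suc and j = "\<lambda>j. j - 1"]) auto
  also have "\<dots> = (\<Sum>j<Suc n. h j * cos (\<theta> (Suc j) \<omega>))"
    using sw by (intro sum.cong refl) auto
  finally have m: "motion c S \<theta> s \<omega> = c * (\<Sum>j<Suc n. h j * cos (\<theta> (Suc j) \<omega>))"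
    unfolding motion_def cnt by simp
  have "(\<Sum>j<n. h j) = (\<Sum>j<n. S (Suc j) \<omega> - S j \<omega>)" unfolding h_def by (intro sum.cong) auto
  also have "\<dots> = S n \<omega>" by (subst sum_lessThan_telescope) (simp add: S0)
  finally show sh: "(\<Sum>j<Suc n. h j) = s" by (simp add: h_def)
  have "c * (\<Sum>j<Suc n. h j * (1 + cos (\<theta> (Suc j) \<omega>))) = c * (\<Sum>j<Suc n. h j * cos (\<theta> (Suc j) \<omega>)) + c * (\<Sum>j<Suc n. h j)"
    by (simp only: distrib_left sum.distrib mult_1_right add.commute)
  then show "motion c S \<theta> s \<omega> + c * s = c * (\<Sum>j<Suc n. h j * (1 + cos (\<theta> (Suc j) \<omega>)))"
    unfolding sh m by simp
qed

locale flight = prob_space M for M :: "'a measure" +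
  fixes c lam :: real and m n :: nat and S \<theta> :: "nat \<Rightarrow> 'a \<Rightarrow> real"
  assumes c: "0 < c" and lam: "0 < lam" and m: "m \<in> {0, 1}" and n: "1 \<le> n"
    and poisson: "poisson_event_times M lam S"
    and directions: "iid_directions M m \<theta>"
    and indep: "indep_elements M
           (Pi\<^sub>M UNIV (\<lambda>_. borel)) (\<lambda>\<omega>. \<lambda>j\<in>UNIV. S j \<omega>)
           (Pi\<^sub>M {1..} (\<lambda>_. borel)) (\<lambda>\<omega>. \<lambda>j\<in>{1..}. \<theta> j \<omega>)"
    and measurable_motion: "\<And>s. 0 \<le> s \<Longrightarrow> motion c S \<theta> s \<in> borel_measurable M"
    and measurable_count: "\<And>s. 0 \<le> s \<Longrightarrow> event_count S s \<in> measurable M (count_space UNIV)"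
begin

abbreviation gaps :: "'a \<Rightarrow> nat \<Rightarrow> real" where
  "gaps \<omega> \<equiv> \<lambda>j\<in>{..<Suc n}. S (Suc j) \<omega> - S j \<omega>"

abbreviation dirs :: "'a \<Rightarrow> nat \<Rightarrow> real" where
  "dirs \<omega> \<equiv> \<lambda>j\<in>{..<Suc n}. \<theta> (Suc j) \<omega>"

abbreviation gap_space :: "(nat \<Rightarrow> real) measure" where
  "gap_space \<equiv> Pi\<^sub>M {..<Suc n} (\<lambda>_. gap_law lam)"

abbreviation dir_space :: "(nat \<Rightarrow> real) measure" where
  "dir_space \<equiv> Pi\<^sub>M {..<Suc n} (\<lambda>_. direction_law m)"

abbreviation count_event :: "real \<Rightarrow> 'a set" where
  "count_event s \<equiv> {\<omega> \<in> space M. event_count S s \<omega> = n}"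

lemma count_event_sets: "0 \<le> s \<Longrightarrow> count_event s \<in> sets M"
  using measurable_count[of s] by measurable

lemma S_0: "\<omega> \<in> space M \<Longrightarrow> S 0 \<omega> = 0"
  using poisson unfolding poisson_event_times_def by blast

lemma measurable_S [measurable]: "S j \<in> borel_measurable M"
proof -
  have "(\<lambda>\<omega>. \<lambda>j\<in>UNIV. S j \<omega>) \<in> measurable M (Pi\<^sub>M UNIV (\<lambda>_. borel))"
    using indep by (simp add: indep_elements_def)
  from measurable_compose[OF this measurable_component_singleton[of j]] show ?thesis by simp
qed

lemma distr_gap: "distr M borel (\<lambda>\<omega>. S (Suc j) \<omega> - S j \<omega>) = gap_law lam"
proof -
  have "distributed M lborel (\<lambda>\<omega>. S (Suc j) \<omega> - S j \<omega>) (\<lambda>x. ennreal (exponential_density lam x))"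
    using poisson unfolding poisson_event_times_def by blast
  then have "distr M lborel (\<lambda>\<omega>. S (Suc j) \<omega> - S j \<omega>) = gap_law lam"
    by (simp add: distributed_def gap_law_def)
  then show ?thesis by (simp cong: distr_cong)
qed

lemma AE_gaps: "AE \<omega> in M. strict_mono (\<lambda>j. S j \<omega>)"
proof -
  have "AE \<omega> in M. 0 < S (Suc j) \<omega> - S j \<omega>" for j
  proof -
    have "AE x in distr M borel (\<lambda>\<omega>. S (Suc j) \<omega> - S j \<omega>). 0 < x"
      unfolding distr_gap by (rule AE_gap_law)
    then show ?thesis by (subst (asm) AE_distr_iff) auto
  qed
  then have "AE \<omega> in M. \<forall>j. 0 < S (Suc j) \<omega> - S j \<omega>" by (simp add: AE_all_countable)
  then show ?thesis by eventually_elim (auto simp: strict_mono_Suc_iff)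
qed

lemma distr_gaps: "distr M (Pi\<^sub>M {..<Suc n} (\<lambda>_. borel)) gaps = gap_space"
proof -
  have "indep_vars (\<lambda>_. borel) (\<lambda>j \<omega>. S (Suc j) \<omega> - S j \<omega>) UNIV"
    using poisson unfolding poisson_event_times_def by blast
  then have "indep_vars (\<lambda>_. borel) (\<lambda>j \<omega>. S (Suc j) \<omega> - S j \<omega>) {..<Suc n}"
    by (rule indep_vars_subset) simp
  then show ?thesis
    using indep_vars_iff_distr_eq_PiM[where I = "{..<Suc n}" and X = "\<lambda>j \<omega>. S (Suc j) \<omega> - S j \<omega>" and M' = "\<lambda>_. borel"]
    by (simp add: distr_gap lessThan_empty_iff)
qed

text \<open>Directions are numbered from 1 and gaps from 0; the renumbering keeps the product
  law.\<close>

lemma distr_dirs: "distr M (Pi\<^sub>M {..<Suc n} (\<lambda>_. borel)) dirs = dir_space"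
proof -
  let ?J = "{1..Suc n}"
  let ?Th = "(\<lambda>\<omega>. \<lambda>j\<in>?J. \<theta> j \<omega>)"
  let ?PJ = "(Pi\<^sub>M ?J (\<lambda>_. borel))"
  have iv: "indep_vars (\<lambda>_. borel) \<theta> {1..}" and ds: "\<And>j. 1 \<le> j \<Longrightarrow> distributed M lborel (\<theta> j) (\<lambda>x. ennreal (direction_density m x))"
    using directions unfolding iid_directions_def by blast+
  have \<theta>m: "\<theta> j \<in> borel_measurable M" if "j \<in> ?J" for j
    using ds[of j] that by (auto simp: distributed_def)
  have d: "distr M borel (\<theta> j) = direction_law m" if "j \<in> ?J" for j
  proof -
    have "distr M lborel (\<theta> j) = direction_law m"
      using ds[of j] that by (simp add: distributed_def direction_law_def)
    then show ?thesis by (simp cong: distr_cong)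
  qed
  have rm [measurable]: "?Th \<in> measurable M ?PJ"
    using \<theta>m by (intro measurable_restrict) auto
  have sm [measurable]: "(\<lambda>q. \<lambda>j\<in>{..<Suc n}. q (Suc j)) \<in> measurable ?PJ (Pi\<^sub>M {..<Suc n} (\<lambda>_. borel :: real measure))"
    by (intro measurable_restrict measurable_component_singleton) auto
  have "indep_vars (\<lambda>_. borel) \<theta> ?J" by (rule indep_vars_subset[OF iv]) auto
  then have "distr M ?PJ ?Th = Pi\<^sub>M ?J (\<lambda>j. distr M borel (\<theta> j))"
    using \<theta>m by (subst (asm) indep_vars_iff_distr_eq_PiM') auto
  also have "\<dots> = Pi\<^sub>M ?J (\<lambda>_. direction_law m)" by (intro PiM_cong d) auto
  finally have J: "distr M ?PJ ?Th = Pi\<^sub>M ?J (\<lambda>_. direction_law m)" .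
  have "distr M (Pi\<^sub>M {..<Suc n} (\<lambda>_. borel)) dirs =
     distr (distr M ?PJ ?Th) (Pi\<^sub>M {..<Suc n} (\<lambda>_. borel)) (\<lambda>q. \<lambda>j\<in>{..<Suc n}. q (Suc j))"
    by (subst distr_distr[OF sm rm]) (auto intro!: distr_cong simp: fun_eq_iff restrict_def)
  also have "\<dots> = distr (Pi\<^sub>M ?J (\<lambda>_. direction_law m)) (Pi\<^sub>M {..<Suc n} (\<lambda>_. direction_law m)) (\<lambda>q. \<lambda>j\<in>{..<Suc n}. q (Suc j))"
    unfolding J by (intro distr_cong sets_PiM_cong) auto
  also have "\<dots> = dir_space"
    by (rule distr_PiM_reindex[where M = "\<lambda>_. direction_law m"]) (auto intro: prob_space_direction_law[OF m])
  finally show ?thesis .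
qed

lemma measurable_gaps_dirs: "(\<lambda>\<omega>. (gaps \<omega>, dirs \<omega>)) \<in> measurable M (Pi\<^sub>M {..<Suc n} (\<lambda>_. borel) \<Otimes>\<^sub>M Pi\<^sub>M {..<Suc n} (\<lambda>_. borel))"
proof -
  have "\<theta> j \<in> borel_measurable M" if "1 \<le> j" for j
    using directions that by (auto simp: iid_directions_def distributed_def)
  then show ?thesis by (intro measurable_Pair measurable_restrict) auto
qed

lemma distr_gaps_dirs:
  "distr M (Pi\<^sub>M {..<Suc n} (\<lambda>_. borel) \<Otimes>\<^sub>M Pi\<^sub>M {..<Suc n} (\<lambda>_. borel)) (\<lambda>\<omega>. (gaps \<omega>, dirs \<omega>)) = gap_space \<Otimes>\<^sub>M dir_space"
proof -
  let ?\<phi> = "\<lambda>p :: nat \<Rightarrow> real. \<lambda>j\<in>{..<Suc n}. p (Suc j) - p j"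
  let ?\<psi> = "\<lambda>q :: nat \<Rightarrow> real. \<lambda>j\<in>{..<Suc n}. q (Suc j)"
  have "?\<phi> \<in> measurable (Pi\<^sub>M UNIV (\<lambda>_. borel)) (Pi\<^sub>M {..<Suc n} (\<lambda>_. borel))"
    by (intro measurable_restrict borel_measurable_diff measurable_component_singleton) auto
  moreover have "?\<psi> \<in> measurable (Pi\<^sub>M {1..} (\<lambda>_. borel)) (Pi\<^sub>M {..<Suc n} (\<lambda>_. borel))"
    by (intro measurable_restrict measurable_component_singleton) auto
  ultimately have "distr M (Pi\<^sub>M {..<Suc n} (\<lambda>_. borel) \<Otimes>\<^sub>M Pi\<^sub>M {..<Suc n} (\<lambda>_. borel))
       (\<lambda>\<omega>. (?\<phi> (\<lambda>j\<in>UNIV. S j \<omega>), ?\<psi> (\<lambda>j\<in>{1..}. \<theta> j \<omega>))) =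
     distr M (Pi\<^sub>M {..<Suc n} (\<lambda>_. borel)) (\<lambda>\<omega>. ?\<phi> (\<lambda>j\<in>UNIV. S j \<omega>)) \<Otimes>\<^sub>M
     distr M (Pi\<^sub>M {..<Suc n} (\<lambda>_. borel)) (\<lambda>\<omega>. ?\<psi> (\<lambda>j\<in>{1..}. \<theta> j \<omega>))"
    by (rule indep_elements_distr[OF indep])
  moreover have "?\<phi> (\<lambda>j\<in>UNIV. S j \<omega>) = gaps \<omega>" "?\<psi> (\<lambda>j\<in>{1..}. \<theta> j \<omega>) = dirs \<omega>" for \<omega>
    by (auto simp: fun_eq_iff restrict_def)
  ultimately show ?thesis by (simp only: distr_gaps distr_dirs)
qed

text \<open>On the event N(s) = n this is X(s) / c + s as a function of the first n + 1 gaps and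
  directions. Coordinate n of \<open>g\<close> is overwritten by the remaining time, which is the
  true duration of the last leg.\<close>

definition shifted_position :: "real \<Rightarrow> (nat \<Rightarrow> real) \<Rightarrow> (nat \<Rightarrow> real) \<Rightarrow> real" where
  "shifted_position s g d = (\<Sum>j<Suc n. (g(n := s - (\<Sum>j<n. g j))) j * (1 + cos (d j)))"

definition stops_at :: "real \<Rightarrow> (nat \<Rightarrow> real) \<Rightarrow> bool" where
  "stops_at s g \<longleftrightarrow> (\<Sum>j<n. g j) \<le> s \<and> s < (\<Sum>j<Suc n. g j)"

lemma count_event_gaps:
  assumes "strict_mono (\<lambda>j. S j \<omega>)" "\<omega> \<in> space M"
  shows "event_count S s \<omega> = n \<longleftrightarrow> stops_at s (gaps \<omega>)"
    and "event_count S s \<omega> = n \<Longrightarrow> motion c S \<theta> s \<omega> + c * s = c * shifted_position s (gaps \<omega>) (dirs \<omega>)"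
    and "event_count S s \<omega> = n \<Longrightarrow> 0 \<le> motion c S \<theta> s \<omega> + c * s \<and> motion c S \<theta> s \<omega> + c * s \<le> 2 * c * s"
proof -
  have tel: "(\<Sum>j<k. gaps \<omega> j) = S k \<omega>" if "k \<le> Suc n" for k
  proof -
    have "(\<Sum>j<k. gaps \<omega> j) = (\<Sum>j<k. S (Suc j) \<omega> - S j \<omega>)" using that by (intro sum.cong) auto
    also have "\<dots> = S k \<omega>" using S_0[OF assms(2)] by (subst sum_lessThan_telescope) simp
    finally show ?thesis .
  qed
  show iff: "event_count S s \<omega> = n \<longleftrightarrow> stops_at s (gaps \<omega>)"
    unfolding event_count_def stops_at_def card_event_times_eq_iff[OF assms(1) n] using tel[of n] tel[of "Suc n"] by simp
  assume cnt: "event_count S s \<omega> = n"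
  let ?h = "(\<lambda>j. S (Suc j) \<omega> - S j \<omega>)(n := s - S n \<omega>)"
  have e: "(\<Sum>j<Suc n. ?h j * (1 + cos (\<theta> (Suc j) \<omega>))) = shifted_position s (gaps \<omega>) (dirs \<omega>)"
    unfolding shifted_position_def tel[OF le_SucI[OF order_refl]] by (intro sum.cong) auto
  show eq: "motion c S \<theta> s \<omega> + c * s = c * shifted_position s (gaps \<omega>) (dirs \<omega>)"
    using motion_plus_eq(1)[OF cnt S_0[OF assms(2)], of c \<theta>] unfolding e .
  have h0: "0 \<le> ?h j" if "j < Suc n" for j
    using assms(1) iff cnt tel[of n] that by (auto simp: stops_at_def strict_mono_Suc_iff less_imp_le)
  have c2: "0 \<le> 1 + cos x" "1 + cos x \<le> 2" for x :: real using cos_ge_minus_one[of x] cos_le_one[of x] by linarith+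
  have "0 \<le> (\<Sum>j<Suc n. ?h j * (1 + cos (\<theta> (Suc j) \<omega>)))"
    using h0 c2 by (intro sum_nonneg mult_nonneg_nonneg) auto
  moreover have "(\<Sum>j<Suc n. ?h j * (1 + cos (\<theta> (Suc j) \<omega>))) \<le> (\<Sum>j<Suc n. ?h j * 2)"
    using h0 c2 by (intro sum_mono mult_left_mono) auto
  moreover have "(\<Sum>j<Suc n. ?h j * 2) = 2 * s"
    unfolding sum_distrib_right[symmetric] motion_plus_eq(2)[OF cnt S_0[OF assms(2)]] by simp
  ultimately have "0 \<le> shifted_position s (gaps \<omega>) (dirs \<omega>)" "shifted_position s (gaps \<omega>) (dirs \<omega>) \<le> 2 * s"
    unfolding e by auto
  then show "0 \<le> motion c S \<theta> s \<omega> + c * s \<and> motion c S \<theta> s \<omega> + c * s \<le> 2 * c * s"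
    unfolding eq using c mult_left_mono[of "shifted_position s (gaps \<omega>) (dirs \<omega>)" "2 * s" c] by auto
qed

end

text \<open>The gap in progress at time s matters only through its exceeding the remaining time,
  which is y here.\<close>

lemma nn_integral_gap_law_tail:
  assumes lam: "0 < lam" and y: "0 \<le> y"
  shows "(\<integral>\<^sup>+ x. (if y < x then 1 else 0) \<partial>gap_law lam) = ennreal (exp (- lam * y))"
proof -
  have one: "(\<integral>\<^sup>+ x. gamma_weight lam 1 0 x \<partial>lborel) = 1"
    using nn_integral_gap_law[of "\<lambda>_. 1" lam] prob_space.emeasure_space_1[OF prob_space_gap_law[OF lam]]
    by simp
  have "(\<integral>\<^sup>+ x. (if y < x then 1 else 0) \<partial>gap_law lam) = (\<integral>\<^sup>+ x. gamma_weight lam 1 0 x * (if y < x then 1 else 0) \<partial>lborel)"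
    by (rule nn_integral_gap_law) measurable
  also have "\<dots> = ennreal \<bar>1\<bar> * (\<integral>\<^sup>+ u. gamma_weight lam 1 0 (y + 1 * u) * (if y < y + 1 * u then 1 else 0) \<partial>lborel)"
    by (rule nn_integral_real_affine) auto
  also have "\<dots> = (\<integral>\<^sup>+ u. ennreal (exp (- lam * y)) * gamma_weight lam 1 0 u \<partial>lborel)"
  proof (simp, rule nn_integral_cong)
    fix u :: real
    have "exp (- (lam * (y + u))) = exp (- (lam * y)) * exp (- (lam * u))"
      by (simp add: exp_add[symmetric] algebra_simps)
    then show "gamma_weight lam (Suc 0) 0 (y + u) * (if 0 < u then 1 else 0) = ennreal (exp (- (lam * y))) * gamma_weight lam (Suc 0) 0 u"
      using y lam by (auto simp: gamma_weight_def ennreal_mult[symmetric])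
  qed
  also have "\<dots> = ennreal (exp (- lam * y))"
    using one by (subst nn_integral_cmult) auto
  finally show ?thesis .
qed

text \<open>Here u is the time of the n-th event and s - u the duration of the last leg. The
  survival factor exp(-lam (s - u)) completes exp(-lam u) to a constant, which leaves a convolution
  of divided powers.\<close>

lemma nn_integral_last_gap:
  assumes lam: "0 < lam" and s: "0 < s"
  shows "(\<integral>\<^sup>+ u. (if u \<le> s then ennreal (exp (- lam * (s - u)) * ((s - u) ^ i / fact i)) else 0) * gamma_weight lam n j u \<partial>lborel)
    = ennreal (lam ^ n * exp (- lam * s) * (s ^ Suc (i + j) / fact (Suc (i + j))))"
proof -
  have "(\<integral>\<^sup>+ u. (if u \<le> s then ennreal (exp (- lam * (s - u)) * ((s - u) ^ i / fact i)) else 0) * gamma_weight lam n j u \<partial>lborel)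
    = (\<integral>\<^sup>+ u. ennreal (lam ^ n * exp (- lam * s)) * (ennreal (u ^ j / fact j * ((s - u) ^ i / fact i)) * indicator {0<..<s} u) \<partial>lborel)"
  proof (rule nn_integral_cong_AE)
    show "AE u in lborel. (if u \<le> s then ennreal (exp (- lam * (s - u)) * ((s - u) ^ i / fact i)) else 0) * gamma_weight lam n j u =
      ennreal (lam ^ n * exp (- lam * s)) * (ennreal (u ^ j / fact j * ((s - u) ^ i / fact i)) * indicator {0<..<s} u)"
      using AE_lborel_singleton[of s]
    proof eventually_elim
      case (elim u)
      show ?case
      proof (cases "u \<in> {0<..<s}")
        case True
        have "exp (- lam * (s - u)) * exp (- lam * u) = exp (- lam * s)"
          by (simp add: exp_add[symmetric] algebra_simps)
        then have "(exp (- lam * (s - u)) * ((s - u) ^ i / fact i)) * (lam ^ n * exp (- lam * u) * (u ^ j / fact j))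
          = (lam ^ n * exp (- lam * s)) * (u ^ j / fact j * ((s - u) ^ i / fact i))"
          by (simp add: mult_ac)
        then have "ennreal (exp (- lam * (s - u)) * ((s - u) ^ i / fact i)) * ennreal (lam ^ n * exp (- lam * u) * (u ^ j / fact j))
          = ennreal (lam ^ n * exp (- lam * s)) * ennreal (u ^ j / fact j * ((s - u) ^ i / fact i))"
          using True lam by (simp add: ennreal_mult[symmetric])
        then show ?thesis using True by (simp add: gamma_weight_def)
      next
        case False
        then have "u \<le> 0 \<or> s < u" using elim by auto
        then show ?thesis using False by (auto simp: gamma_weight_nonpos)
      qed
    qed
  qed
  also have "\<dots> = ennreal (lam ^ n * exp (- lam * s)) * ennreal (s ^ Suc (j + i) / fact (Suc (j + i)))"
    by (subst nn_integral_cmult) (simp_all only: nn_integral_beta_power[OF s], measurable)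
  also have "\<dots> = ennreal (lam ^ n * exp (- lam * s) * (s ^ Suc (i + j) / fact (Suc (i + j))))"
    using lam s by (subst ennreal_mult[symmetric]) (auto simp: add.commute)
  finally show ?thesis .
qed

context flight
begin

text \<open>A moment on the event N(s) = n, not yet conditional: for k = 0 it is the Poisson
  probability by which the others are later divided. Directions are integrated out first, then the
  gap in progress, then the n complete gaps.\<close>

lemma nn_integral_shifted_motion:
  assumes s: "0 < s"
  shows "(\<integral>\<^sup>+ \<omega>. ennreal ((motion c S \<theta> s \<omega> + c * s) ^ k) * indicator (count_event s) \<omega> \<partial>M) =
    ennreal (c ^ k * fact k * flight_coeff m (Suc n) k * (lam ^ n * exp (- lam * s) * (s ^ (k + n) / fact (k + n))))"
proof -
  \<comment> \<open>\<open>nn_integral_gaps\<close> counts its gaps by a successor; it is applied to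
    the n complete ones.\<close>
  obtain n' where n': "n = Suc n'" using n by (cases n) auto
  let ?B = "Pi\<^sub>M {..<Suc n} (\<lambda>_. borel) :: (nat \<Rightarrow> real) measure"
  let ?r = "\<lambda>g. s - (\<Sum>j<n. g j)"
  let ?A = "\<lambda>g. ennreal (c ^ k * fact k) * ennreal (flight_moment m (Suc n) k (g(n := (?r g))))"
  let ?W = "\<lambda>i. (ennreal (c ^ k * fact k) * ennreal (direction_moment m i))"
  let ?J = "\<lambda>g i. ennreal (flight_moment m n (k - i) g)"
  let ?Y = "\<lambda>g i. (if (\<Sum>j<n. g j) \<le> s then ennreal (exp (- lam * (?r g)) * ((?r g) ^ i / fact i)) else 0)"
  let ?T = "\<lambda>g x. (if (\<Sum>j<n. g j) \<le> s \<and> (?r g) < x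
      then (?A g) else 0)"
  interpret gap: prob_space "gap_law lam" by (rule prob_space_gap_law[OF lam])
  interpret dir: prob_space "direction_law m" by (rule prob_space_direction_law[OF m])
  interpret gp: product_sigma_finite "\<lambda>_ :: nat. gap_law lam" by unfold_locales
  interpret dp: prob_space dir_space by (intro prob_space_PiM) unfold_locales
  let ?G = "Pi\<^sub>M {..<n} (\<lambda>_ :: nat. gap_law lam)"
  have [measurable_cong]: "sets gap_space = sets ?B" "sets dir_space = sets ?B" by (auto intro!: sets_PiM_cong)
  have gm [measurable]: "(\<lambda>g. g j) \<in> borel_measurable ?B" if "j \<in> {..<Suc n}" for j
    using measurable_component_singleton[of j "{..<Suc n}" "\<lambda>_. borel :: real measure"] that by simp
  have sm [measurable]: "(\<lambda>g. \<Sum>j<n. g j) \<in> borel_measurable ?B" "(\<lambda>g. \<Sum>j<Suc n. g j) \<in> borel_measurable ?B"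
    by (intro measurable_partial_sum; auto)+
  have st [measurable]: "Measurable.pred ?B (stops_at s)"
    unfolding stops_at_def[abs_def] using sm by measurable
  have pm [measurable]: "(\<lambda>(g, d). shifted_position s g d) \<in> borel_measurable (?B \<Otimes>\<^sub>M ?B)"
    unfolding shifted_position_def case_prod_beta'
  proof (intro borel_measurable_sum)
    fix j assume "j \<in> {..<Suc n}"
    note [measurable] = gm[OF this]
    show "(\<lambda>x. ((fst x)(n := s - (\<Sum>j<n. fst x j))) j * (1 + cos (snd x j))) \<in> borel_measurable (?B \<Otimes>\<^sub>M ?B)"
      by (cases "j = n") simp_all
  qed
  let ?F = "\<lambda>(g, d). if stops_at s g then ennreal ((c * shifted_position s g d) ^ k) else 0"
  have Fm: "?F \<in> borel_measurable (?B \<Otimes>\<^sub>M ?B)"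
    using pm unfolding case_prod_beta' by measurable
  note cg = count_event_gaps
  have "(\<integral>\<^sup>+ \<omega>. ennreal ((motion c S \<theta> s \<omega> + c * s) ^ k) * indicator (count_event s) \<omega> \<partial>M) = (\<integral>\<^sup>+ \<omega>. ?F (gaps \<omega>, dirs \<omega>) \<partial>M)"
  proof (rule nn_integral_cong_AE)
    show "AE \<omega> in M. ennreal ((motion c S \<theta> s \<omega> + c * s) ^ k) * indicator (count_event s) \<omega> = ?F (gaps \<omega>, dirs \<omega>)"
      using AE_gaps AE_space
    proof eventually_elim
      case (elim \<omega>)
      show ?case
      proof (cases "event_count S s \<omega> = n")
        case True
        then have "stops_at s (gaps \<omega>)" using cg(1)[OF elim] by blast
        then show ?thesis using True elim(2) by (simp only: cg(2)[OF elim True] split if_True) simp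
      next
        case False
        then have "\<not> stops_at s (gaps \<omega>)" using cg(1)[OF elim] by blast
        then show ?thesis using False by (simp only: split if_False) simp
      qed
    qed
  qed
  also have "\<dots> = (\<integral>\<^sup>+ x. ?F x \<partial>distr M (?B \<Otimes>\<^sub>M ?B) (\<lambda>\<omega>. (gaps \<omega>, dirs \<omega>)))"
    by (rule nn_integral_distr[OF measurable_gaps_dirs, symmetric]) (simp only: measurable_distr_eq1 Fm)
  also have "\<dots> = (\<integral>\<^sup>+ g. (\<integral>\<^sup>+ d. ?F (g, d) \<partial>dir_space) \<partial>gap_space)"
    unfolding distr_gaps_dirs using Fm by (intro dp.nn_integral_fst[symmetric]) simp
  also have "\<dots> = (\<integral>\<^sup>+ g. (if stops_at s g then (?A g) else 0) \<partial>gap_space)"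
  proof (rule nn_integral_cong_AE)
    show "AE g in gap_space. (\<integral>\<^sup>+ d. ?F (g, d) \<partial>dir_space) =
      (if stops_at s g then (?A g) else 0)"
      using AE_PiM_gap_law[OF lam, of "Suc n"]
    proof eventually_elim
      case (elim g)
      let ?h = "g(n := (?r g))"
      show ?case
      proof (cases "stops_at s g")
        case True
        have h0: "0 \<le> ?h j" if "j < Suc n" for j
          using elim True that by (auto simp: stops_at_def less_imp_le)
        \<comment> \<open>The factor \<open>fact k\<close> is inserted because
          \<open>flight_moment\<close> is a divided moment.\<close>
        have "(\<integral>\<^sup>+ d. ?F (g, d) \<partial>dir_space) = (\<integral>\<^sup>+ d. ennreal (c ^ k * fact k) * ennreal ((\<Sum>j<Suc n. ?h j * (1 + cos (d j))) ^ k / fact k) \<partial>dir_space)"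
        proof (rule nn_integral_cong)
          fix d :: "nat \<Rightarrow> real"
          have "0 \<le> (\<Sum>j<Suc n. ?h j * (1 + cos (d j)))"
            using h0 by (intro sum_nonneg mult_nonneg_nonneg) (auto simp: add.commute[of 1] cos_ge_minus_one[THEN diff_ge_0_iff_ge[THEN iffD2], simplified])
          then show "?F (g, d) = ennreal (c ^ k * fact k) * ennreal ((\<Sum>j<Suc n. ?h j * (1 + cos (d j))) ^ k / fact k)"
            using True c unfolding shifted_position_def
            by (simp add: ennreal_mult[symmetric] power_mult_distrib del: sum.lessThan_Suc)
        qed
        also have "\<dots> = ennreal (c ^ k * fact k) * (\<integral>\<^sup>+ d. ennreal ((\<Sum>j<Suc n. ?h j * (1 + cos (d j))) ^ k / fact k) \<partial>dir_space)"
        proof (rule nn_integral_cmult)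
          have "(\<lambda>d. \<Sum>j<Suc n. ?h j * (1 + cos (d j))) \<in> borel_measurable ?B"
          proof (intro borel_measurable_sum)
            fix j assume "j \<in> {..<Suc n}"
            note [measurable] = gm[OF this]
            show "(\<lambda>d. ?h j * (1 + cos (d j))) \<in> borel_measurable ?B" by measurable
          qed
          then show "(\<lambda>d. ennreal ((\<Sum>j<Suc n. ?h j * (1 + cos (d j))) ^ k / fact k)) \<in> borel_measurable dir_space"
            by measurable
        qed
        also have "\<dots> = ennreal (c ^ k * fact k) * ennreal (flight_moment m (Suc n) k ?h)"
          by (subst nn_integral_directions[OF m h0]) auto
        finally show ?thesis using True by simp
      qed simp
    qed
  qed
  \<comment> \<open>Coordinate n, the gap in progress, becomes the inner variable: it occurs only in
    the condition that it exceeds the remaining time.\<close>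
  also have "\<dots> = (\<integral>\<^sup>+ g. (\<integral>\<^sup>+ x. (?T g x) \<partial>gap_law lam) \<partial>?G)"
  proof -
    let ?H = "\<lambda>g. if stops_at s g then (?A g) else 0"
    have um: "(\<lambda>g. g(n := (?r g))) \<in> measurable ?B ?B"
    proof (rule measurable_PiM_single')
      fix j assume "j \<in> {..<Suc n}"
      note [measurable] = gm[OF this]
      show "(\<lambda>g. (g(n := (?r g))) j) \<in> borel_measurable ?B" by (cases "j = n") simp_all
    qed (auto simp: space_PiM PiE_iff extensional_def)
    have "flight_moment m (Suc n) k \<in> borel_measurable ?B" by (rule measurable_flight_moment) auto
    from measurable_compose[OF um this]
    have [measurable]: "(\<lambda>g. flight_moment m (Suc n) k (g(n := (?r g)))) \<in> borel_measurable ?B" .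
    have "?H \<in> borel_measurable ?B" by measurable
    then have "?H \<in> borel_measurable (Pi\<^sub>M (insert n {..<n}) (\<lambda>_. gap_law lam))"
      unfolding lessThan_Suc[symmetric] by (simp cong: measurable_cong_sets)
    from gp.product_nn_integral_insert[OF _ _ this]
    have "integral\<^sup>N gap_space ?H = (\<integral>\<^sup>+ g. (\<integral>\<^sup>+ x. ?H (g(n := x)) \<partial>gap_law lam) \<partial>?G)"
      unfolding lessThan_Suc[symmetric] by simp
    moreover have "?H (g(n := x)) = (?T g x)" for g x
    proof -
      have "(\<Sum>j<n. (g(n := x)) j) = (\<Sum>j<n. g j)" by (intro sum.cong) auto
      then show ?thesis by (simp add: stops_at_def diff_less_eq add.commute del: flight_moment.simps)
    qed
    ultimately show ?thesis by simp
  qed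
  \<comment> \<open>The gap in progress contributes its exponential tail, and
    \<open>flight_moment\<close> is expanded in powers of the duration of the last leg.\<close>
  also have "\<dots> = (\<integral>\<^sup>+ g. (\<Sum>i\<le>k. (?W i) *
      ((?Y g i) *
       (?J g i))) \<partial>?G)"
  proof (rule nn_integral_cong_AE)
    show "AE g in ?G. (\<integral>\<^sup>+ x. (?T g x) \<partial>gap_law lam) =
      (\<Sum>i\<le>k. (?W i) *
      ((?Y g i) *
       (?J g i)))"
      using AE_PiM_gap_law[OF lam, of n]
    proof eventually_elim
      case (elim g)
      let ?l = "(?r g)"
      show ?case
      proof (cases "(\<Sum>j<n. g j) \<le> s")
        case True
        then have l: "0 \<le> ?l" by simp
        let ?A = "ennreal (c ^ k * fact k) * ennreal (flight_moment m (Suc n) k (g(n := ?l)))"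
        have fm: "ennreal (flight_moment m (Suc n) k (g(n := ?l))) =
           (\<Sum>i\<le>k. ennreal (?l ^ i / fact i) * (ennreal (direction_moment m i) * (?J g i)))"
          using elim l by (intro flight_moment_Suc_ennreal m) (auto intro: less_imp_le)
        have "(\<integral>\<^sup>+ x. (if (\<Sum>j<n. g j) \<le> s \<and> ?l < x then ?A else 0) \<partial>gap_law lam)
           = (\<integral>\<^sup>+ x. ?A * (if ?l < x then 1 else 0) \<partial>gap_law lam)"
          using True by (intro nn_integral_cong) auto
        also have "\<dots> = ?A * ennreal (exp (- lam * ?l))"
          using nn_integral_gap_law_tail[OF lam l] by (subst nn_integral_cmult) auto
        also have "?A * ennreal (exp (- lam * ?l)) =
          (\<Sum>i\<le>k. (?W i) *
            (ennreal (exp (- lam * ?l) * (?l ^ i / fact i)) * (?J g i)))"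
          unfolding fm sum_distrib_left sum_distrib_right
        proof (intro sum.cong refl)
          fix i
          have "ennreal (exp (- lam * ?l) * (?l ^ i / fact i)) = ennreal (exp (- lam * ?l)) * ennreal (?l ^ i / fact i)"
            using l by (intro ennreal_mult) auto
          then show "ennreal (c ^ k * fact k) * (ennreal (?l ^ i / fact i) * (ennreal (direction_moment m i) * (?J g i))) * ennreal (exp (- lam * ?l)) =
            (?W i) * (ennreal (exp (- lam * ?l) * (?l ^ i / fact i)) * (?J g i))"
            by (simp only: mult_ac)
        qed
        finally show ?thesis using True by (simp only: if_True)
      qed simp
    qed
  qed
  also have "\<dots> = (\<Sum>i\<le>k. (?W i) *
      (\<integral>\<^sup>+ g. (\<lambda>u. if u \<le> s then ennreal (exp (- lam * (s - u)) * ((s - u) ^ i / fact i)) else 0) (\<Sum>j<n. g j) *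
       (?J g i) \<partial>?G))"
  proof -
    have [measurable]: "(\<lambda>g. \<Sum>j<n. g j) \<in> borel_measurable ?G" by (rule measurable_partial_sum) auto
    have [measurable]: "flight_moment m n j \<in> borel_measurable ?G" for j by (rule measurable_flight_moment) auto
    show ?thesis
      by (subst nn_integral_sum, measurable, intro sum.cong refl nn_integral_cmult) measurable
  qed
  also have "\<dots> = (\<Sum>i\<le>k. (?W i) *
      (ennreal (flight_coeff m n (k - i)) * ennreal (lam ^ n * exp (- lam * s) * (s ^ (k + n) / fact (k + n)))))"
  proof (intro sum.cong refl)
    fix i assume "i \<in> {..k}"
    then have e: "Suc (i + (k - i + n')) = k + n" using n' by simp
    have "(\<lambda>u. if u \<le> s then ennreal (exp (- lam * (s - u)) * ((s - u) ^ i / fact i)) else 0) \<in> borel_measurable borel"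
      by measurable
    from nn_integral_gaps[OF m lam this, of n' "k - i"]
    show "(?W i) *
      (\<integral>\<^sup>+ g. (\<lambda>u. if u \<le> s then ennreal (exp (- lam * (s - u)) * ((s - u) ^ i / fact i)) else 0) (\<Sum>j<n. g j) *
       (?J g i) \<partial>?G) = (?W i) *
      (ennreal (flight_coeff m n (k - i)) * ennreal (lam ^ n * exp (- lam * s) * (s ^ (k + n) / fact (k + n))))"
      unfolding n'[symmetric] nn_integral_last_gap[OF lam s] e by (simp only:)
  qed
  also have "\<dots> = ennreal (c ^ k * fact k * flight_coeff m (Suc n) k * (lam ^ n * exp (- lam * s) * (s ^ (k + n) / fact (k + n))))"
  proof -
    let ?E = "lam ^ n * exp (- lam * s) * (s ^ (k + n) / fact (k + n))"
    have E0: "0 \<le> ?E" using lam s by simp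
    have "(?W i) * (ennreal (flight_coeff m n (k - i)) * ennreal ?E)
      = ennreal (c ^ k * fact k * (direction_moment m i * flight_coeff m n (k - i)) * ?E)" for i
      using E0 c direction_moment_nonneg[OF m, of i] flight_coeff_nonneg[OF m, of n "k - i"]
      by (simp only: ennreal_mult[symmetric] mult_nonneg_nonneg zero_le_power fact_ge_zero less_imp_le mult.assoc)
    then have "(\<Sum>i\<le>k. (?W i) * (ennreal (flight_coeff m n (k - i)) * ennreal ?E))
      = (\<Sum>i\<le>k. ennreal (c ^ k * fact k * (direction_moment m i * flight_coeff m n (k - i)) * ?E))" by (simp only:)
    also have "\<dots> = ennreal (\<Sum>i\<le>k. c ^ k * fact k * (direction_moment m i * flight_coeff m n (k - i)) * ?E)"
      using c direction_moment_nonneg[OF m] flight_coeff_nonneg[OF m]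
      by (intro sum_ennreal mult_nonneg_nonneg[OF _ E0] mult_nonneg_nonneg) auto
    \<comment> \<open>Summing over the order i carried by the last leg is the recursion for
      \<open>flight_coeff\<close>.\<close>
    also have "(\<Sum>i\<le>k. c ^ k * fact k * (direction_moment m i * flight_coeff m n (k - i)) * ?E) = c ^ k * fact k * flight_coeff m (Suc n) k * ?E"
      unfolding flight_coeff_Suc by (simp only: sum_distrib_left sum_distrib_right mult.assoc)
    finally show ?thesis .
  qed
  finally show ?thesis .
qed

end

text \<open>With b = c s this is the explicit p_n^m(x, s), its constant rewritten by the duplication
  formula into the form that the w-integral produces. It is the density of b (2 Y - 1) for a Beta
  variable Y with both parameters v + 1/2.\<close>

definition conditional_density :: "real \<Rightarrow> real \<Rightarrow> real \<Rightarrow> real" where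
  "conditional_density v b x =
     (if \<bar>x\<bar> < b then v * Beta v (1 / 2) / (pi * b) * (1 - x\<^sup>2 / b\<^sup>2) powr (v - 1 / 2) else 0)"

lemma conditional_density_nonneg: "0 < v \<Longrightarrow> 0 \<le> conditional_density v b x"
  by (auto simp: conditional_density_def Beta_def intro!: mult_nonneg_nonneg divide_nonneg_nonneg)

lemma measurable_conditional_density [measurable (raw)]:
  assumes [measurable]: "f \<in> borel_measurable N" "g \<in> borel_measurable N"
  shows "(\<lambda>z. conditional_density v (f z) (g z)) \<in> borel_measurable N"
  unfolding conditional_density_def by measurable

text \<open>Legendre's duplication formula in terms of Beta; it is what normalises
  \<open>conditional_density\<close> to total mass 1.\<close>

lemma Beta_half_product:
  fixes v :: real
  assumes v: "0 < v"
  shows "v * Beta v (1 / 2) * 2 powr (2 * v) * Beta (v + 1 / 2) (v + 1 / 2) = pi"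
proof -
  have np: "x \<notin> \<int>\<^sub>\<le>\<^sub>0" if "0 < x" for x :: real using that nonpos_Ints_nonpos[of x] by auto
  have npc: "complex_of_real x \<notin> \<int>\<^sub>\<le>\<^sub>0" if "0 < x" for x
  proof
    assume "complex_of_real x \<in> \<int>\<^sub>\<le>\<^sub>0"
    then obtain k where "complex_of_real x = of_int k" "k \<le> 0" by (auto elim: nonpos_Ints_cases)
    then show False using that by (metis of_int_le_0_iff of_real_eq_iff of_real_of_int_eq not_le)
  qed
  have "complex_of_real v \<notin> \<int>\<^sub>\<le>\<^sub>0" "complex_of_real v + 1 / 2 \<notin> \<int>\<^sub>\<le>\<^sub>0"
    using npc[of v] npc[of "v + 1 / 2"] v by simp_all
  from Gamma_legendre_duplication[OF this]
  have "complex_of_real (Gamma v * Gamma (v + 1 / 2)) = complex_of_real (exp ((1 - 2 * v) * ln 2) * sqrt pi * Gamma (2 * v))"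
    by (simp add: Gamma_complex_of_real[symmetric] exp_of_real[symmetric])
  then have dup: "Gamma v * Gamma (v + 1 / 2) = exp ((1 - 2 * v) * ln 2) * sqrt pi * Gamma (2 * v)"
    by (simp only: of_real_eq_iff)
  have "exp ((1 - 2 * v) * ln 2) * 2 powr (2 * v) = exp ((1 - 2 * v) * ln 2 + 2 * v * ln 2)"
    by (simp add: powr_def exp_add)
  also have "(1 - 2 * v) * ln 2 + 2 * v * ln 2 = ln (2 :: real)" by (simp add: algebra_simps)
  finally have e2: "exp ((1 - 2 * v) * ln 2) * 2 powr (2 * v) = 2" by simp
  have G1: "Gamma (2 * v + 1) = 2 * v * Gamma (2 * v)" using Gamma_plus1[of "2 * v"] np[of "2 * v"] v by (simp add: add.commute)
  have pos: "0 < Gamma (v + 1 / 2)" "0 < Gamma (2 * v)" using v by (auto intro: Gamma_real_pos)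
  have B1: "Beta v (1 / 2) = Gamma v * sqrt pi / Gamma (v + 1 / 2)" by (simp add: Beta_def Gamma_one_half_real)
  have B2: "Beta (v + 1 / 2) (v + 1 / 2) = Gamma (v + 1 / 2) * Gamma (v + 1 / 2) / (2 * v * Gamma (2 * v))"
  proof -
    have "v + 1 / 2 + (v + 1 / 2) = 2 * v + 1" by simp
    then show ?thesis unfolding Beta_def by (simp only: G1)
  qed
  have "v * Beta v (1 / 2) * 2 powr (2 * v) * Beta (v + 1 / 2) (v + 1 / 2)
    = (Gamma v * Gamma (v + 1 / 2)) * 2 powr (2 * v) * sqrt pi / (2 * Gamma (2 * v))"
    unfolding B1 B2 using pos v by (simp add: divide_simps)
  also have "\<dots> = (exp ((1 - 2 * v) * ln 2) * 2 powr (2 * v)) * (sqrt pi * sqrt pi) / 2"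
    unfolding dup using pos by (simp add: divide_simps)
  also have "\<dots> = pi" unfolding e2 by simp
  finally show ?thesis .
qed

text \<open>On (-b, b) the density is a multiple of ((b + x) (b - x))^(v - 1/2), so the shifted
  moments are Beta integrals. The case k = 0 says that the total mass is 1.\<close>

lemma conditional_density_moments:
  assumes v: "0 < v" and b: "0 < b"
  shows "(\<integral>\<^sup>+ x. ennreal (conditional_density v b x) * ennreal ((x + b) ^ k) \<partial>lborel)
    = ennreal ((2 * b) ^ k * pochhammer (v + 1 / 2) k / pochhammer (2 * v + 1) k)"
proof -
  define C where "C = v * Beta v (1 / 2) / pi * b powr (- (2 * v))"
  have B0: "0 \<le> Beta v (1 / 2)" using v by (simp add: Beta_def)
  then have C0: "0 \<le> C" using v by (simp add: C_def)
  have "(\<integral>\<^sup>+ x. ennreal (conditional_density v b x) * ennreal ((x + b) ^ k) \<partial>lborel)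
    = (\<integral>\<^sup>+ x. ennreal C * (ennreal ((x - (- b)) powr (v + 1 / 2 + real k - 1) * (b - x) powr (v + 1 / 2 - 1)) * indicator {- b<..<b} x) \<partial>lborel)"
  proof (rule nn_integral_cong)
    fix x :: real
    show "ennreal (conditional_density v b x) * ennreal ((x + b) ^ k) =
      ennreal C * (ennreal ((x - (- b)) powr (v + 1 / 2 + real k - 1) * (b - x) powr (v + 1 / 2 - 1)) * indicator {- b<..<b} x)"
    proof (cases "\<bar>x\<bar> < b")
      case True
      then have p: "0 < b + x" "0 < b - x" by auto
      have "1 - x\<^sup>2 / b\<^sup>2 = (b + x) * (b - x) / b powr 2"
        using b by (simp add: powr_numeral power2_eq_square divide_simps) (simp add: algebra_simps)
      then have e1: "(1 - x\<^sup>2 / b\<^sup>2) powr (v - 1 / 2) = (b + x) powr (v - 1 / 2) * (b - x) powr (v - 1 / 2) / b powr (2 * (v - 1 / 2))"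
        using p b powr_powr[of b 2 "v - 1 / 2"] by (simp add: powr_divide powr_mult del: powr_powr powr_numeral)
      have e2: "b powr (2 * v) = b * b powr (2 * (v - 1 / 2))"
        using b powr_add[of b 1 "2 * (v - 1 / 2)"] by simp
      have e3: "(b + x) powr (v + 1 / 2 + real k - 1) = (b + x) powr (v - 1 / 2) * (b + x) ^ k"
      proof -
        have "v + 1 / 2 + real k - 1 = (v - 1 / 2) + real k" by simp
        then show ?thesis using p by (simp only: powr_add powr_realpow)
      qed
      have e4: "x - (- b) = b + x" "v + 1 / 2 - 1 = v - 1 / 2" "x + b = b + x" by simp_all
      have cd: "conditional_density v b x = v * Beta v (1 / 2) / (pi * b) * (1 - x\<^sup>2 / b\<^sup>2) powr (v - 1 / 2)"
        using True by (simp add: conditional_density_def)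
      have "conditional_density v b x * (x + b) ^ k =
         C * ((x - (- b)) powr (v + 1 / 2 + real k - 1) * (b - x) powr (v + 1 / 2 - 1))"
        unfolding C_def powr_minus_divide e2 e4 e3 cd e1 by (simp add: mult_ac)
      then show ?thesis using True p C0 conditional_density_nonneg[OF v, of b x]
        by (simp add: ennreal_mult[symmetric] abs_less_iff)
    qed (auto simp: conditional_density_def split: split_indicator)
  qed
  also have "\<dots> = ennreal C * ennreal ((b - (- b)) powr (v + 1 / 2 + real k + (v + 1 / 2) - 1) * Beta (v + 1 / 2 + real k) (v + 1 / 2))"
    by (subst nn_integral_cmult, measurable, subst nn_integral_Beta) (use v b in auto)
  also have "\<dots> = ennreal ((2 * b) ^ k * pochhammer (v + 1 / 2) k / pochhammer (2 * v + 1) k)"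
  proof -
    have B: "Beta (v + 1 / 2 + real k) (v + 1 / 2) = Beta (v + 1 / 2) (v + 1 / 2) * pochhammer (v + 1 / 2) k / pochhammer (2 * v + 1) k"
      using Beta_add_nat[of "v + 1 / 2" "v + 1 / 2" k] v by simp
    have P: "(b - (- b)) powr (v + 1 / 2 + real k + (v + 1 / 2) - 1) = 2 powr (2 * v) * b powr (2 * v) * (2 * b) ^ k"
      using b powr_add[of "2 * b" "2 * v" "real k"] powr_realpow[of "2 * b" k] by (simp add: powr_mult add_ac)
    have "C * ((b - (- b)) powr (v + 1 / 2 + real k + (v + 1 / 2) - 1) * Beta (v + 1 / 2 + real k) (v + 1 / 2))
      = (v * Beta v (1 / 2) * 2 powr (2 * v) * Beta (v + 1 / 2) (v + 1 / 2)) / pi * (b powr (- (2 * v)) * b powr (2 * v)) *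
        ((2 * b) ^ k * pochhammer (v + 1 / 2) k / pochhammer (2 * v + 1) k)"
      unfolding B P C_def by simp
    also have "\<dots> = (2 * b) ^ k * pochhammer (v + 1 / 2) k / pochhammer (2 * v + 1) k"
      unfolding Beta_half_product[OF v] using b by (simp add: powr_minus)
    finally show ?thesis using C0 by (simp only: ennreal_mult'[symmetric])
  qed
  finally show ?thesis .
qed

text \<open>The indicator restricts w to w > a with a = x^2 / b^2, and there sqrt (b^2 w - x^2) = b
  sqrt (w - a). What remains is a Beta integral over (a, 1) with parameters 1/2 and v. The divisor v
  reflects Beta 1 v = 1 / v.\<close>

lemma nn_integral_conditional_density:
  assumes v: "0 < v" and b: "0 < b"
  shows "(\<integral>\<^sup>+ w\<in>{0<..<1}. ennreal ((1 - w) powr (v - 1) * (1 / pi) *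
      (indicator {w. \<bar>x\<bar> < b * sqrt w} w / sqrt (b\<^sup>2 * w - x\<^sup>2))) \<partial>lborel) = ennreal (conditional_density v b x / v)"
proof -
  define a where "a = x\<^sup>2 / b\<^sup>2"
  have a0: "0 \<le> a" by (simp add: a_def)
  have cond: "\<bar>x\<bar> < b * sqrt w \<longleftrightarrow> a < w" if "0 < w" for w
  proof -
    have "\<bar>x\<bar> < b * sqrt w \<longleftrightarrow> \<bar>x\<bar>\<^sup>2 < (b * sqrt w)\<^sup>2"
    proof
      assume "\<bar>x\<bar> < b * sqrt w"
      then show "\<bar>x\<bar>\<^sup>2 < (b * sqrt w)\<^sup>2" by (rule power_strict_mono) auto
    next
      assume "\<bar>x\<bar>\<^sup>2 < (b * sqrt w)\<^sup>2"
      then show "\<bar>x\<bar> < b * sqrt w" by (rule power2_less_imp_less) (use b that in simp)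
    qed
    also have "\<dots> \<longleftrightarrow> a < w" using b that by (simp add: a_def power_mult_distrib pos_divide_less_eq mult.commute)
    finally show ?thesis .
  qed
  have "(\<integral>\<^sup>+ w\<in>{0<..<1}. ennreal ((1 - w) powr (v - 1) * (1 / pi) *
      (indicator {w. \<bar>x\<bar> < b * sqrt w} w / sqrt (b\<^sup>2 * w - x\<^sup>2))) \<partial>lborel)
    = (\<integral>\<^sup>+ w. ennreal (1 / (pi * b)) * (ennreal ((w - a) powr (1 / 2 - 1) * (1 - w) powr (v - 1)) * indicator {a<..<1} w) \<partial>lborel)"
  proof (rule nn_integral_cong)
    fix w :: real
    show "ennreal ((1 - w) powr (v - 1) * (1 / pi) * (indicator {w. \<bar>x\<bar> < b * sqrt w} w / sqrt (b\<^sup>2 * w - x\<^sup>2))) * indicator {0<..<1} w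
      = ennreal (1 / (pi * b)) * (ennreal ((w - a) powr (1 / 2 - 1) * (1 - w) powr (v - 1)) * indicator {a<..<1} w)"
    proof (cases "a < w \<and> w < 1")
      case True
      then have w: "0 < w" "w < 1" "0 < w - a" using a0 by auto
      have "b\<^sup>2 * w - x\<^sup>2 = b\<^sup>2 * (w - a)" using b by (simp add: a_def right_diff_distrib)
      then have "sqrt (b\<^sup>2 * w - x\<^sup>2) = b * sqrt (w - a)" using b by (simp add: real_sqrt_mult)
      moreover have "(w - a) powr (1 / 2 - 1) = 1 / sqrt (w - a)"
        using w by (simp add: powr_minus powr_half_sqrt divide_simps)
      ultimately show ?thesis using True w cond[of w] b
        by (simp add: ennreal_mult[symmetric] mult_ac)
    next
      case False
      then show ?thesis using cond[of w] by (auto split: split_indicator)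
    qed
  qed
  also have "\<dots> = ennreal (1 / (pi * b)) * (\<integral>\<^sup>+ w\<in>{a<..<1}. ennreal ((w - a) powr (1 / 2 - 1) * (1 - w) powr (v - 1)) \<partial>lborel)"
    by (rule nn_integral_cmult) measurable
  also have "\<dots> = ennreal (conditional_density v b x / v)"
  proof (cases "a < 1")
    case True
    then have x: "\<bar>x\<bar> < b" using cond[of 1] by simp
    have "(\<integral>\<^sup>+ w\<in>{a<..<1}. ennreal ((w - a) powr (1 / 2 - 1) * (1 - w) powr (v - 1)) \<partial>lborel)
      = ennreal ((1 - a) powr (1 / 2 + v - 1) * Beta (1 / 2) v)"
      using True v by (intro nn_integral_Beta) auto
    also have "ennreal (1 / (pi * b)) * \<dots> = ennreal (conditional_density v b x / v)"
      using x v b by (simp add: ennreal_mult'[symmetric] conditional_density_def a_def Beta_commute[of "1 / 2" v] mult_ac add.commute)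
    finally show ?thesis .
  next
    case False
    then have "{a<..<1} = {}" by auto
    moreover have "\<not> \<bar>x\<bar> < b" using False cond[of 1] by simp
    ultimately show ?thesis by (simp add: conditional_density_def)
  qed
  finally show ?thesis .
qed

text \<open>The left side is the conditional moment of the shifted position for c = s = 1, the right
  side the shifted moment of \<open>conditional_density\<close> for b = 1.\<close>

lemma flight_coeff_closed_form:
  assumes "m \<in> {0, 1}"
  shows "fact n * fact k / fact (k + n) * flight_coeff m (Suc n) k =
    2 ^ k * pochhammer (shape m n + 1 / 2) k / pochhammer (2 * shape m n + 1) k"
proof (cases "m = 0")
  case True
  then have d: "direction_moment m = (\<lambda>k. 2 ^ k * pochhammer (1 / 2) k / fact k)"
    by (simp add: fun_eq_iff direction_moment_def)
  show ?thesis unfolding flight_coeff_def d moments_planar using True by (simp add: shape_def)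
next
  case False
  then have d: "direction_moment m = (\<lambda>k. 8 * 2 ^ k * (pochhammer (1 / 2) (Suc k) / fact (Suc k) - pochhammer (1 / 2) (Suc (Suc k)) / fact (Suc (Suc k))))"
    by (simp add: fun_eq_iff direction_moment_def del: fact_Suc)
  have "real n + 3 / 2 = shape m n + 1 / 2" "2 * real n + 3 = 2 * shape m n + 1"
    using False by (auto simp: shape_def)
  then show ?thesis unfolding flight_coeff_def d moments_semicircle by (simp only:)
qed

context flight
begin

lemma shape_pos: "0 < shape m n" using n by (simp add: shape_def)

text \<open>The moment of order 0 in \<open>nn_integral_shifted_motion\<close>.\<close>

lemma emeasure_count_event:
  assumes s: "0 < s"
  shows "emeasure M (count_event s) = ennreal (lam ^ n * exp (- lam * s) * (s ^ n / fact n))"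
proof -
  have "flight_coeff m (Suc n) 0 = 1"
    using flight_coeff_closed_form[OF m, of n 0] by simp
  then show ?thesis
    using nn_integral_shifted_motion[OF s, of 0] count_event_sets[of s] s by simp
qed

text \<open>After a shift by c s both laws live on [0, 2 c s], where comparing moments suffices; the
  shift is then undone.\<close>

lemma distr_motion:
  assumes s: "0 < s"
  shows "distr (uniform_measure M (count_event s)) borel (motion c S \<theta> s)
    = density lborel (\<lambda>x. ennreal (conditional_density (shape m n) (c * s) x))"
proof -
  let ?A = "count_event s" and ?v = "shape m n" and ?b = "c * s"
  let ?U = "uniform_measure M ?A" and ?D = "density lborel (\<lambda>x. ennreal (conditional_density ?v ?b x))"
  let ?Y = "(\<lambda>\<omega>. motion c S \<theta> s \<omega> + ?b)"
  have b: "0 < ?b" using c s by simp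
  have [measurable]: "motion c S \<theta> s \<in> borel_measurable M" "?A \<in> sets M"
    using measurable_motion[of s] count_event_sets[of s] s by auto
  define p where "p = lam ^ n * exp (- lam * s) * (s ^ n / fact n)"
  have p: "0 < p" using lam s by (simp add: p_def)
  have A: "emeasure M ?A = ennreal p" unfolding p_def by (rule emeasure_count_event[OF s])
  have prob_U: "prob_space ?U"
    by (rule prob_space_uniform_measure) (use A p in auto)
  have prob_D: "prob_space ?D"
    using conditional_density_moments[OF shape_pos b, of 0] by (intro prob_spaceI) (simp add: emeasure_density)
  have "distr ?U borel ?Y = distr ?D borel (\<lambda>x. x + ?b)"
  proof (rule measure_eqI_moments[where K = "2 * ?b"])
    show "prob_space (distr ?U borel ?Y)"
      by (rule prob_space.prob_space_distr[OF prob_U]) simp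
    show "prob_space (distr ?D borel (\<lambda>x. x + ?b))"
      by (rule prob_space.prob_space_distr[OF prob_D]) simp
    have "AE \<omega> in ?U. 0 \<le> motion c S \<theta> s \<omega> + ?b \<and> motion c S \<theta> s \<omega> + ?b \<le> 2 * ?b"
    proof (rule AE_uniform_measureI)
      show "AE \<omega> in M. \<omega> \<in> ?A \<longrightarrow> 0 \<le> motion c S \<theta> s \<omega> + ?b \<and> motion c S \<theta> s \<omega> + ?b \<le> 2 * ?b"
        using AE_gaps AE_space
      proof eventually_elim
        case (elim \<omega>)
        show ?case using count_event_gaps(3)[OF elim, of s] by (simp add: mult.assoc)
      qed
    qed simp
    then show "AE x in distr ?U borel ?Y. 0 \<le> x \<and> x \<le> 2 * ?b"
      by (subst AE_distr_iff) auto
    have "AE x in ?D. 0 \<le> x + ?b \<and> x + ?b \<le> 2 * ?b"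
      by (subst AE_density) (auto simp: conditional_density_def)
    then show "AE x in distr ?D borel (\<lambda>x. x + ?b). 0 \<le> x \<and> x \<le> 2 * ?b"
      by (subst AE_distr_iff) auto
    fix k
    have "(\<integral>\<^sup>+ x. ennreal (x ^ k) \<partial>distr ?U borel ?Y) = (\<integral>\<^sup>+ \<omega>. ennreal ((motion c S \<theta> s \<omega> + ?b) ^ k) \<partial>?U)"
      by (rule nn_integral_distr) auto
    also have "\<dots> = (\<integral>\<^sup>+ \<omega>. ennreal ((motion c S \<theta> s \<omega> + ?b) ^ k) * indicator ?A \<omega> \<partial>M) / emeasure M ?A"
      by (rule nn_integral_uniform_measure) auto
    also have "\<dots> = ennreal (c ^ k * fact k * flight_coeff m (Suc n) k * (lam ^ n * exp (- lam * s) * (s ^ (k + n) / fact (k + n))) / p)"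
      unfolding nn_integral_shifted_motion[OF s] A
      using c lam s flight_coeff_nonneg[OF m, of "Suc n" k] by (intro divide_ennreal p mult_nonneg_nonneg) auto
    \<comment> \<open>The Poisson factor lam^n exp(-lam s) cancels, so the conditional law is free
      of \<open>lam\<close>.\<close>
    also have "c ^ k * fact k * flight_coeff m (Suc n) k * (lam ^ n * exp (- lam * s) * (s ^ (k + n) / fact (k + n))) / p
      = ?b ^ k * (fact n * fact k / fact (k + n) * flight_coeff m (Suc n) k)"
      unfolding p_def using lam s by (simp add: power_mult_distrib power_add)
    also have "\<dots> = (2 * ?b) ^ k * pochhammer (?v + 1 / 2) k / pochhammer (2 * ?v + 1) k"
      unfolding flight_coeff_closed_form[OF m] by (simp add: power_mult_distrib)
    also have "ennreal \<dots> = (\<integral>\<^sup>+ x. ennreal (conditional_density ?v ?b x) * ennreal ((x + ?b) ^ k) \<partial>lborel)"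
      by (rule conditional_density_moments[OF shape_pos b, symmetric])
    also have "\<dots> = (\<integral>\<^sup>+ x. ennreal ((x + ?b) ^ k) \<partial>?D)"
      by (rule nn_integral_density[symmetric]) auto
    also have "\<dots> = (\<integral>\<^sup>+ x. ennreal (x ^ k) \<partial>distr ?D borel (\<lambda>x. x + ?b))"
      by (rule nn_integral_distr[symmetric]) auto
    finally show "(\<integral>\<^sup>+ x. ennreal (x ^ k) \<partial>distr ?U borel ?Y) = (\<integral>\<^sup>+ x. ennreal (x ^ k) \<partial>distr ?D borel (\<lambda>x. x + ?b))" .
  qed auto
  then have "distr (distr ?U borel ?Y) borel (\<lambda>x. x - ?b) = distr (distr ?D borel (\<lambda>x. x + ?b)) borel (\<lambda>x. x - ?b)"
    by simp
  then have "distr ?U borel (motion c S \<theta> s) = distr ?D borel (\<lambda>x. x)"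
    by (subst (asm) (1 2) distr_distr) (auto simp: comp_def)
  then show ?thesis by (simp add: distr_id2)
qed

end

lemma (in flight) conditional_density_is_cond_density:
  "is_cond_density M (motion c S \<theta>) (event_count S) n (\<lambda>x s. conditional_density (shape m n) (c * s) x)"
  unfolding is_cond_density_def
proof (intro conjI allI impI)
  have [measurable]: "(\<lambda>z. fst z) \<in> borel_measurable (borel \<Otimes>\<^sub>M restrict_space borel {0<..} :: (real \<times> real) measure)"
    by measurable
  have [measurable]: "(\<lambda>z. snd z) \<in> borel_measurable (borel \<Otimes>\<^sub>M restrict_space borel {0<..} :: (real \<times> real) measure)"
    by (rule measurable_compose[OF measurable_snd]) (simp add: measurable_restrict_space1)
  show "(\<lambda>(x, s). conditional_density (shape m n) (c * s) x) \<in> borel_measurable (borel \<Otimes>\<^sub>M restrict_space borel {0<..})"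
    unfolding case_prod_beta' by measurable
qed (auto intro: conditional_density_nonneg shape_pos distr_motion)

section \<open>Uniqueness of conditional densities and the mixture\<close>

lemma is_cond_density_measurable:
  assumes "is_cond_density M X N n p"
  shows "(\<lambda>(x, s). if 0 < s then p x s else 0) \<in> borel_measurable (borel \<Otimes>\<^sub>M borel)"
proof -
  have "(\<lambda>(x, s). p x s) \<in> borel_measurable (borel \<Otimes>\<^sub>M restrict_space borel {0<..})"
    using assms by (simp add: is_cond_density_def)
  \<comment> \<open>Nonpositive s are sent to the dummy point 1 of the half-line; the value taken
    there is overwritten by 0 afterwards.\<close>
  moreover have "(\<lambda>z. (fst z, if 0 < snd z then snd z else 1)) \<in> measurable (borel \<Otimes>\<^sub>M borel) (borel \<Otimes>\<^sub>M restrict_space (borel :: real measure) {0<..})"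
    by (intro measurable_Pair measurable_restrict_space2) auto
  ultimately have "(\<lambda>z. (\<lambda>(x, s). p x s) (fst z, if 0 < snd z then snd z else 1)) \<in> borel_measurable (borel \<Otimes>\<^sub>M borel)"
    by (rule measurable_compose[rotated])
  then have [measurable]: "(\<lambda>z. p (fst z) (if 0 < snd z then snd z else 1)) \<in> borel_measurable (borel \<Otimes>\<^sub>M borel)"
    unfolding split .
  have "(\<lambda>z. if 0 < snd z then p (fst z) (if 0 < snd z then snd z else 1) else 0) \<in> borel_measurable (borel \<Otimes>\<^sub>M (borel :: real measure))"
    by measurable
  then show ?thesis
    by (rule measurable_cong[THEN iffD1, rotated]) auto
qed

text \<open>For each s > 0 two densities of the same law agree for almost all x. Joint measurability
  makes the set of agreement measurable in the plane, so Fubini exchanges the order of the null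
  sets.\<close>

lemma is_cond_density_unique:
  assumes p: "is_cond_density M X N n p" and q: "is_cond_density M X N n q"
  shows "AE x in lborel. AE s in lborel. 0 < s \<longrightarrow> p x s = q x s"
proof -
  define p' q' where "p' x s = (if 0 < s then p x s else 0)" and "q' x s = (if 0 < s then q x s else 0)" for x s :: real
  have pm [measurable]: "(\<lambda>(x, s). p' x s) \<in> borel_measurable (borel \<Otimes>\<^sub>M borel)"
    and qm [measurable]: "(\<lambda>(x, s). q' x s) \<in> borel_measurable (borel \<Otimes>\<^sub>M borel)"
    unfolding p'_def q'_def using is_cond_density_measurable[OF p] is_cond_density_measurable[OF q] by auto
  have "AE x in lborel. p' x s = q' x s" for s
  proof (cases "0 < s")
    case True
    have m: "(\<lambda>x. p' x s) \<in> borel_measurable borel" "(\<lambda>x. q' x s) \<in> borel_measurable borel"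
      using measurable_compose[OF measurable_Pair2'[of s borel borel] pm] measurable_compose[OF measurable_Pair2'[of s borel borel] qm] by simp_all
    have "density lborel (\<lambda>x. ennreal (q x s)) = density lborel (\<lambda>x. ennreal (p x s))"
      using p q True unfolding is_cond_density_def by metis
    then have "density lborel (\<lambda>x. ennreal (q' x s)) = density lborel (\<lambda>x. ennreal (p' x s))"
      using True by (simp add: p'_def q'_def)
    then have "AE x in lborel. ennreal (q' x s) = ennreal (p' x s)"
      using m by (subst (asm) sigma_finite_measure.density_unique_iff[OF sigma_finite_lborel]) auto
    moreover have "0 \<le> p' x s" "0 \<le> q' x s" for x
      using p q True by (auto simp: p'_def q'_def is_cond_density_def)
    ultimately show ?thesis by (auto elim!: eventually_mono)
  qed (simp add: p'_def q'_def)
  then have AE: "AE s in lborel. AE x in lborel. p' x s = q' x s" by simp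
  have "(\<lambda>(x, s). p' x s) \<in> borel_measurable (lborel \<Otimes>\<^sub>M lborel)" "(\<lambda>(x, s). q' x s) \<in> borel_measurable (lborel \<Otimes>\<^sub>M lborel)"
    using pm qm unfolding measurable_cong_sets[OF sets_pair_measure_cong[OF sets_lborel sets_lborel] refl] by auto
  then have "{z \<in> space (lborel \<Otimes>\<^sub>M lborel). p' (fst z) (snd z) = q' (fst z) (snd z)} \<in> sets (lborel \<Otimes>\<^sub>M lborel)"
    unfolding case_prod_beta' by measurable
  then have "AE x in lborel. AE s in lborel. p' x s = q' x s"
    using AE lborel_pair.AE_commute[of "\<lambda>x s. p' x s = q' x s"] by blast
  then show ?thesis
    by (elim eventually_mono) (auto simp: p'_def q'_def elim!: eventually_mono)
qed

lemma arcsine_mult: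
  fixes w k :: real
  assumes "0 < w" "0 \<le> k"
  shows "ennreal (w / pi) * (ennreal (1 / sqrt (s * (t - s))) * ennreal (k / w) * indicator {0<..<t} s) = ennreal (arcsine_density t s) * ennreal k"
proof (cases "s \<in> {0<..<t}")
  case True
  then have p: "0 < sqrt (s * (t - s))" by simp
  have "w / pi * (1 / sqrt (s * (t - s)) * (k / w)) = 1 / (pi * sqrt (s * (t - s))) * k"
    using assms by simp
  then have "ennreal (w / pi) * (ennreal (1 / sqrt (s * (t - s))) * ennreal (k / w)) = ennreal (1 / (pi * sqrt (s * (t - s)))) * ennreal k"
    using assms p by (simp only: ennreal_mult'[symmetric] divide_nonneg_nonneg less_imp_le pi_ge_zero zero_le_one mult_nonneg_nonneg)
  then show ?thesis using True by (simp only: arcsine_density_def indicator_simps mult_1_right)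
qed (simp add: arcsine_density_def)
theorem theorem4p4:
  fixes M :: "'a measure"
    and c lam t :: real
    and m n :: nat
    and S \<theta> :: "nat \<Rightarrow> 'a \<Rightarrow> real"
    and B :: "real \<Rightarrow> 'a \<Rightarrow> real"
  assumes "prob_space M"
    and "0 < c" and "0 < lam" and "0 < t"
    and "m \<in> {0, 1}" and "1 \<le> n"
    and "poisson_event_times M lam S"
    and "iid_directions M m \<theta>"
    and "indep_elements M
           (Pi\<^sub>M UNIV (\<lambda>_. borel)) (\<lambda>\<omega>. \<lambda>j\<in>UNIV. S j \<omega>)
           (Pi\<^sub>M {1..} (\<lambda>_. borel)) (\<lambda>\<omega>. \<lambda>j\<in>{1..}. \<theta> j \<omega>)"
    and "brownian_motion M B"
    and "indep_elements M
           (Pi\<^sub>M {0..} (\<lambda>_. borel)) (\<lambda>\<omega>. \<lambda>s\<in>{0..}. B s \<omega>)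
           (Pi\<^sub>M {0..} (\<lambda>_. borel \<Otimes>\<^sub>M count_space UNIV))
             (\<lambda>\<omega>. \<lambda>s\<in>{0..}. (motion c S \<theta> s \<omega>, event_count S s \<omega>))"
  shows "(\<exists>p. is_cond_density M (motion c S \<theta>) (event_count S) n p) \<and>
    (\<forall>p. is_cond_density M (motion c S \<theta>) (event_count S) n p \<longrightarrow>
      (AE x in lborel.
        fixed_count_density M p (sojourn_time B t) x =
          ennreal (1 / (Beta 1 (shape m n) * pi)) *
          (\<integral>\<^sup>+ s\<in>{0<..<t}. ennreal (1 / sqrt (s * (t - s))) *
             (\<integral>\<^sup>+ w\<in>{0<..<1}.
                ennreal ((1 - w) powr (shape m n - 1) * (1 / pi) *
                  (indicator {w. \<bar>x\<bar> < c * s * sqrt w} w / sqrt (c\<^sup>2 * s\<^sup>2 * w - x\<^sup>2))) \<partial>lborel)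
           \<partial>lborel)))"
proof -
  interpret prob_space M by fact
  \<comment> \<open>Independence of the two families includes their measurability, from which that
    of position and count at each time is read off.\<close>
  have pair: "(\<lambda>\<omega>. (motion c S \<theta> s \<omega>, event_count S s \<omega>)) \<in> measurable M (borel \<Otimes>\<^sub>M count_space UNIV)" if "0 \<le> s" for s
  proof -
    have "(\<lambda>\<omega>. \<lambda>s\<in>{0..}. (motion c S \<theta> s \<omega>, event_count S s \<omega>)) \<in> measurable M (Pi\<^sub>M {0..} (\<lambda>_. borel \<Otimes>\<^sub>M count_space UNIV))"
      using assms(11) by (simp add: indep_elements_def)
    from measurable_compose[OF this measurable_component_singleton[of s]] show ?thesis using that by simp
  qed
  interpret flight M c lam m n S \<theta>
  proof
    show "motion c S \<theta> s \<in> borel_measurable M" if "0 \<le> s" for s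
      using measurable_compose[OF pair[OF that] measurable_fst] by simp
    show "event_count S s \<in> measurable M (count_space UNIV)" if "0 \<le> s" for s
      using measurable_compose[OF pair[OF that] measurable_snd] by simp
  qed fact+
  interpret brownian M B by unfold_locales fact
  let ?v = "shape m n"
  let ?k = "\<lambda>x s. conditional_density ?v (c * s) x"
  let ?I = "\<lambda>x s. (\<integral>\<^sup>+ w\<in>{0<..<1}.
                ennreal ((1 - w) powr (?v - 1) * (1 / pi) *
                  (indicator {w. \<bar>x\<bar> < c * s * sqrt w} w / sqrt (c\<^sup>2 * s\<^sup>2 * w - x\<^sup>2))) \<partial>lborel)"
  note v = shape_pos
  \<comment> \<open>As Beta 1 v = 1 / v, the prefactor cancels the 1 / v of the inner integral and
    leaves the 1 / \<pi> of the arcsine density.\<close>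
  have Bt: "1 / (Beta 1 ?v * pi) = ?v / pi"
  proof -
    have "?v \<notin> \<int>\<^sub>\<le>\<^sub>0" using v nonpos_Ints_nonpos[of ?v] by auto
    then have "Beta 1 ?v = 1 / ?v"
      using v Gamma_plus1[of ?v] by (auto simp: Beta_def add.commute Gamma_eq_zero_iff)
    then show ?thesis by simp
  qed
  have rhs: "ennreal (1 / (Beta 1 ?v * pi)) *
          (\<integral>\<^sup>+ s\<in>{0<..<t}. ennreal (1 / sqrt (s * (t - s))) *
             (?I x s)
           \<partial>lborel) = (\<integral>\<^sup>+ s. ennreal (arcsine_density t s) * ennreal (?k x s) \<partial>lborel)" for x
  proof -
    have e: "(\<integral>\<^sup>+ s\<in>{0<..<t}. ennreal (1 / sqrt (s * (t - s))) *
             (?I x s)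
           \<partial>lborel) = (\<integral>\<^sup>+ s\<in>{0<..<t}. ennreal (1 / sqrt (s * (t - s))) * ennreal (?k x s / ?v) \<partial>lborel)"
    proof (rule nn_integral_cong)
      fix s :: real
      show "ennreal (1 / sqrt (s * (t - s))) *
             (?I x s) * indicator {0<..<t} s =
           ennreal (1 / sqrt (s * (t - s))) * ennreal (?k x s / ?v) * indicator {0<..<t} s"
      proof (cases "s \<in> {0<..<t}")
        case True
        then have "0 < c * s" using c by simp
        from nn_integral_conditional_density[OF v this, of x]
        show ?thesis by (simp only: power_mult_distrib)
      qed simp
    qed
    have "ennreal (1 / (Beta 1 ?v * pi)) * (\<integral>\<^sup>+ s\<in>{0<..<t}. ennreal (1 / sqrt (s * (t - s))) * ennreal (?k x s / ?v) \<partial>lborel) =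
      (\<integral>\<^sup>+ s. ennreal (1 / (Beta 1 ?v * pi)) * (ennreal (1 / sqrt (s * (t - s))) * ennreal (?k x s / ?v) * indicator {0<..<t} s) \<partial>lborel)"
      by (rule nn_integral_cmult[symmetric]) measurable
    also have "\<dots> = (\<integral>\<^sup>+ s. ennreal (arcsine_density t s) * ennreal (?k x s) \<partial>lborel)"
    proof (rule nn_integral_cong)
      fix s :: real
      show "ennreal (1 / (Beta 1 ?v * pi)) * (ennreal (1 / sqrt (s * (t - s))) * ennreal (?k x s / ?v) * indicator {0<..<t} s)
        = ennreal (arcsine_density t s) * ennreal (?k x s)"
        unfolding Bt by (rule arcsine_mult[OF v conditional_density_nonneg[OF v]])
    qed
    finally show ?thesis unfolding e .
  qed
  show ?thesis
  proof (intro conjI allI impI)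
    show "\<exists>p. is_cond_density M (motion c S \<theta>) (event_count S) n p"
      using conditional_density_is_cond_density by blast
  next
    fix p assume p: "is_cond_density M (motion c S \<theta>) (event_count S) n p"
    have pm: "(\<lambda>(x, s). if 0 < s then p x s else 0) \<in> borel_measurable (borel \<Otimes>\<^sub>M borel)"
      by (rule is_cond_density_measurable[OF p])
    have "AE x in lborel. AE s in lborel. 0 < s \<longrightarrow> p x s = ?k x s"
      using p conditional_density_is_cond_density by (rule is_cond_density_unique)
    then show "AE x in lborel. fixed_count_density M p (sojourn_time B t) x = ennreal (1 / (Beta 1 ?v * pi)) *
          (\<integral>\<^sup>+ s\<in>{0<..<t}. ennreal (1 / sqrt (s * (t - s))) *
             (?I x s)
           \<partial>lborel)"
    proof eventually_elim
      case (elim x)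
      have [measurable]: "(\<lambda>s. if 0 < s then p x s else 0) \<in> borel_measurable borel"
        using measurable_compose[OF measurable_Pair1'[of x borel borel] pm] by simp
      \<comment> \<open>Only s > 0 is integrated over, so \<open>p\<close> may be replaced by its
        cut-off version, which is measurable on the whole line.\<close>
      have "fixed_count_density M p (sojourn_time B t) x = (\<integral>\<^sup>+ s. ennreal (if 0 < s then p x s else 0) \<partial>distr M borel (sojourn_time B t))"
        unfolding fixed_count_density_def by (rule nn_integral_cong) (auto split: split_indicator)
      also have "\<dots> = (\<integral>\<^sup>+ s. ennreal (arcsine_density t s) * ennreal (if 0 < s then p x s else 0) \<partial>lborel)"
        unfolding arcsine_law[OF \<open>0 < t\<close>] by (rule nn_integral_density) auto
      \<comment> \<open>Equality for almost every s > 0 suffices, because the sojourn time has a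
        Lebesgue density and this density vanishes for s \<le> 0.\<close>
      also have "\<dots> = (\<integral>\<^sup>+ s. ennreal (arcsine_density t s) * ennreal (?k x s) \<partial>lborel)"
        using elim by (intro nn_integral_cong_AE) (auto elim!: eventually_mono simp: arcsine_density_def)
      finally show ?case unfolding rhs .
    qed
  qed
qed

end
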